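(* Let $\gamma>\gamma^\star$. (1) If $\mathcal{K}_\gamma$ contains a non-minimal dynamical controller, then $\mathcal{K}_\gamma$ is path-connected. (2) Suppose the plant is single-input or single-output, i.e. $n_u=1$ or $n_y=1$. Then $\mathcal{K}_\gamma$ is path-connected if and only if it contains a non-minimal dynamical controller.
   Context: Consider the continuous-time linear plant $\dot x=Ax+B_1w+B_2u$, $z=C_1x+D_{11}w+D_{12}u$, $y=C_2x+D_{21}w$, with $x\in\mathbb{R}^{n_x}$, $w\in\mathbb{R}^{n_w}$, $u\in\mathbb{R}^{n_u}$, $y\in\mathbb{R}^{n_y}$, $z\in\mathbb{R}^{n_z}$ and real matrices of compatible dimensions; assume $(A,B_2)$ stabilizable and $(C_2,A)$ detectable. A full-order controller $\dot\xi=A_K\xi+B_Ky$, $u=C_K\xi+D_Ky$, $\xi\in\mathbb{R}^{n_x}$, is identified with $K=\begin{bmatrix}D_K & C_K\\ B_K & A_K\end{bmatrix}$. Closed-loop matrices: $A_{cl}=\begin{bmatrix}A+B_2D_KC_2 & B_2C_K\\ B_KC_2 & A_K\end{bmatrix}$, $B_{cl}=\begin{bmatrix}B_1+B_2D_KD_{21}\\ B_KD_{21}\end{bmatrix}$, $C_{cl}=\begin{bmatrix}C_1+D_{12}D_KC_2 & D_{12}C_K\end{bmatrix}$, $D_{cl}=D_{11}+D_{12}D_KD_{21}$; $\mathcal{C}_{stab}$ is the set of $K$ with $A_{cl}$ Hurwitz; $\mathbf{T}_{zw}(s)=C_{cl}(sI-A_{cl})^{-1}B_{cl}+D_{cl}$;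 $\mathcal{K}_\gamma=\{K\in\mathcal{C}_{stab}:\|\mathbf{T}_{zw}\|_\infty<\gamma\}$; $\gamma^\star=\inf_{K\in\mathcal{C}_{stab}}\|\mathbf{T}_{zw}\|_\infty$. A controller $K$ is non-minimal if its state-space realization $(A_K,B_K,C_K,D_K)$ is not minimal, i.e. $(A_K,B_K)$ is not controllable or $(C_K,A_K)$ is not observable. *)

theory Defs
  imports "HOL-Analysis.Analysis"
begin

record ('nx, 'nw, 'nu, 'ny, 'nz) plant =
  pA   :: "real^'nx^'nx"
  pB1  :: "real^'nw^'nx"
  pB2  :: "real^'nu^'nx"
  pC1  :: "real^'nx^'nz"
  pD11 :: "real^'nw^'nz"
  pD12 :: "real^'nu^'nz"
  pC2  :: "real^'nx^'ny"
  pD21 :: "real^'nw^'ny"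

text \<open>A full-order controller K = [D_K C_K; B_K A_K], stored as (D_K, C_K, B_K, A_K).\<close>
type_synonym ('nx, 'nu, 'ny) ctrl =
  "(real^'ny^'nu) \<times> (real^'nx^'nu) \<times> (real^'ny^'nx) \<times> (real^'nx^'nx)"

definition cmat :: "real^'n^'m \<Rightarrow> complex^'n^'m" where
  "cmat M = (\<chi> i j. complex_of_real (M $ i $ j))"

definition mpow :: "('a::semiring_1)^'n^'n \<Rightarrow> nat \<Rightarrow> 'a^'n^'n" where
  "mpow M k = ((\<lambda>X. M ** X) ^^ k) (mat 1)"

definition hurwitz :: "real^'n^'n \<Rightarrow> bool" where
  "hurwitz M \<longleftrightarrow> (\<forall>(lam::complex) (v::complex^'n). v \<noteq> 0 \<and> cmat M *v v = lam *s v \<longrightarrow> Re lam < 0)"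

definition stabilizable :: "real^'n^'n \<Rightarrow> real^'m^'n \<Rightarrow> bool" where
  "stabilizable A B \<longleftrightarrow> (\<exists>F::real^'n^'m. hurwitz (A + B ** F))"

definition detectable :: "real^'n^'p \<Rightarrow> real^'n^'n \<Rightarrow> bool" where
  "detectable C A \<longleftrightarrow> (\<exists>L::real^'p^'n. hurwitz (A + L ** C))"

text \<open>(A,B) controllable: the controllability matrix [B, AB, ..., A^(n-1)B] has full rank n,
  i.e. its columns span R^n.\<close>
definition controllable :: "real^'n^'n \<Rightarrow> real^'m^'n \<Rightarrow> bool" where
  "controllable A B \<longleftrightarrow>
     span {mpow A k *v (B *v u) | k u. k < CARD('n)} = (UNIV :: (real^'n) set)"

text \<open>(C,A) observable: the observability matrix [C; CA; ...; CA^(n-1)] has full column rank n,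
  i.e. trivial null space.\<close>
definition observable :: "real^'n^'p \<Rightarrow> real^'n^'n \<Rightarrow> bool" where
  "observable C A \<longleftrightarrow>
     (\<forall>x::real^'n. (\<forall>k < CARD('n). C *v (mpow A k *v x) = 0) \<longrightarrow> x = 0)"

definition nonminimal :: "('nx::finite, 'nu::finite, 'ny::finite) ctrl \<Rightarrow> bool" where
  "nonminimal K = (case K of (DK, CK, BK, AK) \<Rightarrow> \<not> controllable AK BK \<or> \<not> observable CK AK)"

definition Acl :: "('nx::finite, 'nw::finite, 'nu::finite, 'ny::finite, 'nz::finite) plant \<Rightarrow> ('nx, 'nu, 'ny) ctrl \<Rightarrow> real^('nx + 'nx)^('nx + 'nx)" where
  "Acl P K = (case K of (DK, CK, BK, AK) \<Rightarrow>
     (\<chi> i j. case (i, j) of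
        (Inl a, Inl b) \<Rightarrow> (pA P + pB2 P ** DK ** pC2 P) $ a $ b
      | (Inl a, Inr b) \<Rightarrow> (pB2 P ** CK) $ a $ b
      | (Inr a, Inl b) \<Rightarrow> (BK ** pC2 P) $ a $ b
      | (Inr a, Inr b) \<Rightarrow> AK $ a $ b))"

definition Bcl :: "('nx::finite, 'nw::finite, 'nu::finite, 'ny::finite, 'nz::finite) plant \<Rightarrow> ('nx, 'nu, 'ny) ctrl \<Rightarrow> real^'nw^('nx + 'nx)" where
  "Bcl P K = (case K of (DK, CK, BK, AK) \<Rightarrow>
     (\<chi> i j. case i of
        Inl a \<Rightarrow> (pB1 P + pB2 P ** DK ** pD21 P) $ a $ j
      | Inr a \<Rightarrow> (BK ** pD21 P) $ a $ j))"

definition Ccl :: "('nx::finite, 'nw::finite, 'nu::finite, 'ny::finite, 'nz::finite) plant \<Rightarrow> ('nx, 'nu, 'ny) ctrl \<Rightarrow> real^('nx + 'nx)^'nz" where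
  "Ccl P K = (case K of (DK, CK, BK, AK) \<Rightarrow>
     (\<chi> i j. case j of
        Inl b \<Rightarrow> (pC1 P + pD12 P ** DK ** pC2 P) $ i $ b
      | Inr b \<Rightarrow> (pD12 P ** CK) $ i $ b))"

definition Dcl :: "('nx::finite, 'nw::finite, 'nu::finite, 'ny::finite, 'nz::finite) plant \<Rightarrow> ('nx, 'nu, 'ny) ctrl \<Rightarrow> real^'nw^'nz" where
  "Dcl P K = (case K of (DK, CK, BK, AK) \<Rightarrow> pD11 P + pD12 P ** DK ** pD21 P)"

definition Cstab :: "('nx::finite, 'nw::finite, 'nu::finite, 'ny::finite, 'nz::finite) plant \<Rightarrow> ('nx, 'nu, 'ny) ctrl set" where
  "Cstab P = {K. hurwitz (Acl P K)}"

definition Tzw :: "('nx::finite, 'nw::finite, 'nu::finite, 'ny::finite, 'nz::finite) plant \<Rightarrow> ('nx, 'nu, 'ny) ctrl \<Rightarrow> complex \<Rightarrow> complex^'nw^'nz" where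
  "Tzw P K s = cmat (Ccl P K) ** matrix_inv (mat s - cmat (Acl P K)) ** cmat (Bcl P K) + cmat (Dcl P K)"

text \<open>H-infinity norm: supremum over the imaginary axis of the largest singular value,
  i.e. of the operator 2-norm (Euclidean norms on complex^n).\<close>
definition hinf_norm :: "('nx::finite, 'nw::finite, 'nu::finite, 'ny::finite, 'nz::finite) plant \<Rightarrow> ('nx, 'nu, 'ny) ctrl \<Rightarrow> real" where
  "hinf_norm P K = (SUP \<omega>::real. onorm (\<lambda>v. Tzw P K (\<i> * complex_of_real \<omega>) *v v))"

definition Kgamma :: "('nx::finite, 'nw::finite, 'nu::finite, 'ny::finite, 'nz::finite) plant \<Rightarrow> real \<Rightarrow> ('nx, 'nu, 'ny) ctrl set" where
  "Kgamma P \<gamma> = {K \<in> Cstab P. hinf_norm P K < \<gamma>}"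

definition gamma_opt :: "('nx::finite, 'nw::finite, 'nu::finite, 'ny::finite, 'nz::finite) plant \<Rightarrow> real" where
  "gamma_opt P = (INF K \<in> Cstab P. hinf_norm P K)"

end

theory Submission
  imports Defs
begin

text \<open>By the strict bounded real lemma, \<open>K\<close> lies in \<open>Kgamma\<close> iff the closed loop admits a quadratic
  storage function with blocks \<open>X\<close>, \<open>V\<close>, \<open>Z\<close>. After a perturbation \<open>V\<close> is invertible, and a change of
  controller coordinates makes it equal to \<open>- Z\<close>; the controllers with such a normalized certificate (the
  slice) are a continuous image of a convex set, by the usual linearizing change of variables. Since
  \<open>GL\<^sub>n\<close> has two path components, \<open>Kgamma\<close> is the union of the path-connected orbit of the slice under
  the identity component and its mirror image under a reflection. From a non-minimal controller one gets a
  controller in \<open>Kgamma\<close> whose uncontrollable (or unobservable) part is decoupled and equal to \<open>- I\<close>; it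
  is fixed by a reflection, so the two pieces coincide. Conversely, if the plant has a single output (input)
  the determinant of the controllability (observability) matrix of \<open>K\<close> is continuous, changes sign under
  reflections, and does not vanish at minimal controllers.

  For the bounded real lemma, a separation argument reduces the matrix inequality to the frequency
  inequality: a violating positive semidefinite matrix splits into vectors that oscillate at a single
  frequency.\<close>

subsection \<open>The strict Kalman-Yakubovich-Popov lemma\<close>

text \<open>Every condition is a strict inequality for a quadratic form on a finite-dimensional
  space, so it holds with a uniform margin on the unit sphere. This margin is what allows
  \<open>V\<close> to be perturbed, and it turns the pointwise gain estimates into a strict bound on
  their supremum. The sign of \<open>det V\<close> decides which of the two pieces a certificate
  points to. A controller may have certificates of both signs, so the pieces may meet, and no
  continuous choice of certificates is attempted: each controller is joined separately to the slice
  or to its mirror image. A controller fixed by a reflection lies in both pieces because a path from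
  it to the slice can itself be reflected. This is why the uncontrollable block is replaced by - I,
  which commutes with reflections along its directions, while a general stable block need not. The
  replacement only has to lie in \<open>Kgamma\<close>; it is not joined to the original controller
  by hand. The transposed plant exchanges inputs with outputs and controllability with
  observability, so one half of each argument suffices.\<close>

lemmas mat_add_scale_vec = matrix_vector_mult_add_rdistrib scaleR_matrix_vector_assoc[symmetric]

lemmas mat_vec_linear = matrix_vector_right_distrib matrix_vector_mult_scaleR

text \<open>At a zero \<open>x\<close> of the form, moving along \<open>M x\<close> changes its
  value by 2 t |M x|^2 to first order, so a suitable negative \<open>t\<close> would make it
  negative unless \<open>M x = 0\<close>.\<close>

lemma psd_zero_imp_kernel:
  fixes M :: "'a::euclidean_space \<Rightarrow> 'a"
  assumes lin: "linear M" and sym: "\<And>x y. M x \<bullet> y = x \<bullet> M y"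
    and psd: "\<And>x. 0 \<le> M x \<bullet> x" and z: "M x \<bullet> x = 0"
  shows "M x = 0"
proof (rule ccontr)
  assume "M x \<noteq> 0"
  define a where "a = M x \<bullet> M x"
  define b where "b = M (M x) \<bullet> M x"
  have a: "a > 0" using \<open>M x \<noteq> 0\<close> by (simp add: a_def)
  have b: "b \<ge> 0" by (simp add: b_def psd)
  have exp: "M (x + t *\<^sub>R M x) \<bullet> (x + t *\<^sub>R M x) = 2 * t * a + t\<^sup>2 * b" for t
    using z sym[of "M x" x]
    by (simp add: linear_add[OF lin] linear_scale[OF lin] inner_add_left inner_add_right a_def b_def
        power2_eq_square algebra_simps)
  \<comment> \<open>With this step 2 a + t b equals a (b + 2) / (b + 1), still positive; the added 1
    covers b = 0.\<close>
  define t where "t = - a / (b + 1)"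
  have "t < 0" using a b by (simp add: t_def field_simps)
  moreover have "2 * a + t * b > 0"
  proof -
    have "2 * a + t * b = a * (b + 2) / (b + 1)"
      using b by (simp add: t_def field_simps)
    then show ?thesis using a b by simp
  qed
  ultimately have "t * (2 * a + t * b) < 0"
    by (simp add: mult_neg_pos)
  then have "M (x + t *\<^sub>R M x) \<bullet> (x + t *\<^sub>R M x) < 0"
    using exp by (simp add: power2_eq_square algebra_simps)
  then show False using psd[of "x + t *\<^sub>R M x"] by simp
qed

text \<open>Maximizes the Rayleigh quotient of \<open>H\<close> against \<open>G\<close> on the unit
  sphere of the orthogonal complement of ker \<open>G\<close>, where \<open>G\<close> is definite.
  At a maximizer \<open>q\<close> the operator r(q) G - H is semidefinite with vanishing form, so
  \<open>q\<close> lies in its kernel. The hypothesis on kernels lets semidefiniteness pass from the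
  complement to the whole space.\<close>

lemma generalized_eigenvector:
  fixes G H :: "'a::euclidean_space \<Rightarrow> 'a"
  assumes linG: "linear G" and linH: "linear H"
    and symG: "\<And>x y. G x \<bullet> y = x \<bullet> G y" and symH: "\<And>x y. H x \<bullet> y = x \<bullet> H y"
    and psd: "\<And>x. 0 \<le> G x \<bullet> x" and ker: "\<And>x. G x = 0 \<Longrightarrow> H x = 0"
    and nz: "G z \<noteq> 0"
  obtains q \<omega> where "G q \<noteq> 0" "H q = \<omega> *\<^sub>R G q"
proof -
  define N where "N = {x. G x = 0}"
  have subN: "subspace N"
    using linG by (simp add: N_def linear_subspace_kernel)
  define S where "S = sphere 0 1 \<inter> {x. \<forall>y\<in>N. orthogonal y x}"
  have split: "\<exists>y w. y \<in> N \<and> (\<forall>v\<in>N. orthogonal v w) \<and> x = y + w" for x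
  proof -
    obtain y w where "y \<in> span N" "\<And>v. v \<in> span N \<Longrightarrow> orthogonal w v" "x = y + w"
      using orthogonal_subspace_decomp_exists[of N x] by metis
    then show ?thesis
      using subN by (metis orthogonal_commute span_eq_iff)
  qed
  have cS: "compact S"
    unfolding S_def
    by (intro compact_Int_closed) (auto simp: closed_def[symmetric] subspace_orthogonal_to_vectors closed_subspace)
  have Gpos: "G x \<bullet> x > 0" if "\<forall>v\<in>N. orthogonal v x" "x \<noteq> 0" for x
  proof (rule ccontr)
    assume "\<not> ?thesis"
    then have "G x \<bullet> x = 0" using psd[of x] by linarith
    then have "x \<in> N"
      unfolding N_def using psd_zero_imp_kernel[OF linG symG psd] by blast
    then show False using that by (auto simp: orthogonal_def)
  qed
  have normS: "inverse (norm w) *\<^sub>R w \<in> S" if "\<forall>v\<in>N. orthogonal v w" "w \<noteq> 0" for w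
    using that by (auto simp: S_def orthogonal_def)
  obtain y w where yw: "y \<in> N" "\<forall>v\<in>N. orthogonal v w" "z = y + w"
    using split by blast
  have "w \<noteq> 0"
    using nz yw by (auto simp: N_def)
  then have "S \<noteq> {}" using normS yw by blast
  define r where "r x = (H x \<bullet> x) / (G x \<bullet> x)" for x
  have Snz: "x \<noteq> 0" if "x \<in> S" for x using that by (auto simp: S_def)
  have "continuous_on S r"
    unfolding r_def
    by (intro continuous_intros linear_continuous_on linear_conv_bounded_linear[THEN iffD1] linG linH)
      (use Gpos Snz in \<open>force simp: S_def\<close>)
  then obtain q where q: "q \<in> S" "\<And>x. x \<in> S \<Longrightarrow> r x \<le> r q"
    using continuous_attains_sup[OF cS \<open>S \<noteq> {}\<close>] by metis
  define M where "M x = r q *\<^sub>R G x - H x" for x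
  have linM: "linear M"
    unfolding M_def by (intro linear_compose_sub linear_compose_scale_right linG linH)
  have symM: "M x \<bullet> y = x \<bullet> M y" for x y
    by (simp add: M_def inner_diff_left inner_diff_right symG symH)
  have psdM: "0 \<le> M x \<bullet> x" for x
  proof -
    obtain y w where yw: "y \<in> N" "\<forall>v\<in>N. orthogonal v w" "x = y + w"
      using split by blast
    have My: "M y = 0" using yw(1) ker by (simp add: M_def N_def)
    have "M x \<bullet> x = M w \<bullet> w"
      using symM[of w y] by (simp add: yw(3) linear_add[OF linM] My inner_add_right)
    also have "\<dots> \<ge> 0"
    proof (cases "w = 0")
      case False
      let ?c = "inverse (norm w)"
      have "r (?c *\<^sub>R w) \<le> r q" using q normS yw False by blast
      moreover have "r (?c *\<^sub>R w) = r w"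
        using False by (simp add: r_def linear_scale[OF linG] linear_scale[OF linH])
      ultimately have "H w \<bullet> w \<le> r q * (G w \<bullet> w)"
        using Gpos[OF yw(2) False] by (simp add: r_def[of w] pos_divide_le_eq)
      then show ?thesis by (simp add: M_def inner_diff_left)
    qed simp
    finally show ?thesis .
  qed
  have Gq: "G q \<bullet> q > 0" using q(1) Gpos Snz by (force simp: S_def)
  then have "M q \<bullet> q = 0"
    by (simp add: M_def inner_diff_left r_def)
  then have "M q = 0"
    using psd_zero_imp_kernel[OF linM symM psdM] by blast
  show ?thesis
    by (rule that[of q "r q"]) (use Gq \<open>M q = 0\<close> in \<open>auto simp: M_def\<close>)
qed

text \<open>The new family is the matrix with columns \<open>l i\<close> times the projection I - d
  d^T / \<alpha>, so its sum loses exactly one rank-one term. This splits a chosen direction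
  \<open>L\<close> off a family while keeping the form of a sum over a family.\<close>

lemma sum_bilinear_deflate:
  fixes B :: "'a::real_vector \<Rightarrow> 'a \<Rightarrow> 'b::real_vector"
  assumes bil: "bilinear B" and fin: "finite I"
    and L: "L = (\<Sum>i\<in>I. d i *\<^sub>R l i)" and \<alpha>: "\<alpha> = (\<Sum>i\<in>I. (d i)\<^sup>2)" "\<alpha> \<noteq> 0"
  shows "(\<Sum>i\<in>I. B (l i - (d i / \<alpha>) *\<^sub>R L) (l i - (d i / \<alpha>) *\<^sub>R L))
     = (\<Sum>i\<in>I. B (l i) (l i)) - (1 / \<alpha>) *\<^sub>R B L L"
proof -
  have lin1: "linear (\<lambda>x. B x y)" and lin2: "linear (B x)" for x y
    using bil by (auto simp: bilinear_def)
  have "B (l i - (d i / \<alpha>) *\<^sub>R L) (l i - (d i / \<alpha>) *\<^sub>R L) = B (l i) (l i)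
      - (1 / \<alpha>) *\<^sub>R B L (d i *\<^sub>R l i) - (1 / \<alpha>) *\<^sub>R B (d i *\<^sub>R l i) L + (1 / \<alpha>\<^sup>2) *\<^sub>R ((d i)\<^sup>2 *\<^sub>R B L L)" for i
    using \<alpha>(2)
    by (simp add: bilinear_lsub[OF bil] bilinear_rsub[OF bil] bilinear_lmul[OF bil] bilinear_rmul[OF bil]
        power2_eq_square field_simps scaleR_diff_right)
  then have "(\<Sum>i\<in>I. B (l i - (d i / \<alpha>) *\<^sub>R L) (l i - (d i / \<alpha>) *\<^sub>R L)) = (\<Sum>i\<in>I. B (l i) (l i))
      - (1 / \<alpha>) *\<^sub>R (\<Sum>i\<in>I. B L (d i *\<^sub>R l i)) - (1 / \<alpha>) *\<^sub>R (\<Sum>i\<in>I. B (d i *\<^sub>R l i) L)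
      + (1 / \<alpha>\<^sup>2) *\<^sub>R ((\<Sum>i\<in>I. (d i)\<^sup>2) *\<^sub>R B L L)"
    by (simp only: sum.distrib sum_subtractf scaleR_sum_right scaleR_sum_left)
  also have "(\<Sum>i\<in>I. B L (d i *\<^sub>R l i)) = B L L"
    by (subst (3) L) (simp add: linear_sum[OF lin2])
  also have "(\<Sum>i\<in>I. B (d i *\<^sub>R l i) L) = B L L"
    by (subst (2) L) (simp add: linear_sum[OF lin1])
  finally show ?thesis
    using \<alpha>(2) by (simp only: \<alpha>(1)[symmetric]) (simp add: power2_eq_square)
qed

lemma continuous_on_bilinear_diag:
  fixes q :: "'a::euclidean_space \<Rightarrow> 'a \<Rightarrow> 'b::real_normed_vector"
  assumes "bilinear q"
  shows "continuous_on S (\<lambda>l. q l l)"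
  using assms by (intro bounded_bilinear.continuous_on[of q] continuous_on_id)
    (simp add: bilinear_conv_bounded_bilinear)

lemma bilinear_sgn:
  fixes q :: "'a::real_normed_vector \<Rightarrow> 'a \<Rightarrow> real"
  assumes "bilinear q"
  shows "q l l = (norm l)\<^sup>2 * q (sgn l) (sgn l)"
proof (cases "l = 0")
  case False
  then have "l = norm l *\<^sub>R sgn l" by (simp add: sgn_div_norm)
  then show ?thesis
    by (metis bilinear_lmul[OF assms] bilinear_rmul[OF assms] real_scaleR_def power2_eq_square mult.assoc)
qed (simp add: bilinear_lzero[OF assms])

definition outer :: "real^'m \<Rightarrow> real^'n \<Rightarrow> real^'n^'m" where
  "outer a b = (\<chi> i j. a $ i * b $ j)"

lemma outer_mult_vec: "outer a b *v c = (b \<bullet> c) *\<^sub>R a"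
  by (simp add: vec_eq_iff outer_def matrix_vector_mult_def inner_vec_def sum_distrib_left sum_distrib_right
     mult_ac)

lemma bilinear_outer: "bilinear outer"
  by (auto simp: bilinear_def outer_def vec_eq_iff algebra_simps intro!: linearI)

lemma inner_outer: "X \<bullet> outer a b = a \<bullet> (X *v b)"
  by (simp add: inner_vec_def outer_def matrix_vector_mult_def sum_distrib_left mult_ac)

lemma outer_zero [simp]: "outer 0 b = 0" "outer a 0 = 0"
  by (simp_all add: outer_def vec_eq_iff)

text \<open>For \<open>g = fst\<close> and symmetric \<open>X\<close>, pairing with \<open>X\<close>
  on the diagonal gives 2 (X x) . f l, the derivative of x^T X x: this is the adjoint of the
  Lyapunov map, written as a bilinear map so that families can be deflated.\<close>

definition lyap_sym :: "('a \<Rightarrow> real^'n) \<Rightarrow> ('a \<Rightarrow> real^'n) \<Rightarrow> 'a \<Rightarrow> 'a \<Rightarrow> real^'n^'n" where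
  "lyap_sym f g l l' = outer (f l) (g l') + outer (g l) (f l')"

lemma bilinear_lyap_sym:
  assumes "linear f" "linear g"
  shows "bilinear (lyap_sym f g)"
proof -
  note outer_simps = bilinear_ladd[OF bilinear_outer] bilinear_radd[OF bilinear_outer]
    bilinear_lmul[OF bilinear_outer] bilinear_rmul[OF bilinear_outer]
  show ?thesis
    unfolding bilinear_def lyap_sym_def
    by (intro conjI allI linearI)
      (simp_all add: linear_add[OF assms(1)] linear_add[OF assms(2)] linear_scale[OF assms(1)]
        linear_scale[OF assms(2)] outer_simps scaleR_add_right)
qed

text \<open>A feasible family is improved by splitting off from its Gram operator either a static vector or
  a pair of vectors oscillating at one frequency; both have negative supply.\<close>

lemma kyp_family_improve:
  fixes f :: "(real^'n) \<times> 'w::euclidean_space \<Rightarrow> real^'n" and l :: "'i \<Rightarrow> (real^'n) \<times> 'w"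
  assumes lin: "linear f" and bil: "bilinear s"
    and static: "\<And>w. w \<noteq> 0 \<Longrightarrow> s (0,w) (0,w) < 0"
    and FDI: "\<And>\<omega> l1 l2. l1 \<noteq> 0 \<or> l2 \<noteq> 0 \<Longrightarrow> f l1 = - \<omega> *\<^sub>R fst l2 \<Longrightarrow> f l2 = \<omega> *\<^sub>R fst l1
       \<Longrightarrow> s l1 l1 + s l2 l2 < (0::real)"
    and fin: "finite I" and z: "(\<Sum>i\<in>I. lyap_sym f fst (l i) (l i)) = 0"
    and nz: "\<exists>i\<in>I. l i \<noteq> 0"
  obtains l' where "(\<Sum>i\<in>I. lyap_sym f fst (l' i) (l' i)) = 0"
    "(\<Sum>i\<in>I. s (l' i) (l' i)) > (\<Sum>i\<in>I. s (l i) (l i))"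
    "(\<Sum>i\<in>I. l' i \<bullet> l' i) < (\<Sum>i\<in>I. l i \<bullet> l i)"
proof -
  define x where "x i = fst (l i)" for i
  \<comment> \<open>\<open>G\<close> is the Gram operator of the states, \<open>J\<close> mixes the
    states with their derivatives, and \<open>L q\<close> is the combination of the family with
    state \<open>G q\<close> and derivative \<open>J q\<close>.\<close>
  define G where "G q = (\<Sum>i\<in>I. (x i \<bullet> q) *\<^sub>R x i)" for q
  define J where "J q = (\<Sum>i\<in>I. (x i \<bullet> q) *\<^sub>R f (l i))" for q
  define L where "L q = (\<Sum>i\<in>I. (x i \<bullet> q) *\<^sub>R l i)" for q
  have fstL: "fst (L q) = G q" for q
    by (simp add: L_def G_def x_def fst_sum)
  have fL: "f (L q) = J q" for q
    by (simp add: L_def J_def linear_sum[OF lin] linear_scale[OF lin])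
  have linG: "linear G" unfolding G_def
    by (auto intro!: linearI simp: inner_add_right scaleR_add_left sum.distrib scaleR_sum_right)
  have linJ: "linear J" unfolding J_def
    by (auto intro!: linearI simp: inner_add_right scaleR_add_left sum.distrib scaleR_sum_right)
  have Gip: "G p \<bullet> q = (\<Sum>i\<in>I. (x i \<bullet> p) * (x i \<bullet> q))" for p q
    by (simp add: G_def inner_sum_left)
  have symG: "G p \<bullet> q = p \<bullet> G q" for p q
    by (simp add: Gip inner_commute[of p] mult.commute)
  have psdG: "0 \<le> G p \<bullet> p" for p
    by (simp add: Gip sum_nonneg)
  \<comment> \<open>The vanishing Lyapunov sum, tested on \<open>p\<close> and \<open>q\<close>,
    says that \<open>J\<close> is skew.\<close>
  have skew: "J p \<bullet> q + p \<bullet> J q = 0" for p q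
  proof -
    have "0 = ((\<Sum>i\<in>I. lyap_sym f fst (l i) (l i)) *v p) \<bullet> q" using z by simp
    also have "\<dots> = (\<Sum>i\<in>I. (lyap_sym f fst (l i) (l i) *v p) \<bullet> q)"
    proof -
      have "linear (\<lambda>M::real^'n^'n. (M *v p) \<bullet> q)"
        by (auto intro!: linearI simp: matrix_vector_mult_add_rdistrib inner_add_left scaleR_matrix_vector_assoc[symmetric])
      from linear_sum[OF this] show ?thesis by simp
    qed
    also have "\<dots> = J p \<bullet> q + p \<bullet> J q"
      by (simp add: lyap_sym_def matrix_vector_mult_add_rdistrib outer_mult_vec inner_add_left inner_add_right J_def
        inner_sum_left inner_sum_right sum.distrib x_def inner_commute mult.commute)
    finally show ?thesis by simp
  qed
  have bl: "bilinear (lyap_sym f fst)"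
    by (intro bilinear_lyap_sym lin linear_fst)
  have bi: "bilinear (\<lambda>a b::(real^'n) \<times> 'w. a \<bullet> b)"
    by (auto simp: bilinear_def algebra_simps inner_add_right inner_add_left intro!: linearI)
  show ?thesis
  proof (cases "\<forall>i\<in>I. x i = 0")
    case True
    obtain j where j: "j \<in> I" "l j \<noteq> 0" using nz by blast
    \<comment> \<open>With all states zero the family is purely static, and deleting a nonzero
      member removes a negative supply.\<close>
    define l' where "l' = l(j := 0)"
    have lj: "l j = (0, snd (l j))" using True j by (metis x_def prod.collapse)
    have snz: "snd (l j) \<noteq> 0" using lj j(2) by (metis zero_prod_def)
    have s0: "s 0 0 = 0" using bil by (simp add: bilinear_lzero)
    have sneg: "s (l j) (l j) < 0" using static[OF snz] lj by metis
    have split: "(\<Sum>i\<in>I. h (l i)) = h (l j) + (\<Sum>i\<in>I-{j}. h (l' i))"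
      "(\<Sum>i\<in>I. h (l' i)) = h 0 + (\<Sum>i\<in>I-{j}. h (l' i))" for h :: "_ \<Rightarrow> real"
      using fin j(1) by (simp_all add: sum.remove l'_def)
    show ?thesis
    proof (rule that[of l'])
      show "(\<Sum>i\<in>I. lyap_sym f fst (l' i) (l' i)) = 0"
        using True by (intro sum.neutral) (auto simp: lyap_sym_def l'_def x_def)
      show "(\<Sum>i\<in>I. s (l' i) (l' i)) > (\<Sum>i\<in>I. s (l i) (l i))"
        using split[of "\<lambda>v. s v v"] sneg s0 by simp
      show "(\<Sum>i\<in>I. l' i \<bullet> l' i) < (\<Sum>i\<in>I. l i \<bullet> l i)"
        using split[of "\<lambda>v. v \<bullet> v"] j(2) by simp
    qed
  next
    case False
    then obtain j where j: "j \<in> I" "x j \<noteq> 0" by blast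
    have "G (x j) \<bullet> x j > 0"
      unfolding Gip using fin j by (intro sum_pos2[of _ j]) auto
    then have Gj: "G (x j) \<noteq> 0" by auto
    have kerx: "x i \<bullet> p = 0" if "G p = 0" "i \<in> I" for p i
    proof -
      have "(\<Sum>i\<in>I. (x i \<bullet> p) * (x i \<bullet> p)) = 0" using that(1) Gip[of p p] by simp
      then have "\<forall>i\<in>I. (x i \<bullet> p) * (x i \<bullet> p) = 0" by (subst (asm) sum_nonneg_eq_0_iff) (auto simp: fin)
      with that(2) show ?thesis by simp
    qed
    then have kerJ: "J p = 0" if "G p = 0" for p
      using that by (simp add: J_def)
    \<comment> \<open>\<open>J\<close> is skew, so its eigenvectors relative to \<open>G\<close> are
      complex. On pairs, \<open>HH\<close> is symmetric, and a real eigenvector of \<open>HH\<close>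
      relative to \<open>GG\<close> consists of a real and an imaginary part rotating at frequency
      \<omega>.\<close>
    define GG where "GG p = (G (fst p), G (snd p))" for p
    define HH where "HH p = (J (snd p), - J (fst p))" for p
    obtain q \<omega> where q: "GG q \<noteq> 0" "HH q = \<omega> *\<^sub>R GG q"
    proof (rule generalized_eigenvector[of GG HH "(x j, 0)"])
      show "linear GG" "linear HH"
        unfolding GG_def HH_def
        by (auto intro!: linearI simp: linear_add[OF linG] linear_add[OF linJ] linear_scale[OF linG] linear_scale[OF linJ])
      show "GG p \<bullet> r = p \<bullet> GG r" for p r
        by (simp add: GG_def inner_prod_def symG)
      show "HH p \<bullet> r = p \<bullet> HH r" for p r
        using skew[of "snd p" "fst r"] skew[of "fst p" "snd r"] by (simp add: HH_def inner_prod_def)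
      show "0 \<le> GG p \<bullet> p" for p
        using psdG by (simp add: GG_def inner_prod_def)
      show "GG p = 0 \<Longrightarrow> HH p = 0" for p
        using kerJ by (simp add: GG_def HH_def zero_prod_def)
      show "GG (x j, 0) \<noteq> 0" using Gj by (simp add: GG_def zero_prod_def)
    qed
    obtain q1 q2 where q12: "q = (q1, q2)" by fastforce
    have J2: "J q2 = \<omega> *\<^sub>R G q1" and J1: "J q1 = - \<omega> *\<^sub>R G q2"
      using q(2) by (auto simp: q12 GG_def HH_def minus_equation_iff[of "J q1"])
    have bls: "bilinear s" by fact
    show ?thesis
    proof (cases "\<omega> = 0")
      case True
      \<comment> \<open>At frequency zero one of the two parts is already an equilibrium, and a
        single deflation suffices.\<close>
      obtain p where p: "G p \<noteq> 0" "J p = 0"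
        using q(1) J1 J2 True by (auto simp: q12 GG_def zero_prod_def)
      define \<alpha> where "\<alpha> = (\<Sum>i\<in>I. (x i \<bullet> p)\<^sup>2)"
      have Lnz: "L p \<noteq> 0" using p fstL by (metis fst_zero)
      have "\<alpha> = G p \<bullet> p" by (simp add: \<alpha>_def Gip power2_eq_square)
      then have \<alpha>: "\<alpha> > 0"
        using psdG[of p] psd_zero_imp_kernel[OF linG symG psdG, of p] p by fastforce
      define l' where "l' i = l i - ((x i \<bullet> p) / \<alpha>) *\<^sub>R L p" for i
      have defl: "(\<Sum>i\<in>I. B (l' i) (l' i)) = (\<Sum>i\<in>I. B (l i) (l i)) - (1 / \<alpha>) *\<^sub>R B (L p) (L p)"
        if "bilinear B" for B :: "_ \<Rightarrow> _ \<Rightarrow> 'b::real_vector"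
        unfolding l'_def using \<alpha> by (intro sum_bilinear_deflate that fin) (auto simp: L_def \<alpha>_def)
      have sneg: "s (L p) (L p) < 0"
        using FDI[of "L p" 0 0] Lnz fL p bil by (simp add: bilinear_lzero linear_0[OF lin])
      show ?thesis
      proof (rule that[of l'])
        show "(\<Sum>i\<in>I. lyap_sym f fst (l' i) (l' i)) = 0"
          using defl[OF bl] z p by (simp add: lyap_sym_def fL)
        show "(\<Sum>i\<in>I. s (l' i) (l' i)) > (\<Sum>i\<in>I. s (l i) (l i))"
          using defl[OF bls] sneg \<alpha> by (simp add: divide_neg_pos)
        show "(\<Sum>i\<in>I. l' i \<bullet> l' i) < (\<Sum>i\<in>I. l i \<bullet> l i)"
          using defl[OF bi] Lnz \<alpha> by simp
      qed
    next
      case False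
      \<comment> \<open>Skewness makes \<open>q1\<close> and \<open>q2\<close> orthogonal and
        equally long with respect to \<open>G\<close>. Hence the second deflation is not disturbed
        by the first and has the same \<alpha>.\<close>
      have G12: "G q1 \<bullet> q2 = 0"
      proof -
        have "J q1 \<bullet> q1 = 0" using skew[of q1 q1] by (simp add: inner_commute)
        then show ?thesis using J1 False symG[of q1 q2] by (simp add: inner_commute)
      qed
      have Geq: "G q1 \<bullet> q1 = G q2 \<bullet> q2"
        using skew[of q1 q2] J1 J2 False
        by (simp add: inner_commute[of q1] right_diff_distrib[symmetric] flip: symG)
      define \<alpha> where "\<alpha> = (\<Sum>i\<in>I. (x i \<bullet> q1)\<^sup>2)"
      have \<alpha>G: "\<alpha> = G q1 \<bullet> q1" by (simp add: \<alpha>_def Gip power2_eq_square)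
      have \<alpha>2: "\<alpha> = (\<Sum>i\<in>I. (x i \<bullet> q2)\<^sup>2)" using Geq \<alpha>G by (simp add: Gip power2_eq_square)
      have \<alpha>: "\<alpha> > 0"
      proof (rule ccontr)
        assume "\<not> \<alpha> > 0"
        then have "\<alpha> = 0" using \<alpha>G psdG[of q1] by linarith
        then have "G q1 = 0" "G q2 = 0"
          using \<alpha>G Geq psd_zero_imp_kernel[OF linG symG psdG] by metis+
        then show False using q(1) by (simp add: q12 GG_def zero_prod_def)
      qed
      then have "G q1 \<noteq> 0" using \<alpha>G by auto
      then have Lnz: "L q1 \<noteq> 0" using fstL by (metis fst_zero)
      define m where "m i = l i - ((x i \<bullet> q1) / \<alpha>) *\<^sub>R L q1" for i
      define l' where "l' i = m i - ((x i \<bullet> q2) / \<alpha>) *\<^sub>R L q2" for i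
      have Lm: "L q2 = (\<Sum>i\<in>I. (x i \<bullet> q2) *\<^sub>R m i)"
      proof -
        have "(\<Sum>i\<in>I. (x i \<bullet> q2) *\<^sub>R m i) = L q2 - (\<Sum>i\<in>I. ((x i \<bullet> q1) * (x i \<bullet> q2) / \<alpha>) *\<^sub>R L q1)"
          by (simp add: m_def L_def scaleR_diff_right sum_subtractf mult.commute)
        also have "(\<Sum>i\<in>I. ((x i \<bullet> q1) * (x i \<bullet> q2) / \<alpha>) *\<^sub>R L q1) = ((G q1 \<bullet> q2) / \<alpha>) *\<^sub>R L q1"
          by (simp add: Gip scaleR_sum_left sum_divide_distrib)
        finally show ?thesis using G12 by simp
      qed
      have defl: "(\<Sum>i\<in>I. B (l' i) (l' i)) = (\<Sum>i\<in>I. B (l i) (l i))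
          - (1 / \<alpha>) *\<^sub>R (B (L q1) (L q1) + B (L q2) (L q2))"
        if "bilinear B" for B :: "_ \<Rightarrow> _ \<Rightarrow> 'b::real_vector"
      proof -
        have "(\<Sum>i\<in>I. B (l' i) (l' i)) = (\<Sum>i\<in>I. B (m i) (m i)) - (1 / \<alpha>) *\<^sub>R B (L q2) (L q2)"
          unfolding l'_def using \<alpha> \<alpha>2 Lm by (intro sum_bilinear_deflate that fin) auto
        also have "(\<Sum>i\<in>I. B (m i) (m i)) = (\<Sum>i\<in>I. B (l i) (l i)) - (1 / \<alpha>) *\<^sub>R B (L q1) (L q1)"
          unfolding m_def using \<alpha> by (intro sum_bilinear_deflate that fin) (auto simp: L_def \<alpha>_def)
        finally show ?thesis by (simp add: algebra_simps)
      qed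
      have sneg: "s (L q1) (L q1) + s (L q2) (L q2) < 0"
        using FDI[of "L q1" "L q2" \<omega>] Lnz fL J1 J2 by (simp add: fstL)
      \<comment> \<open>The two Lyapunov terms of a rotating pair cancel, so the constraint survives
        the double deflation.\<close>
      have rot: "lyap_sym f fst (L q1) (L q1) + lyap_sym f fst (L q2) (L q2) = 0"
        by (simp add: lyap_sym_def fL fstL J1 J2 bilinear_lneg[OF bilinear_outer] bilinear_rneg[OF bilinear_outer]
          bilinear_lmul[OF bilinear_outer] bilinear_rmul[OF bilinear_outer] algebra_simps)
      show ?thesis
      proof (rule that[of l'])
        show "(\<Sum>i\<in>I. lyap_sym f fst (l' i) (l' i)) = 0"
          using defl[OF bl] z rot by simp
        show "(\<Sum>i\<in>I. s (l' i) (l' i)) > (\<Sum>i\<in>I. s (l i) (l i))"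
          using defl[OF bls] sneg \<alpha> by (simp add: divide_neg_pos)
        have "L q1 \<bullet> L q1 > 0" "L q2 \<bullet> L q2 \<ge> 0" using Lnz by simp_all
        then have "L q1 \<bullet> L q1 + L q2 \<bullet> L q2 > 0" by linarith
        then have "(1/\<alpha>) * (L q1 \<bullet> L q1 + L q2 \<bullet> L q2) > 0" using \<alpha> by (intro mult_pos_pos) auto
        then show "(\<Sum>i\<in>I. l' i \<bullet> l' i) < (\<Sum>i\<in>I. l i \<bullet> l i)"
          using defl[OF bi] by simp
      qed
    qed
  qed
qed

text \<open>The convex weights are the shares |l i|^2 / m; zero members are dropped since they
  cannot be normalized.\<close>

lemma kyp_hull_family:
  fixes q :: "'a::euclidean_space \<Rightarrow> 'a \<Rightarrow> 'b::real_vector"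
  assumes q: "bilinear q" and fin: "finite I" and m: "(\<Sum>i\<in>I. l i \<bullet> l i) = m" "m > 0"
  shows "(1 / m) *\<^sub>R (\<Sum>i\<in>I. q (l i) (l i)) \<in> convex hull ((\<lambda>l. q l l) ` sphere 0 1)"
proof -
  let ?I = "{i\<in>I. l i \<noteq> 0}"
  have "(1 / m) *\<^sub>R (\<Sum>i\<in>I. q (l i) (l i)) = (1 / m) *\<^sub>R (\<Sum>i\<in>?I. q (l i) (l i))"
    using fin q by (intro arg_cong2[of _ _ _ _ scaleR] sum.mono_neutral_right) (auto simp: bilinear_lzero)
  also have "\<dots> = (\<Sum>i\<in>?I. (l i \<bullet> l i / m) *\<^sub>R q (inverse (norm (l i)) *\<^sub>R l i) (inverse (norm (l i)) *\<^sub>R l i))"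
    unfolding scaleR_sum_right
    by (intro sum.cong) (auto simp: bilinear_lmul[OF q] bilinear_rmul[OF q] dot_square_norm power2_eq_square field_simps)
  also have "\<dots> \<in> convex hull ((\<lambda>l. q l l) ` sphere 0 1)"
  proof (rule convex_sum)
    have "(\<Sum>i\<in>?I. l i \<bullet> l i) = m"
      unfolding m(1)[symmetric] using fin by (intro sum.mono_neutral_left) auto
    then show "(\<Sum>i\<in>?I. l i \<bullet> l i / m) = 1"
      using m(2) by (simp flip: sum_divide_distrib)
  qed (use fin m in \<open>auto intro!: hull_inc imageI simp: convex_convex_hull\<close>)
  finally show ?thesis .
qed

text \<open>Each convex weight enters its unit vector as a square root, so the points of the hull
  are the sums over families of total squared norm 1.\<close>

lemma kyp_hull_familyE:
  fixes q :: "'a::euclidean_space \<Rightarrow> 'a \<Rightarrow> 'b::real_vector"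
  assumes q: "bilinear q" and h: "h \<in> convex hull ((\<lambda>l. q l l) ` sphere 0 1)"
  obtains I and l :: "'b \<Rightarrow> 'a" where "finite I" "(\<Sum>i\<in>I. l i \<bullet> l i) = 1" "h = (\<Sum>i\<in>I. q (l i) (l i))"
proof -
  obtain S u where S: "finite S" "S \<subseteq> (\<lambda>l. q l l) ` sphere 0 1" "\<forall>x\<in>S. 0 \<le> u x" "sum u S = 1"
    "(\<Sum>v\<in>S. u v *\<^sub>R v) = h"
    using h unfolding convex_hull_explicit by blast
  have "\<exists>e. norm e = 1 \<and> v = q e e" if "v \<in> S" for v
  proof -
    have "v \<in> (\<lambda>l. q l l) ` sphere 0 1" using S(2) that by blast
    then show ?thesis by (auto simp: dist_norm)
  qed
  then obtain g where g: "\<And>v. v \<in> S \<Longrightarrow> norm (g v) = 1 \<and> v = q (g v) (g v)"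
    by metis
  show ?thesis
  proof (rule that[of S "\<lambda>v. sqrt (u v) *\<^sub>R g v"])
    have "(\<Sum>i\<in>S. (sqrt (u i) *\<^sub>R g i) \<bullet> (sqrt (u i) *\<^sub>R g i)) = sum u S"
      using S(3) g by (intro sum.cong) (auto simp: dot_square_norm simp flip: mult.assoc)
    then show "(\<Sum>i\<in>S. (sqrt (u i) *\<^sub>R g i) \<bullet> (sqrt (u i) *\<^sub>R g i)) = 1"
      using S(4) by simp
    have "(\<Sum>v\<in>S. u v *\<^sub>R v) = (\<Sum>i\<in>S. q (sqrt (u i) *\<^sub>R g i) (sqrt (u i) *\<^sub>R g i))"
    proof (rule sum.cong)
      fix v assume v: "v \<in> S"
      have "u v *\<^sub>R v = u v *\<^sub>R q (g v) (g v)" using g[OF v] by simp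
      then show "u v *\<^sub>R v = q (sqrt (u v) *\<^sub>R g v) (sqrt (u v) *\<^sub>R g v)"
        using S(3) v by (simp add: bilinear_lmul[OF q] bilinear_rmul[OF q])
    qed simp
    then show "h = (\<Sum>i\<in>S. q (sqrt (u i) *\<^sub>R g i) (sqrt (u i) *\<^sub>R g i))"
      using S(5) by simp
  qed (rule S(1))
qed

lemma bilinear_Pair:
  assumes "bilinear f" "bilinear g"
  shows "bilinear (\<lambda>x y. (f x y, g x y))"
  using assms by (auto simp: bilinear_def linear_iff)

lemma transpose_add: "transpose (A + B) = transpose A + transpose B" for A B :: "'a::ab_group_add^'n^'m"
  by (simp add: transpose_def vec_eq_iff)

text \<open>Separates the hull \<open>H\<close> of the pairs (Lyapunov term, supply) over unit
  vectors from the ray \<open>T\<close> of pairs (0, r) with r >= 0. A common point with the largest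
  supply could be improved by \<open>kyp_family_improve\<close> to a larger supply with smaller
  total norm; renormalizing to norm 1 cannot decrease a positive supply, a contradiction. In
  \<open>FDI\<close>, \<open>l1\<close> and \<open>l2\<close> are the real and imaginary parts of a
  complex vector l with f l = i \<omega> fst l.\<close>

theorem kyp_strict:
  fixes f :: "(real^'n) \<times> 'w::euclidean_space \<Rightarrow> real^'n"
  assumes lin: "linear f" and bil: "bilinear s"
    and static: "\<And>w. w \<noteq> 0 \<Longrightarrow> s (0,w) (0,w) < 0"
    and FDI: "\<And>\<omega> l1 l2. l1 \<noteq> 0 \<or> l2 \<noteq> 0 \<Longrightarrow> f l1 = - \<omega> *\<^sub>R fst l2 \<Longrightarrow> f l2 = \<omega> *\<^sub>R fst l1
       \<Longrightarrow> s l1 l1 + s l2 l2 < (0::real)"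
  shows "\<exists>X. transpose X = X \<and> (\<forall>l. l \<noteq> 0 \<longrightarrow> 2 * ((X *v fst l) \<bullet> f l) + s l l < 0)"
proof -
  define q where "q l l' = (lyap_sym f fst l l', s l l')" for l l'
  have bl: "bilinear (lyap_sym f fst)"
    by (intro bilinear_lyap_sym lin linear_fst)
  have bq: "bilinear q"
    unfolding q_def by (intro bilinear_Pair bl bil)
  have fq: "fst (\<Sum>i\<in>I. q (l i) (l i)) = (\<Sum>i\<in>I. lyap_sym f fst (l i) (l i))"
    "snd (\<Sum>i\<in>I. q (l i) (l i)) = (\<Sum>i\<in>I. s (l i) (l i))" for I and l :: "'j \<Rightarrow> _"
    by (simp_all add: fst_sum snd_sum q_def)
  define S where "S = (sphere 0 1 :: ((real^'n) \<times> 'w) set)"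
  have contq: "continuous_on S (\<lambda>l. q l l)"
    by (rule continuous_on_bilinear_diag[OF bq])
  define H where "H = convex hull ((\<lambda>l. q l l) ` S)"
  have cH: "compact H" "convex H"
    unfolding H_def S_def
    by (auto intro!: compact_convex_hull compact_continuous_image contq[unfolded S_def] simp: convex_convex_hull)
  have SH: "q l l \<in> H" if "norm l = 1" for l
    using that by (auto simp: H_def S_def intro!: hull_inc)
  define T where "T = {(0::real^'n^'n, r::real) | r. r \<ge> 0}"
  have T_eq: "T = {0} \<times> {0..}" by (auto simp: T_def)
  have "H \<inter> T = {}"
  proof (rule ccontr)
    assume ne: "H \<inter> T \<noteq> {}"
    have "compact (H \<inter> T)"
      unfolding T_eq by (intro compact_Int_closed cH closed_Times) auto
    then obtain h where h: "h \<in> H \<inter> T" "\<And>y. y \<in> H \<inter> T \<Longrightarrow> snd y \<le> snd h"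
      using continuous_attains_sup[OF _ ne, of snd] continuous_on_snd[OF continuous_on_id] by blast
    have hT: "h \<in> T" and hH: "h \<in> convex hull ((\<lambda>l. q l l) ` sphere 0 1)"
      using h(1) by (simp_all only: H_def S_def Int_iff)
    obtain I and l :: "(real^'n^'n) \<times> real \<Rightarrow> (real^'n) \<times> 'w" where l: "finite I" "(\<Sum>i\<in>I. l i \<bullet> l i) = 1" "h = (\<Sum>i\<in>I. q (l i) (l i))"
      by (rule kyp_hull_familyE[OF bq hH])
    have h0: "fst h = 0" "snd h \<ge> 0"
      using hT unfolding T_eq mem_Times_iff by simp_all
    have nz: "\<exists>i\<in>I. l i \<noteq> 0"
    proof (rule ccontr)
      assume "\<not> ?thesis"
      then have "(\<Sum>i\<in>I. l i \<bullet> l i) = 0" by (intro sum.neutral) auto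
      then show False using l(2) by simp
    qed
    have z: "(\<Sum>i\<in>I. lyap_sym f fst (l i) (l i)) = 0"
      using h0(1) l(3) fq(1)[of l I] by simp
    obtain l' where l': "(\<Sum>i\<in>I. lyap_sym f fst (l' i) (l' i)) = 0"
       "(\<Sum>i\<in>I. s (l' i) (l' i)) > (\<Sum>i\<in>I. s (l i) (l i))"
       "(\<Sum>i\<in>I. l' i \<bullet> l' i) < (\<Sum>i\<in>I. l i \<bullet> l i)"
      by (rule kyp_family_improve[OF lin bil static FDI l(1) z nz])
    define m where "m = (\<Sum>i\<in>I. l' i \<bullet> l' i)"
    have gt: "(\<Sum>i\<in>I. s (l' i) (l' i)) > snd h" using l'(2) l(3) fq(2)[of l I] by simp
    have "m \<ge> 0" "m < 1" using l'(3) l(2) by (auto simp: m_def sum_nonneg)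
    moreover have "m \<noteq> 0"
    proof
      assume "m = 0"
      then have "\<forall>i\<in>I. l' i \<bullet> l' i = 0"
        unfolding m_def by (subst (asm) sum_nonneg_eq_0_iff) (auto simp: l(1))
      then have "(\<Sum>i\<in>I. s (l' i) (l' i)) = 0"
        by (intro sum.neutral) (auto simp: bilinear_lzero[OF bil])
      then show False using gt h0(2) by simp
    qed
    ultimately have m: "0 < m" "m < 1" by auto
    let ?h = "(1 / m) *\<^sub>R (\<Sum>i\<in>I. q (l' i) (l' i))"
    have "?h \<in> H"
      unfolding H_def S_def by (intro kyp_hull_family bq l(1) m) (simp add: m_def)
    moreover have sh: "snd ?h = (\<Sum>i\<in>I. s (l' i) (l' i)) / m"
      by (simp add: fq divide_inverse mult.commute)
    moreover have "snd ?h > snd h"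
    proof -
      have "(\<Sum>i\<in>I. s (l' i) (l' i)) * m \<le> (\<Sum>i\<in>I. s (l' i) (l' i)) * 1"
        using gt h0(2) m by (intro mult_left_mono) auto
      then have "(\<Sum>i\<in>I. s (l' i) (l' i)) / m \<ge> (\<Sum>i\<in>I. s (l' i) (l' i))"
        using m by (simp add: field_simps)
      then show ?thesis using sh gt by linarith
    qed
    moreover have "fst ?h = 0" using l'(1) by (simp add: fq)
    ultimately have "?h \<in> H \<inter> T"
      using h0(2) by (auto simp: T_eq mem_Times_iff)
    then show False using h(2) \<open>snd ?h > snd h\<close> by fastforce
  qed
  moreover have "convex T" "closed T"
    unfolding T_eq by (auto intro!: convex_Times closed_Times)
  moreover have "H \<noteq> {}"
    unfolding H_def S_def by simp
  ultimately obtain a b where ab: "\<And>h. h \<in> H \<Longrightarrow> a \<bullet> h < b" "\<And>h. h \<in> T \<Longrightarrow> a \<bullet> h > b"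
    using separating_hyperplane_compact_closed[of H T] cH by blast
  obtain Y c where a: "a = (Y, c)" by fastforce
  have b: "b < 0" using ab(2)[of "(0,0)"] by (simp add: T_def a)
  \<comment> \<open>A negative \<open>c\<close> would place the point (0, b / c) of \<open>T\<close>
    on the hyperplane itself.\<close>
  have c: "c \<ge> 0"
  proof (rule ccontr)
    assume "\<not> c \<ge> 0"
    then have "(0, b / c) \<in> T" using b by (simp add: T_eq divide_nonpos_nonpos)
    from ab(2)[OF this] show False using \<open>\<not> c \<ge> 0\<close> by (simp add: a)
  qed
  have Yq: "Y \<bullet> lyap_sym f fst l l + c * s l l < b" if "norm l = 1" for l
    using ab(1)[OF SH[OF that]] by (simp add: a q_def)
  \<comment> \<open>\<open>lyap_sym f fst l l\<close> is a symmetric matrix, so only the symmetric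
    part of \<open>Y\<close> matters.\<close>
  define Z where "Z = (1/2) *\<^sub>R (Y + transpose Y)"
  have symZ: "transpose (r *\<^sub>R Z) = r *\<^sub>R Z" for r
    by (simp add: Z_def transpose_scalar transpose_add add.commute)
  have YZ: "Y \<bullet> lyap_sym f fst l l = 2 * ((Z *v fst l) \<bullet> f l)" for l
  proof -
    have "fst l \<bullet> (Y *v f l) = (transpose Y *v fst l) \<bullet> f l"
      by (simp add: transpose_matrix_vector dot_lmul_matrix)
    moreover have "2 *\<^sub>R (Z *v fst l) = Y *v fst l + transpose Y *v fst l"
      by (simp add: Z_def scaleR_matrix_vector_assoc matrix_vector_mult_add_rdistrib)
    then have "2 * ((Z *v fst l) \<bullet> f l) = (Y *v fst l) \<bullet> f l + (transpose Y *v fst l) \<bullet> f l"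
      by (metis inner_add_left inner_scaleR_left)
    ultimately show ?thesis
      by (simp add: lyap_sym_def inner_add_right inner_outer inner_commute[of "f l"])
  qed
  have cs: "continuous_on S (\<lambda>l. s l l)"
    using continuous_on_snd[OF contq] by (simp add: q_def)
  have "bounded ((\<lambda>l. s l l) ` S)"
    by (intro compact_imp_bounded compact_continuous_image cs) (simp add: S_def)
  then obtain N where N: "N > 0" "\<And>l. l \<in> S \<Longrightarrow> \<bar>s l l\<bar> \<le> N"
    unfolding bounded_pos by auto
  have "\<exists>r. \<forall>l. norm l = 1 \<longrightarrow> r * (Y \<bullet> lyap_sym f fst l l) + s l l < 0"
  proof (cases "c = 0")
    case True
    \<comment> \<open>For \<open>c = 0\<close> the Lyapunov term alone stays below
      \<open>b < 0\<close> on unit vectors; the multiple N / (-b) outweighs the supply, which is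
      bounded by \<open>N\<close>.\<close>
    have "N / (-b) * (Y \<bullet> lyap_sym f fst l l) + s l l < 0" if "norm l = 1" for l
    proof -
      have "N / (-b) * (Y \<bullet> lyap_sym f fst l l) < N / (-b) * b"
        using Yq[OF that] True N b by (intro mult_strict_left_mono) (auto simp: divide_pos_neg divide_pos_pos)
      also have "\<dots> = - N" using b by simp
      finally show ?thesis using N(2)[of l] that by (simp add: S_def)
    qed
    then show ?thesis by blast
  next
    case False
    then have c0: "c > 0" using c by simp
    have "(1/c) * (Y \<bullet> lyap_sym f fst l l) + s l l < 0" if "norm l = 1" for l
    proof -
      have "c * ((1/c) * (Y \<bullet> lyap_sym f fst l l) + s l l) < 0"
        using Yq[OF that] b c0 by (simp add: distrib_left)
      then show ?thesis using c0 by (simp add: mult_less_0_iff)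
    qed
    then show ?thesis by blast
  qed
  then obtain r where r: "\<And>l. norm l = 1 \<Longrightarrow> r * (Y \<bullet> lyap_sym f fst l l) + s l l < 0" by blast
  show ?thesis
  proof (intro exI[of _ "r *\<^sub>R Z"] conjI symZ allI impI)
    fix l :: "(real^'n) \<times> 'w" assume l: "l \<noteq> 0"
    define n e where "n = norm l" and "e = sgn l"
    then have ne: "l = n *\<^sub>R e" "n > 0" "norm e = 1"
      using l by (simp_all add: norm_sgn sgn_div_norm)
    have "2 * (((r *\<^sub>R Z) *v fst l) \<bullet> f l) + s l l = n\<^sup>2 * (r * (Y \<bullet> lyap_sym f fst e e) + s e e)"
      by (simp add: YZ ne(1) linear_scale[OF lin] bilinear_lmul[OF bil] bilinear_rmul[OF bil]
        scaleR_matrix_vector_assoc[symmetric] matrix_vector_mult_scaleR power2_eq_square algebra_simps)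
    also have "\<dots> < 0" using r[OF ne(3)] ne(2) by (simp add: mult_pos_neg)
    finally show "2 * (((r *\<^sub>R Z) *v fst l) \<bullet> f l) + s l l < 0" .
  qed
qed

subsection \<open>Lyapunov inequalities\<close>

lemma matrix_inv_right:
  fixes A :: "'a::semiring_1^'n^'m"
  assumes "invertible A" shows "A ** matrix_inv A = mat 1"
  using someI_ex[OF assms[unfolded invertible_def]] by (simp add: matrix_inv_def)

lemma matrix_inv_left:
  fixes A :: "'a::semiring_1^'n^'m"
  assumes "invertible A" shows "matrix_inv A ** A = mat 1"
  using someI_ex[OF assms[unfolded invertible_def]] by (simp add: matrix_inv_def)

lemma invertible_kerI:
  fixes A :: "'a::field^'n^'n"
  assumes "\<And>x. A *v x = 0 \<Longrightarrow> x = 0" shows "invertible A"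
  using assms matrix_left_invertible_ker[of A] by (auto simp: invertible_left_inverse)

lemma invertible_kerD:
  fixes A :: "'a::field^'n^'n"
  assumes "invertible A" "A *v x = 0" shows "x = 0"
  using assms matrix_left_invertible_ker[of A] by (auto simp: invertible_left_inverse)

text \<open>The vector a + i b. Through it, complex eigenvectors and frequency responses of real
  matrices are handled as pairs of real vectors.\<close>

definition cvec :: "real^'n \<Rightarrow> real^'n \<Rightarrow> complex^'n" where
  "cvec a b = (\<chi> i. Complex (a $ i) (b $ i))"

lemma cvec_cases: obtains a b where "v = cvec a b"
proof
  show "v = cvec (\<chi> i. Re (v $ i)) (\<chi> i. Im (v $ i))"
    by (simp add: cvec_def vec_eq_iff)
qed

lemma cvec_eq_iff [simp]: "cvec a b = cvec c d \<longleftrightarrow> a = c \<and> b = d"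
  by (auto simp: cvec_def vec_eq_iff)

lemma cvec_eq_0_iff [simp]: "cvec a b = 0 \<longleftrightarrow> a = 0 \<and> b = 0"
  by (auto simp: cvec_def vec_eq_iff zero_complex.ctr)

lemma cvec_scale: "Complex \<sigma> \<omega> *s cvec a b = cvec (\<sigma> *\<^sub>R a - \<omega> *\<^sub>R b) (\<omega> *\<^sub>R a + \<sigma> *\<^sub>R b)"
  by (simp add: cvec_def vec_eq_iff complex_eq_iff)

lemma cmat_cvec: "cmat M *v cvec a b = cvec (M *v a) (M *v b)"
  by (simp add: cmat_def cvec_def vec_eq_iff matrix_vector_mult_def complex_eq_iff)

lemma norm_cvec: "norm (cvec a b) = norm (a, b)"
proof -
  have "(norm (cvec a b))\<^sup>2 = (norm (a, b))\<^sup>2"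
    unfolding norm_Pair
    by (simp add: norm_vec_def L2_set_def cvec_def sum_nonneg cmod_power2 sum.distrib)
  then show ?thesis by simp
qed

text \<open>The eigenvector equation of a + i b for the eigenvalue \<sigma> + i \<omega>, separated
  into real and imaginary parts.\<close>

lemma hurwitz_iff:
  "hurwitz M \<longleftrightarrow> (\<forall>\<sigma> \<omega> a b. (a \<noteq> 0 \<or> b \<noteq> 0) \<and> M *v a = \<sigma> *\<^sub>R a - \<omega> *\<^sub>R b \<and> M *v b = \<omega> *\<^sub>R a + \<sigma> *\<^sub>R b \<longrightarrow> \<sigma> < 0)"
    (is "_ = ?R")
proof
  assume h: "hurwitz M"
  show ?R
  proof (intro allI impI)
    fix \<sigma> \<omega> :: real and a b :: "real^'a"
    assume "(a \<noteq> 0 \<or> b \<noteq> 0) \<and> M *v a = \<sigma> *\<^sub>R a - \<omega> *\<^sub>R b \<and> M *v b = \<omega> *\<^sub>R a + \<sigma> *\<^sub>R b"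
    then have "cvec a b \<noteq> 0" "cmat M *v cvec a b = Complex \<sigma> \<omega> *s cvec a b"
      by (simp_all add: cmat_cvec cvec_scale)
    with h show "\<sigma> < 0" unfolding hurwitz_def by fastforce
  qed
next
  assume r: ?R
  show "hurwitz M" unfolding hurwitz_def
  proof (intro allI impI)
    fix lam and v :: "complex^'a" assume v: "v \<noteq> 0 \<and> cmat M *v v = lam *s v"
    obtain a b where ab: "v = cvec a b" by (rule cvec_cases)
    have "lam = Complex (Re lam) (Im lam)" by simp
    with v have "cvec (M *v a) (M *v b) = cvec (Re lam *\<^sub>R a - Im lam *\<^sub>R b) (Im lam *\<^sub>R a + Re lam *\<^sub>R b)"
      by (metis ab cmat_cvec cvec_scale)
    with r v ab show "Re lam < 0" by auto
  qed
qed

lemma hurwitz_no_imaginary: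
  assumes "hurwitz M" "M *v a = - \<omega> *\<^sub>R b" "M *v b = \<omega> *\<^sub>R a"
  shows "a = 0" "b = 0"
  using assms(1)[unfolded hurwitz_iff, rule_format, of a b 0 \<omega>] assms(2,3) by auto

text \<open>-\<epsilon> is the maximum over the unit sphere, which is attained and hence negative;
  homogeneity does the rest.\<close>

lemma bilinear_neg_uniform:
  fixes q :: "'a::euclidean_space \<Rightarrow> 'a \<Rightarrow> real"
  assumes q: "bilinear q" and neg: "\<And>l. l \<noteq> 0 \<Longrightarrow> q l l < 0"
  obtains \<epsilon> where "\<epsilon> > 0" "\<And>l. q l l \<le> - \<epsilon> * (l \<bullet> l)"
proof -
  have "continuous_on (sphere 0 1) (\<lambda>l. q l l)"
    by (rule continuous_on_bilinear_diag[OF q])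
  moreover have "sphere (0::'a) 1 \<noteq> {}" by simp
  ultimately obtain e where e: "norm e = 1" "\<And>l. norm l = 1 \<Longrightarrow> q l l \<le> q e e"
    using continuous_attains_sup[of "sphere (0::'a) 1" "\<lambda>l. q l l"] by auto
  show ?thesis
  proof
    show "- q e e > 0" using neg[of e] e by force
    fix l
    show "q l l \<le> - (- q e e) * (l \<bullet> l)"
    proof (cases "l = 0")
      case True
      then show ?thesis by (simp add: bilinear_lzero[OF q])
    next
      case False
      have "q l l = (norm l)\<^sup>2 * q (sgn l) (sgn l)" by (rule bilinear_sgn[OF q])
      also have "\<dots> \<le> (norm l)\<^sup>2 * q e e"
        using e False by (intro mult_left_mono) (auto simp: norm_sgn)
      finally show ?thesis by (simp add: dot_square_norm mult.commute)
    qed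
  qed
qed

lemma symmetric_inner: "transpose X = X \<Longrightarrow> (X *v x) \<bullet> y = x \<bullet> (X *v y)" for X :: "real^'n^'n"
  by (metis dot_lmul_matrix transpose_matrix_vector)

lemma inner_transpose: "(X *v x) \<bullet> y = x \<bullet> (transpose X *v y)" for X :: "real^'n^'m"
  by (metis dot_lmul_matrix inner_commute transpose_matrix_vector)

text \<open>Let \<open>v\<close> minimize the ratio \<open>r\<close> of the two forms. Then X v =
  r(v) Y v, so the two Lyapunov expressions at \<open>v\<close> also have ratio r(v); both are
  negative, hence r(v) > 0 and the ratio is positive everywhere.\<close>

lemma lyapunov_compare:
  fixes A X Y :: "real^'n^'n"
  assumes symX: "transpose X = X" and X: "\<And>x. x \<noteq> 0 \<Longrightarrow> (X *v x) \<bullet> (A *v x) < 0"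
    and symY: "transpose Y = Y" and Y: "\<And>x. x \<noteq> 0 \<Longrightarrow> (Y *v x) \<bullet> (A *v x) < 0"
    and pdY: "\<And>x. x \<noteq> 0 \<Longrightarrow> (Y *v x) \<bullet> x > 0" and x: "x \<noteq> 0"
  shows "(X *v x) \<bullet> x > 0"
proof -
  let ?S = "sphere (0::real^'n) 1"
  define r where "r x = ((X *v x) \<bullet> x) / ((Y *v x) \<bullet> x)" for x
  have nz: "\<forall>x\<in>?S. (Y *v x) \<bullet> x \<noteq> 0"
  proof
    fix x :: "real^'n" assume "x \<in> ?S"
    then have "x \<noteq> 0" by auto
    from pdY[OF this] show "(Y *v x) \<bullet> x \<noteq> 0" by simp
  qed
  have "continuous_on ?S r"
    unfolding r_def by (intro continuous_intros) (metis nz)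
  moreover have "?S \<noteq> {}" by simp
  ultimately obtain v where v: "norm v = 1" "\<And>x. norm x = 1 \<Longrightarrow> r v \<le> r x"
    using continuous_attains_inf[of ?S r] by auto
  have v0: "v \<noteq> 0" using v(1) by auto
  have rv: "r v \<le> r x" if "x \<noteq> 0" for x
  proof -
    have "r (sgn x) = r x"
      using that by (simp add: r_def sgn_div_norm matrix_vector_mult_scaleR)
    then show ?thesis using v(2)[of "sgn x"] that by (simp add: norm_sgn)
  qed
  define M where "M x = X *v x - r v *\<^sub>R (Y *v x)" for x
  have "M v = 0"
  proof (rule psd_zero_imp_kernel[where M = M])
    show "linear M"
      by (auto intro!: linearI simp: M_def mat_vec_linear algebra_simps)
    show "M x \<bullet> y = x \<bullet> M y" for x y
      by (simp add: M_def inner_diff_left inner_diff_right symmetric_inner[OF symX] symmetric_inner[OF symY])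
    show "0 \<le> M x \<bullet> x" for x
    proof (cases "x = 0")
      case False
      then show ?thesis using rv[of x] pdY[of x]
        by (simp add: M_def inner_diff_left r_def[of x] pos_le_divide_eq)
    qed (simp add: M_def)
    show "M v \<bullet> v = 0"
      using pdY[OF v0] by (simp add: M_def inner_diff_left r_def)
  qed
  then have "(X *v v) \<bullet> (A *v v) = r v * ((Y *v v) \<bullet> (A *v v))"
    by (simp add: M_def)
  then have "r v > 0" using X[OF v0] Y[OF v0]
    by (metis linorder_not_less mult_nonpos_nonpos less_imp_le)
  then have "r x > 0" using rv[OF x] by linarith
  then show ?thesis using pdY[OF x] by (simp add: r_def zero_less_divide_iff)
qed

text \<open>An instance of \<open>kyp_strict\<close> in which a dummy scalar input does not drive
  the state and is merely penalized. A Hurwitz matrix admits no oscillating pair of states, so only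
  the input can be nonzero in the frequency condition. Definiteness of \<open>X\<close> is
  established separately.\<close>

lemma lyapunov_solution_exists:
  fixes A :: "real^'n^'n"
  assumes "hurwitz A"
  shows "\<exists>X. transpose X = X \<and> (\<forall>x. x \<noteq> 0 \<longrightarrow> (X *v x) \<bullet> (A *v x) < 0)"
proof -
  let ?s = "\<lambda>l l' :: (real^'n) \<times> real. - snd l * snd l'"
  have "\<exists>X. transpose X = X \<and> (\<forall>l. l \<noteq> 0 \<longrightarrow> 2 * ((X *v fst l) \<bullet> (A *v fst l)) + ?s l l < 0)"
  proof (rule kyp_strict[where f = "\<lambda>l. A *v fst l" and s = ?s])
    show "linear (\<lambda>l::(real^'n) \<times> real. A *v fst l)"
      by (auto intro!: linearI simp: mat_vec_linear)
    show "bilinear ?s"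
      by (auto simp: bilinear_def algebra_simps intro!: linearI)
    show "?s (0, w) (0, w) < 0" if "w \<noteq> 0" for w
      using that by (simp add: zero_less_mult_iff linorder_neq_iff disj_commute)
    fix \<omega> and l1 l2 :: "(real^'n) \<times> real"
    assume "l1 \<noteq> 0 \<or> l2 \<noteq> 0" "A *v fst l1 = - \<omega> *\<^sub>R fst l2" "A *v fst l2 = \<omega> *\<^sub>R fst l1"
    with hurwitz_no_imaginary[OF assms this(2,3)] have "snd l1 \<noteq> 0 \<or> snd l2 \<noteq> 0"
      by (auto simp: prod_eq_iff)
    then have "(snd l1)\<^sup>2 + (snd l2)\<^sup>2 > 0"
      by (simp add: sum_power2_gt_zero_iff)
    then show "?s l1 l1 + ?s l2 l2 < 0"
      by (simp add: power2_eq_square)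
  qed
  then obtain X where X: "transpose X = X" "\<And>l::(real^'n) \<times> real. l \<noteq> 0 \<Longrightarrow> 2 * ((X *v fst l) \<bullet> (A *v fst l)) + ?s l l < 0"
    by blast
  show ?thesis
  proof (intro exI conjI allI impI)
    show "(X *v x) \<bullet> (A *v x) < 0" if "x \<noteq> 0" for x
      using X(2)[of "(x, 0)"] that by (simp add: zero_prod_def)
  qed (rule X(1))
qed

lemma hurwitz_shift:
  assumes "hurwitz A" "\<tau> \<ge> 0" shows "hurwitz (A - \<tau> *\<^sub>R mat 1)"
  unfolding hurwitz_iff
proof (intro allI impI, elim conjE)
  fix \<sigma> \<omega> a b
  assume ab: "a \<noteq> 0 \<or> b \<noteq> 0" "(A - \<tau> *\<^sub>R mat 1) *v a = \<sigma> *\<^sub>R a - \<omega> *\<^sub>R b" "(A - \<tau> *\<^sub>R mat 1) *v b = \<omega> *\<^sub>R a + \<sigma> *\<^sub>R b"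
  then have "A *v a = (\<sigma> + \<tau>) *\<^sub>R a - \<omega> *\<^sub>R b" "A *v b = \<omega> *\<^sub>R a + (\<sigma> + \<tau>) *\<^sub>R b"
    by (simp_all add: matrix_vector_mult_diff_rdistrib scaleR_matrix_vector_assoc[symmetric] algebra_simps)
  with assms(1) ab(1) have "\<sigma> + \<tau> < 0" unfolding hurwitz_iff by blast
  then show "\<sigma> < 0" using assms(2) by simp
qed

lemma matrix_form_bound:
  fixes M :: "real^'n^'n"
  obtains c where "c > 0" "\<And>x. \<bar>(M *v x) \<bullet> x\<bar> \<le> c * (x \<bullet> x)"
proof
  show "onorm ((*v) M) + 1 > 0"
    using onorm_pos_le[OF matrix_vector_mul_bounded_linear[of M]] by simp
  fix x
  have "\<bar>(M *v x) \<bullet> x\<bar> \<le> norm (M *v x) * norm x" by (rule Cauchy_Schwarz_ineq2)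
  also have "\<dots> \<le> onorm ((*v) M) * norm x * norm x"
    by (intro mult_right_mono onorm matrix_vector_mul_bounded_linear) simp
  also have "\<dots> \<le> (onorm ((*v) M) + 1) * (x \<bullet> x)"
    by (simp add: dot_square_norm power2_eq_square algebra_simps)
  finally show "\<bar>(M *v x) \<bullet> x\<bar> \<le> (onorm ((*v) M) + 1) * (x \<bullet> x)" .
qed

lemma bilinear_matrix_form: "bilinear (\<lambda>x y. (X *v x) \<bullet> (M *v y))" for X :: "real^'n^'k" and M :: "real^'m^'k"
  by (auto simp: bilinear_def mat_vec_linear inner_add_left inner_add_right
    intro!: linearI)

text \<open>Continuation in the shift \<open>A - \<tau> I\<close>: for large \<open>\<tau>\<close> the identity is a definite solution, a strict
  solution stays one for nearby shifts, and all strict solutions at one shift are definite together.\<close>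

lemma lyapunov_pos:
  fixes A X :: "real^'n^'n"
  assumes A: "hurwitz A" and sym: "transpose X = X"
    and X: "\<And>x. x \<noteq> 0 \<Longrightarrow> (X *v x) \<bullet> (A *v x) < 0" and x: "x \<noteq> 0"
  shows "(X *v x) \<bullet> x > 0"
proof -
  define sol where "sol \<tau> Z \<longleftrightarrow> transpose Z = Z \<and> (\<forall>x. x \<noteq> 0 \<longrightarrow> (Z *v x) \<bullet> (A *v x) - \<tau> * ((Z *v x) \<bullet> x) < 0)"
    for \<tau> and Z :: "real^'n^'n"
  define pd where "pd Z \<longleftrightarrow> (\<forall>x. x \<noteq> 0 \<longrightarrow> (Z *v x) \<bullet> x > 0)" for Z :: "real^'n^'n"
  have shift: "(Z *v x) \<bullet> ((A - \<tau> *\<^sub>R mat 1) *v x) = (Z *v x) \<bullet> (A *v x) - \<tau> * ((Z *v x) \<bullet> x)" for Z x \<tau>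
    by (simp add: matrix_vector_mult_diff_rdistrib scaleR_matrix_vector_assoc[symmetric] inner_diff_right)
  have ex: "\<exists>Z. sol \<tau> Z" if "\<tau> \<ge> 0" for \<tau>
    using lyapunov_solution_exists[OF hurwitz_shift[OF A that]] by (simp add: sol_def shift)
  have cmp: "pd Z" if "sol \<tau> Z" "sol \<tau> Y" "pd Y" for \<tau> Z Y
    unfolding pd_def
  proof (intro allI impI)
    fix x :: "real^'n" assume "x \<noteq> 0"
    then show "(Z *v x) \<bullet> x > 0"
      by (intro lyapunov_compare[of Z "A - \<tau> *\<^sub>R mat 1" Y]) (use that in \<open>auto simp: sol_def shift pd_def\<close>)
  qed
  define T where "T = {\<tau>. \<tau> \<ge> 0 \<and> (\<exists>Z. sol \<tau> Z \<and> pd Z)}"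
  have near: "\<exists>\<delta>>0. \<forall>\<tau>'. \<bar>\<tau>' - \<tau>\<bar> < \<delta> \<longrightarrow> sol \<tau>' Z" if Z: "sol \<tau> Z" for \<tau> Z
  proof -
    obtain \<epsilon> where e: "\<epsilon> > 0" "\<And>x. (Z *v x) \<bullet> ((A - \<tau> *\<^sub>R mat 1) *v x) \<le> - \<epsilon> * (x \<bullet> x)"
      by (rule bilinear_neg_uniform[OF bilinear_matrix_form[of Z "A - \<tau> *\<^sub>R mat 1"]])
        (use Z in \<open>auto simp: sol_def shift\<close>)
    obtain c where c: "c > 0" "\<And>x. \<bar>(Z *v x) \<bullet> x\<bar> \<le> c * (x \<bullet> x)" by (rule matrix_form_bound) blast
    have "sol \<tau>' Z" if t: "\<bar>\<tau>' - \<tau>\<bar> < \<epsilon> / c" for \<tau>'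
      unfolding sol_def
    proof (intro conjI allI impI)
      show "transpose Z = Z" using Z by (simp add: sol_def)
      fix x :: "real^'n" assume "x \<noteq> 0"
      then have xx: "x \<bullet> x > 0" by simp
      have "\<bar>(\<tau> - \<tau>') * ((Z *v x) \<bullet> x)\<bar> \<le> \<bar>\<tau> - \<tau>'\<bar> * (c * (x \<bullet> x))"
        unfolding abs_mult by (intro mult_left_mono c) simp
      also have "\<dots> < (\<epsilon> / c) * (c * (x \<bullet> x))"
        using t xx c by (intro mult_strict_right_mono) auto
      also have "\<dots> = \<epsilon> * (x \<bullet> x)" using c by simp
      finally show "(Z *v x) \<bullet> (A *v x) - \<tau>' * ((Z *v x) \<bullet> x) < 0"
        using e(2)[of x] unfolding shift by (simp add: algebra_simps)
    qed
    then show ?thesis using e c by (intro exI[of _ "\<epsilon> / c"]) auto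
  qed
  have "T \<noteq> {}"
  proof -
    obtain c where c: "c > 0" "\<And>x. \<bar>(A *v x) \<bullet> x\<bar> \<le> c * (x \<bullet> x)" by (rule matrix_form_bound) blast
    \<comment> \<open>\<open>c\<close> bounds the form of \<open>A\<close>, so a shift by c + 1
      makes the identity a strict solution.\<close>
    have "sol (c + 1) (mat 1)"
      unfolding sol_def
    proof (intro conjI allI impI)
      fix x :: "real^'n" assume "x \<noteq> 0"
      then show "(mat 1 *v x) \<bullet> (A *v x) - (c + 1) * ((mat 1 *v x) \<bullet> x) < 0"
        using c(2)[of x] by (simp add: algebra_simps inner_commute[of x "A *v x"]) (smt (verit) inner_gt_zero_iff)
    qed (simp add: transpose_mat)
    moreover have "pd (mat 1)" by (simp add: pd_def)
    ultimately have "c + 1 \<in> T" using c by (auto simp: T_def)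
    then show ?thesis by blast
  qed
  have bdd: "bdd_below T" by (auto simp: T_def bdd_below_def)
  define s where "s = Inf T"
  have s0: "s \<ge> 0" unfolding s_def using \<open>T \<noteq> {}\<close> by (intro cInf_greatest) (auto simp: T_def)
  \<comment> \<open>A solution at the infimum \<open>s\<close> also solves at some \<tau> of
    \<open>T\<close> within \<delta> of \<open>s\<close>, where a definite solution exists.
    Comparison makes it definite, and it would serve at shifts below \<open>s\<close> as well unless
    s = 0.\<close>
  obtain Z where Z: "sol s Z" using ex[OF s0] by blast
  obtain \<delta> where \<delta>: "\<delta> > 0" "\<And>\<tau>'. \<bar>\<tau>' - s\<bar> < \<delta> \<Longrightarrow> sol \<tau>' Z" using near[OF Z] by blast
  obtain \<tau> where \<tau>: "\<tau> \<in> T" "\<tau> < s + \<delta>"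
    using cInf_lessD[OF \<open>T \<noteq> {}\<close>, of "s + \<delta>"] \<delta>(1) by (auto simp: s_def)
  have "s \<le> \<tau>" unfolding s_def by (intro cInf_lower \<tau> bdd)
  then have "sol \<tau> Z" using \<delta>(2) \<tau>(2) by simp
  then have pdZ: "pd Z" using \<tau>(1) cmp unfolding T_def by blast
  have "s = 0"
  proof (rule ccontr)
    assume "s \<noteq> 0"
    define t where "t = max 0 (s - \<delta> / 2)"
    have t: "t < s" "t \<ge> 0" "\<bar>t - s\<bar> < \<delta>" using s0 \<open>s \<noteq> 0\<close> \<delta>(1) by (auto simp: t_def)
    then have "t \<in> T" using \<delta>(2)[of t] pdZ by (auto simp: T_def)
    then have "s \<le> t" unfolding s_def by (intro cInf_lower bdd)
    then show False using t by simp
  qed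
  moreover have "sol 0 X" using sym X by (simp add: sol_def)
  ultimately have "pd X" using cmp Z pdZ by blast
  then show ?thesis using x by (simp add: pd_def)
qed

subsection \<open>The strict bounded real lemma\<close>

lemma cvec_add: "cvec a b + cvec c d = cvec (a + c) (b + d)"
  by (simp add: cvec_def vec_eq_iff complex_eq_iff)

definition transfer_fn :: "real^'n^'n \<Rightarrow> real^'m^'n \<Rightarrow> real^'n^'p \<Rightarrow> real^'m^'p \<Rightarrow> real \<Rightarrow> complex^'m^'p" where
  "transfer_fn A B C D \<omega> = cmat C ** matrix_inv (mat (\<i> * \<omega>) - cmat A) ** cmat B + cmat D"

abbreviation gain :: "real^'n^'n \<Rightarrow> real^'m^'n \<Rightarrow> real^'n^'p \<Rightarrow> real^'m^'p \<Rightarrow> real \<Rightarrow> real" where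
  "gain A B C D \<omega> \<equiv> onorm (\<lambda>v. transfer_fn A B C D \<omega> *v v)"

text \<open>The bounded real matrix inequality, read as strict dissipation: x^T X x is a storage
  function for the supply rate \<gamma>^2 |w|^2 - |z|^2.\<close>

definition brl_lmi :: "real^'n^'n \<Rightarrow> real^'m^'n \<Rightarrow> real^'n^'p \<Rightarrow> real^'m^'p \<Rightarrow> real \<Rightarrow> real^'n^'n \<Rightarrow> bool" where
  "brl_lmi A B C D \<gamma> X \<longleftrightarrow> transpose X = X \<and> (\<forall>x. x \<noteq> 0 \<longrightarrow> (X *v x) \<bullet> x > 0) \<and>
    (\<forall>x w. (x, w) \<noteq> 0 \<longrightarrow> 2 * ((X *v x) \<bullet> (A *v x + B *v w))
       + (C *v x + D *v w) \<bullet> (C *v x + D *v w) - \<gamma>\<^sup>2 * (w \<bullet> w) < 0)"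

lemma hurwitz_resolvent_invertible:
  assumes "hurwitz A" shows "invertible (mat (\<i> * complex_of_real \<omega>) - cmat A)"
proof (rule invertible_kerI, rule ccontr)
  fix x assume x: "(mat (\<i> * complex_of_real \<omega>) - cmat A) *v x = 0" "x \<noteq> 0"
  have "mat (\<i> * complex_of_real \<omega>) *v x = (\<i> * complex_of_real \<omega>) *s x"
    by (simp add: vec_eq_iff matrix_vector_mult_def mat_def if_distrib[of "\<lambda>c. c * _"] cong: if_cong)
  with x have "cmat A *v x = (\<i> * complex_of_real \<omega>) *s x"
    by (simp add: matrix_vector_mult_diff_rdistrib)
  then have "Re (\<i> * complex_of_real \<omega>) < 0" using assms x(2) unfolding hurwitz_def by blast
  then show False by simp
qed

text \<open>\<open>x1\<close> and \<open>x2\<close> are the real and imaginary parts of the state (i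
  \<omega> I - A)^{-1} B w caused by the input w1 + i w2.\<close>

lemma transfer_fn_response:
  assumes "hurwitz A"
  obtains x1 x2 where "A *v x1 + B *v w1 = - \<omega> *\<^sub>R x2" "A *v x2 + B *v w2 = \<omega> *\<^sub>R x1"
    "transfer_fn A B C D \<omega> *v cvec w1 w2 = cvec (C *v x1 + D *v w1) (C *v x2 + D *v w2)"
proof -
  define M where "M = mat (\<i> * complex_of_real \<omega>) - cmat A"
  define x where "x = matrix_inv M *v (cmat B *v cvec w1 w2)"
  have inv: "invertible M" using hurwitz_resolvent_invertible[OF assms] by (simp add: M_def)
  have Mx: "M *v x = cmat B *v cvec w1 w2"
    by (simp add: x_def matrix_vector_mul_assoc matrix_inv_right[OF inv] matrix_mul_assoc)
  obtain x1 x2 where x12: "x = cvec x1 x2" by (rule cvec_cases)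
  have "mat (\<i> * complex_of_real \<omega>) *v x = Complex 0 \<omega> *s x"
    by (simp add: vec_eq_iff matrix_vector_mult_def mat_def if_distrib[of "\<lambda>c. c * _"] complex_eq_iff cong: if_cong)
  then have "Complex 0 \<omega> *s x = cmat A *v x + cmat B *v cvec w1 w2"
    using Mx by (simp add: M_def matrix_vector_mult_diff_rdistrib algebra_simps)
  then have "- \<omega> *\<^sub>R x2 = A *v x1 + B *v w1" "\<omega> *\<^sub>R x1 = A *v x2 + B *v w2"
    unfolding x12 cvec_scale cmat_cvec cvec_add by simp_all
  moreover have "transfer_fn A B C D \<omega> *v cvec w1 w2 = cmat C *v x + cmat D *v cvec w1 w2"
    by (simp add: transfer_fn_def x_def M_def matrix_vector_mult_add_rdistrib matrix_vector_mul_assoc matrix_mul_assoc)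
  ultimately show ?thesis
    by (intro that[of x1 x2]) (simp_all add: x12 cmat_cvec cvec_add)
qed

lemma bounded_linear_pair_bound:
  fixes M :: "real^'n^'k"
  obtains c where "c > 0" "\<And>a b. norm (M *v a, M *v b) \<le> c * norm (a, b)"
proof -
  have "bounded_linear (\<lambda>p. (M *v fst p, M *v snd p))"
    by (intro bounded_linear_Pair bounded_linear_compose[OF matrix_vector_mul_bounded_linear] bounded_linear_fst bounded_linear_snd)
  from bounded_linear.pos_bounded[OF this] obtain c where "c > 0" "\<And>p. norm (M *v fst p, M *v snd p) \<le> norm p * c"
    by auto
  then show ?thesis by (intro that[of c]) (auto simp: mult.commute)
qed

text \<open>The bound has to be uniform in \<omega>. In the Lyapunov estimate for
  (\<open>x1\<close>, \<open>x2\<close>) the two terms containing \<omega> cancel by symmetry of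
  \<open>Y\<close>, and only the pairing of Y x with B w is left.\<close>

lemma response_state_bound:
  fixes A :: "real^'n^'n" and B :: "real^'m^'n"
  assumes "hurwitz A"
  obtains k where "k > 0" "\<And>\<omega> x1 x2 w1 w2. A *v x1 + B *v w1 = - \<omega> *\<^sub>R x2 \<Longrightarrow> A *v x2 + B *v w2 = \<omega> *\<^sub>R x1
     \<Longrightarrow> norm (x1, x2) \<le> k * norm (w1, w2)"
proof -
  obtain Y where Y: "transpose Y = Y" "\<And>x. x \<noteq> 0 \<Longrightarrow> (Y *v x) \<bullet> (A *v x) < 0"
    using lyapunov_solution_exists[OF assms] by blast
  obtain \<epsilon> where e: "\<epsilon> > 0" "\<And>x. (Y *v x) \<bullet> (A *v x) \<le> - \<epsilon> * (x \<bullet> x)"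
    by (rule bilinear_neg_uniform[OF bilinear_matrix_form[of Y A]]) (use Y in auto)
  obtain c where c: "c > 0" "\<And>a b. norm (Y *v a, Y *v b) \<le> c * norm (a, b)"
    by (rule bounded_linear_pair_bound[of Y]) blast
  obtain d where d: "d > 0" "\<And>a b. norm (B *v a, B *v b) \<le> d * norm (a, b)"
    by (rule bounded_linear_pair_bound[of B]) blast
  show ?thesis
  proof
    show "c * d / \<epsilon> > 0" using c d e by simp
    fix \<omega> x1 x2 w1 w2
    assume h: "A *v x1 + B *v w1 = - \<omega> *\<^sub>R x2" "A *v x2 + B *v w2 = \<omega> *\<^sub>R x1"
    define x where "x = (x1, x2)"
    define w where "w = (w1, w2)"
    have A12: "A *v x1 = - \<omega> *\<^sub>R x2 - B *v w1" "A *v x2 = \<omega> *\<^sub>R x1 - B *v w2"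
      using h by (simp_all add: algebra_simps eq_diff_eq)
    have sym: "(Y *v x1) \<bullet> x2 = (Y *v x2) \<bullet> x1"
      by (metis symmetric_inner[OF Y(1)] inner_commute)
    have "\<epsilon> * (norm x)\<^sup>2 = \<epsilon> * (x1 \<bullet> x1) + \<epsilon> * (x2 \<bullet> x2)"
      by (simp add: x_def norm_Pair dot_square_norm distrib_left)
    also have "\<dots> \<le> - ((Y *v x1) \<bullet> (A *v x1)) - ((Y *v x2) \<bullet> (A *v x2))"
      using e(2)[of x1] e(2)[of x2] by simp
    also have "\<dots> = (Y *v x1, Y *v x2) \<bullet> (B *v w1, B *v w2)"
      by (simp add: A12 inner_diff_right sym)
    also have "\<dots> \<le> norm (Y *v x1, Y *v x2) * norm (B *v w1, B *v w2)"
      by (rule norm_cauchy_schwarz)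
    also have "\<dots> \<le> (c * norm x) * (d * norm w)"
      unfolding x_def w_def by (intro mult_mono c d) (auto intro: mult_nonneg_nonneg less_imp_le[OF c(1)])
    finally have "\<epsilon> * norm x * norm x \<le> c * d * norm w * norm x"
      by (simp add: power2_eq_square mult_ac)
    then have "\<epsilon> * norm x \<le> c * d * norm w"
      using c d by (cases "x = 0") auto
    then show "norm (x1, x2) \<le> c * d / \<epsilon> * norm (w1, w2)"
      using e(1) by (simp add: x_def w_def field_simps)
  qed
qed

text \<open>A real supremum carries information only for a bounded family; this gives meaning to the
  H-infinity norm of a stable closed loop.\<close>

lemma transfer_fn_bdd:
  fixes A :: "real^'n^'n" and B :: "real^'m^'n" and C :: "real^'n^'p"
  assumes "hurwitz A"
  shows "bdd_above (range (\<lambda>\<omega>. gain A B C D \<omega>))"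
proof -
  obtain k where k: "k > 0" "\<And>\<omega> x1 x2 w1 w2. A *v x1 + B *v w1 = - \<omega> *\<^sub>R x2 \<Longrightarrow> A *v x2 + B *v w2 = \<omega> *\<^sub>R x1
     \<Longrightarrow> norm (x1, x2) \<le> k * norm (w1, w2)"
    by (rule response_state_bound[OF assms, of B]) blast
  obtain c where c: "c > 0" "\<And>a b. norm (C *v a, C *v b) \<le> c * norm (a, b)"
    by (rule bounded_linear_pair_bound[of C]) blast
  obtain d where d: "d > 0" "\<And>a b. norm (D *v a, D *v b) \<le> d * norm (a, b)"
    by (rule bounded_linear_pair_bound[of D]) blast
  have "norm (transfer_fn A B C D \<omega> *v v) \<le> (c * k + d) * norm v" for \<omega> v
  proof -
    obtain w1 w2 where w: "v = cvec w1 w2" by (rule cvec_cases)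
    obtain x1 x2 where x: "A *v x1 + B *v w1 = - \<omega> *\<^sub>R x2" "A *v x2 + B *v w2 = \<omega> *\<^sub>R x1"
      "transfer_fn A B C D \<omega> *v cvec w1 w2 = cvec (C *v x1 + D *v w1) (C *v x2 + D *v w2)"
      by (rule transfer_fn_response[OF assms]) blast
    have "norm (transfer_fn A B C D \<omega> *v v) = norm ((C *v x1, C *v x2) + (D *v w1, D *v w2))"
      by (simp add: w x(3) norm_cvec)
    also have "\<dots> \<le> c * norm (x1, x2) + d * norm (w1, w2)"
      by (intro norm_triangle_mono c d)
    also have "\<dots> \<le> c * (k * norm (w1, w2)) + d * norm (w1, w2)"
      using k(2)[OF x(1,2)] c(1) by simp
    finally show ?thesis by (simp add: w norm_cvec algebra_simps)
  qed
  then have "gain A B C D \<omega> \<le> c * k + d" for \<omega>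
    by (intro onorm_bound) (use c k d in \<open>auto simp: less_imp_le\<close>)
  then show ?thesis by (auto simp: bdd_above_def)
qed

lemma linear_affine_output:
  "linear (\<lambda>l. C *v fst l + D *v snd l)" for C :: "real^'n^'k" and D :: "real^'m^'k"
  by (auto intro!: linearI simp: mat_vec_linear algebra_simps)

lemma bilinear_inner_comp:
  fixes f g :: "'a::euclidean_space \<Rightarrow> 'b::euclidean_space"
  assumes "linear f" "linear g"
  shows "bilinear (\<lambda>x y. f x \<bullet> g y)"
  unfolding bilinear_def
  by (auto intro!: linearI simp: linear_add[OF assms(1)] linear_add[OF assms(2)] linear_scale[OF assms(1)]
     linear_scale[OF assms(2)] inner_add_left inner_add_right)

lemma bilinear_diff_fun: "bilinear f \<Longrightarrow> bilinear g \<Longrightarrow> bilinear (\<lambda>x y. f x y - g x y)"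
  by (auto simp: bilinear_def intro!: linear_compose_sub)

lemma bilinear_add_fun: "bilinear f \<Longrightarrow> bilinear g \<Longrightarrow> bilinear (\<lambda>x y. f x y + g x y)"
  by (auto simp: bilinear_def intro!: linear_compose_add)

lemma bilinear_scale_fun: "bilinear f \<Longrightarrow> bilinear (\<lambda>x y. (c::real) * f x y)"
  by (auto simp: bilinear_def linear_iff algebra_simps)

text \<open>Applies \<open>kyp_strict\<close> to the supply |z|^2 - \<gamma>^2 |w|^2. Its frequency
  hypothesis is the gain bound at a finite \<omega>; its static hypothesis is the gain at infinity,
  available only as a limit. Setting w = 0 leaves a Lyapunov inequality, and
  \<open>lyapunov_pos\<close> then makes \<open>X\<close> positive.\<close>

lemma brl_necessity:
  fixes A :: "real^'n^'n" and B :: "real^'m^'n" and C :: "real^'n^'p"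
  assumes A: "hurwitz A"
    and lt: "(SUP \<omega>. gain A B C D \<omega>) < \<gamma>"
  shows "\<gamma> > 0 \<and> (\<exists>X. brl_lmi A B C D \<gamma> X)"
proof -
  define h where "h = (SUP \<omega>. gain A B C D \<omega>)"
  have on: "gain A B C D \<omega> \<le> h" for \<omega>
    unfolding h_def by (intro cSUP_upper transfer_fn_bdd A) simp
  have hb: "norm (transfer_fn A B C D \<omega> *v v) \<le> h * norm v" for \<omega> v
    by (rule order_trans[OF onorm[OF matrix_vector_mul_bounded_linear] mult_right_mono[OF on]]) simp
  have h0: "h \<ge> 0"
    using onorm_pos_le[OF matrix_vector_mul_bounded_linear] on by (meson order_trans)
  have hg: "h < \<gamma>" using lt by (simp add: h_def)
  \<comment> \<open>Two solutions of the response equations differ by an oscillation without input,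
    which is zero; so every solution is the one computed by the transfer function.\<close>
  have resp: "norm (C *v x1 + D *v w1, C *v x2 + D *v w2) \<le> h * norm (w1, w2)"
    if x: "A *v x1 + B *v w1 = - \<omega> *\<^sub>R x2" "A *v x2 + B *v w2 = \<omega> *\<^sub>R x1" for x1 x2 w1 w2 \<omega>
  proof -
    obtain y1 y2 where y: "A *v y1 + B *v w1 = - \<omega> *\<^sub>R y2" "A *v y2 + B *v w2 = \<omega> *\<^sub>R y1"
      "transfer_fn A B C D \<omega> *v cvec w1 w2 = cvec (C *v y1 + D *v w1) (C *v y2 + D *v w2)"
      by (rule transfer_fn_response[OF A]) blast
    have e: "A *v (x1 - y1) = - \<omega> *\<^sub>R (x2 - y2)" "A *v (x2 - y2) = \<omega> *\<^sub>R (x1 - y1)"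
    proof -
      have "A *v (x1 - y1) = (A *v x1 + B *v w1) - (A *v y1 + B *v w1)"
        "A *v (x2 - y2) = (A *v x2 + B *v w2) - (A *v y2 + B *v w2)"
        by (simp_all add: matrix_vector_mult_diff_distrib)
      then show "A *v (x1 - y1) = - \<omega> *\<^sub>R (x2 - y2)" "A *v (x2 - y2) = \<omega> *\<^sub>R (x1 - y1)"
        unfolding x y(1,2) by (simp_all add: scaleR_diff_right)
    qed
    have "x1 = y1" "x2 = y2"
      using hurwitz_no_imaginary[OF A e] by auto
    then show ?thesis using hb[of \<omega> "cvec w1 w2"] y(3) by (simp add: norm_cvec)
  qed
  obtain k where k: "k > 0" "\<And>\<omega> x1 x2 w1 w2. A *v x1 + B *v w1 = - \<omega> *\<^sub>R x2 \<Longrightarrow> A *v x2 + B *v w2 = \<omega> *\<^sub>R x1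
     \<Longrightarrow> norm (x1, x2) \<le> k * norm (w1, w2)"
    by (rule response_state_bound[OF A, of B]) blast
  \<comment> \<open>\<open>D\<close> is the limit of the transfer function at infinite frequency:
    \<omega> |x| is the norm of A x + B w, which is bounded by a multiple of |w|, so the state
    contributes only O(1/\<omega>) to the output.\<close>
  have Dbound: "norm (D *v w) \<le> h * norm w" for w
  proof -
    obtain a where a: "a > 0" "\<And>x y. norm (A *v x, A *v y) \<le> a * norm (x, y)"
      by (rule bounded_linear_pair_bound[of A]) blast
    obtain b where b: "b > 0" "\<And>x y. norm (B *v x, B *v y) \<le> b * norm (x, y)"
      by (rule bounded_linear_pair_bound[of B]) blast
    obtain c where c: "c > 0" "\<And>x y. norm (C *v x, C *v y) \<le> c * norm (x, y)"
      by (rule bounded_linear_pair_bound[of C]) blast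
    define K where "K = c * ((a * k + b) * norm w)"
    have "norm (D *v w) - h * norm w \<le> K * inverse \<omega>" if "\<omega> > 0" for \<omega>
    proof -
      obtain x1 x2 where x: "A *v x1 + B *v w = - \<omega> *\<^sub>R x2" "A *v x2 + B *v 0 = \<omega> *\<^sub>R x1"
        by (rule transfer_fn_response[OF A]) blast
      have nw: "norm (w, 0 :: real^'m) = norm w" by (simp add: norm_Pair)
      have "\<omega> * norm (x1, x2) = norm (\<omega> *\<^sub>R x1, - \<omega> *\<^sub>R x2)"
        using that by (simp add: norm_Pair power_mult_distrib real_sqrt_mult flip: distrib_left)
      also have "\<dots> = norm (- \<omega> *\<^sub>R x2, \<omega> *\<^sub>R x1)" by (simp add: norm_Pair add.commute)
      also have "\<dots> = norm ((A *v x1, A *v x2) + (B *v w, B *v 0))"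
        by (simp only: x[symmetric] add_Pair)
      also have "\<dots> \<le> a * norm (x1, x2) + b * norm (w, 0 :: real^'m)"
        by (intro norm_triangle_mono a b)
      also have "\<dots> \<le> a * (k * norm w) + b * norm w"
        using k(2)[OF x] a(1) by (simp add: nw)
      finally have 1: "norm (x1, x2) \<le> ((a * k + b) * norm w) * inverse \<omega>"
        using that by (simp add: field_simps)
      have "norm (D *v w) \<le> norm (D *v w, D *v (0 :: real^'m))" by (simp add: norm_Pair)
      also have "(D *v w, D *v (0 :: real^'m)) = (C *v x1 + D *v w, C *v x2 + D *v 0) - (C *v x1, C *v x2)"
        by simp
      also have "norm \<dots> \<le> norm (C *v x1 + D *v w, C *v x2 + D *v 0) + norm (C *v x1, C *v x2)"
        by (rule norm_triangle_ineq4)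
      also have "\<dots> \<le> h * norm w + c * norm (x1, x2)"
        using resp[OF x] c(2)[of x1 x2] by (simp add: nw)
      also have "\<dots> \<le> h * norm w + c * (((a * k + b) * norm w) * inverse \<omega>)"
        using 1 c(1) by simp
      finally show ?thesis by (simp add: K_def mult_ac)
    qed
    then have "\<forall>\<^sub>F \<omega> in at_top. norm (D *v w) - h * norm w \<le> K * inverse \<omega>"
      by (intro eventually_mono[OF eventually_gt_at_top[of "0::real"]])
    moreover have "((\<lambda>\<omega>. K * inverse \<omega>) \<longlongrightarrow> K * 0) at_top"
      by (intro tendsto_intros tendsto_inverse_0_at_top filterlim_ident)
    ultimately have "norm (D *v w) - h * norm w \<le> K * 0"
      using tendsto_lowerbound[OF _ _ trivial_limit_at_top_linorder] by blast
    then show ?thesis by simp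
  qed
  have sq: "z \<bullet> z + z' \<bullet> z' - \<gamma>\<^sup>2 * (w \<bullet> w + w' \<bullet> w') < 0"
    if "norm (z, z') \<le> h * norm (w, w')" "(w, w') \<noteq> 0" for z z' :: "real^'p" and w w' :: "real^'m"
  proof -
    have "norm (w, w') > 0" using that(2) by simp
    then have "h * norm (w, w') < \<gamma> * norm (w, w')" using hg by simp
    then have "norm (z, z') < \<gamma> * norm (w, w')" using that(1) by linarith
    then have "(norm (z, z'))\<^sup>2 < (\<gamma> * norm (w, w'))\<^sup>2" by (intro power_strict_mono) auto
    then show ?thesis by (simp add: norm_Pair dot_square_norm power_mult_distrib)
  qed
  define s where "s l l' = (C *v fst l + D *v snd l) \<bullet> (C *v fst l' + D *v snd l') - \<gamma>\<^sup>2 * (snd l \<bullet> snd l')"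
    for l l' :: "(real^'n) \<times> (real^'m)"
  have "\<exists>X. transpose X = X \<and> (\<forall>l. l \<noteq> 0 \<longrightarrow> 2 * ((X *v fst l) \<bullet> (A *v fst l + B *v snd l)) + s l l < 0)"
  proof (rule kyp_strict[where f = "\<lambda>l. A *v fst l + B *v snd l" and s = s])
    show "linear (\<lambda>l. A *v fst l + B *v snd l)" by (rule linear_affine_output)
    show "bilinear s"
      unfolding s_def
      by (intro bilinear_diff_fun bilinear_scale_fun bilinear_inner_comp linear_affine_output linear_snd)
    show "s (0, w) (0, w) < 0" if "w \<noteq> 0" for w
      using sq[of "D *v w" 0 w 0] Dbound[of w] that by (simp add: s_def norm_Pair zero_prod_def)
    fix \<omega> and l1 l2 :: "(real^'n) \<times> (real^'m)"
    assume l: "l1 \<noteq> 0 \<or> l2 \<noteq> 0" "A *v fst l1 + B *v snd l1 = - \<omega> *\<^sub>R fst l2"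
      "A *v fst l2 + B *v snd l2 = \<omega> *\<^sub>R fst l1"
    have "(snd l1, snd l2) \<noteq> 0"
    proof
      assume "(snd l1, snd l2) = 0"
      then have z: "snd l1 = 0" "snd l2 = 0" by (simp_all add: zero_prod_def)
      then show False
        using l hurwitz_no_imaginary[OF A, of "fst l1" \<omega> "fst l2"] by (simp add: prod_eq_iff)
    qed
    from sq[OF resp[OF l(2,3)] this] show "s l1 l1 + s l2 l2 < 0"
      by (simp add: s_def algebra_simps)
  qed
  then obtain X where sym: "transpose X = X"
    and X: "\<And>l. l \<noteq> 0 \<Longrightarrow> 2 * ((X *v fst l) \<bullet> (A *v fst l + B *v snd l)) + s l l < 0" by blast
  have "(X *v x) \<bullet> (A *v x) < 0" if "x \<noteq> 0" for x
  proof -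
    have "2 * ((X *v x) \<bullet> (A *v x)) + (C *v x) \<bullet> (C *v x) < 0"
      using X[of "(x, 0)"] that by (simp add: s_def zero_prod_def)
    then show ?thesis using inner_ge_zero[of "C *v x"] by linarith
  qed
  then have "(X *v x) \<bullet> x > 0" if "x \<noteq> 0" for x
    using lyapunov_pos[OF A sym _ that] by blast
  moreover have "2 * ((X *v x) \<bullet> (A *v x + B *v w)) + (C *v x + D *v w) \<bullet> (C *v x + D *v w) - \<gamma>\<^sup>2 * (w \<bullet> w) < 0"
    if "(x, w) \<noteq> 0" for x w
    using X[OF that] by (simp add: s_def algebra_simps)
  ultimately have "brl_lmi A B C D \<gamma> X" using sym by (auto simp: brl_lmi_def)
  then show ?thesis using h0 hg by auto
qed

text \<open>On an oscillating pair the storage terms cancel by symmetry of \<open>X\<close>, and the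
  dissipation inequality becomes a gain bound whose margin is independent of \<omega>. On an
  eigenvector of \<open>A\<close> the same sum is \<sigma> times the storage, which forces \<sigma>
  < 0.\<close>

lemma brl_sufficiency:
  fixes A :: "real^'n^'n" and B :: "real^'m^'n" and C :: "real^'n^'p"
  assumes g: "\<gamma> > 0" and lmi: "brl_lmi A B C D \<gamma> X"
  shows "hurwitz A" and "(SUP \<omega>. gain A B C D \<omega>) < \<gamma>"
proof -
  have sym: "transpose X = X" and pd: "\<And>x. x \<noteq> 0 \<Longrightarrow> (X *v x) \<bullet> x > 0"
    and neg: "\<And>x w. (x, w) \<noteq> 0 \<Longrightarrow> 2 * ((X *v x) \<bullet> (A *v x + B *v w))
       + (C *v x + D *v w) \<bullet> (C *v x + D *v w) - \<gamma>\<^sup>2 * (w \<bullet> w) < 0"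
    using lmi by (auto simp: brl_lmi_def)
  have negA: "(X *v x) \<bullet> (A *v x) < 0" if "x \<noteq> 0" for x
  proof -
    have "2 * ((X *v x) \<bullet> (A *v x)) + (C *v x) \<bullet> (C *v x) < 0"
      using neg[of x 0] that by (simp add: zero_prod_def)
    then show ?thesis using inner_ge_zero[of "C *v x"] by linarith
  qed
  have negA0: "(X *v x) \<bullet> (A *v x) \<le> 0" for x
    using negA[of x] by (cases "x = 0") auto
  have pd0: "(X *v x) \<bullet> x \<ge> 0" for x
    using pd[of x] by (cases "x = 0") auto
  have symX: "(X *v x) \<bullet> y = (X *v y) \<bullet> x" for x y
    by (metis symmetric_inner[OF sym] inner_commute)
  show hA: "hurwitz A"
    unfolding hurwitz_iff
  proof (intro allI impI, elim conjE)
    fix \<sigma> \<omega> a b assume h: "a \<noteq> 0 \<or> b \<noteq> 0" "A *v a = \<sigma> *\<^sub>R a - \<omega> *\<^sub>R b" "A *v b = \<omega> *\<^sub>R a + \<sigma> *\<^sub>R b"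
    have "(X *v a) \<bullet> (A *v a) + (X *v b) \<bullet> (A *v b) = \<sigma> * ((X *v a) \<bullet> a + (X *v b) \<bullet> b)"
      by (simp add: h inner_diff_right inner_add_right symX[of a b] algebra_simps)
    moreover have "(X *v a) \<bullet> (A *v a) + (X *v b) \<bullet> (A *v b) < 0"
      using h(1) negA[of a] negA[of b] negA0[of a] negA0[of b] by linarith
    moreover have "(X *v a) \<bullet> a + (X *v b) \<bullet> b \<ge> 0" using pd0 by simp
    ultimately show "\<sigma> < 0" by (metis linorder_not_less mult_nonneg_nonneg)
  qed
  \<comment> \<open>The zero block brings the factor into the shape covered by
    \<open>linear_affine_output\<close>.\<close>
  define q where "q l l' = 2 * ((X *v fst l + 0 *v snd l) \<bullet> (A *v fst l' + B *v snd l'))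
       + (C *v fst l + D *v snd l) \<bullet> (C *v fst l' + D *v snd l') - \<gamma>\<^sup>2 * (snd l \<bullet> snd l')"
    for l l' :: "(real^'n) \<times> (real^'m)"
  have "bilinear q"
    unfolding q_def
    by (intro bilinear_diff_fun bilinear_add_fun bilinear_scale_fun bilinear_inner_comp linear_affine_output linear_snd)
  then obtain \<epsilon> where e: "\<epsilon> > 0" "\<And>l. q l l \<le> - \<epsilon> * (l \<bullet> l)"
    by (rule bilinear_neg_uniform) (use neg in \<open>auto simp: q_def\<close>)
  \<comment> \<open>The minimum with \<gamma>^2 keeps the radicand of \<open>c\<close>
    nonnegative.\<close>
  define \<delta> where "\<delta> = min \<epsilon> (\<gamma>\<^sup>2)"
  have d: "0 < \<delta>" "\<delta> \<le> \<epsilon>" "\<delta> \<le> \<gamma>\<^sup>2" using e g by (auto simp: \<delta>_def)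
  define c where "c = sqrt (\<gamma>\<^sup>2 - \<delta>)"
  have c0: "c \<ge> 0" using d by (simp add: c_def)
  have cg: "c < \<gamma>" unfolding c_def using d g by (intro real_less_lsqrt) auto
  have "norm (transfer_fn A B C D \<omega> *v v) \<le> c * norm v" for \<omega> v
  proof -
    obtain w1 w2 where w: "v = cvec w1 w2" by (rule cvec_cases)
    obtain x1 x2 where x: "A *v x1 + B *v w1 = - \<omega> *\<^sub>R x2" "A *v x2 + B *v w2 = \<omega> *\<^sub>R x1"
      "transfer_fn A B C D \<omega> *v cvec w1 w2 = cvec (C *v x1 + D *v w1) (C *v x2 + D *v w2)"
      by (rule transfer_fn_response[OF hA]) blast
    let ?z1 = "C *v x1 + D *v w1" and ?z2 = "C *v x2 + D *v w2"
    have "?z1 \<bullet> ?z1 + ?z2 \<bullet> ?z2 - \<gamma>\<^sup>2 * (w1 \<bullet> w1 + w2 \<bullet> w2) = q (x1, w1) (x1, w1) + q (x2, w2) (x2, w2)"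
      unfolding q_def fst_conv snd_conv x(1) x(2) by (simp add: symX[of x1 x2] algebra_simps)
    also have "\<dots> \<le> - \<epsilon> * (w1 \<bullet> w1 + w2 \<bullet> w2)"
    proof -
      have "\<epsilon> * (x1 \<bullet> x1) \<ge> 0" "\<epsilon> * (x2 \<bullet> x2) \<ge> 0" using e(1) by simp_all
      then show ?thesis using e(2)[of "(x1, w1)"] e(2)[of "(x2, w2)"] by (simp add: algebra_simps)
    qed
    also have "\<dots> \<le> - \<delta> * (w1 \<bullet> w1 + w2 \<bullet> w2)"
      using d(2) by (simp add: mult_right_mono)
    finally have "?z1 \<bullet> ?z1 + ?z2 \<bullet> ?z2 \<le> (\<gamma>\<^sup>2 - \<delta>) * (w1 \<bullet> w1 + w2 \<bullet> w2)"
      by (simp add: algebra_simps)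
    then have "(norm (cvec ?z1 ?z2))\<^sup>2 \<le> (c * norm v)\<^sup>2"
      using d by (simp add: w norm_cvec norm_Pair dot_square_norm power_mult_distrib c_def)
    then have "norm (cvec ?z1 ?z2) \<le> c * norm v"
      by (rule power2_le_imp_le) (simp add: c0)
    then show ?thesis by (simp only: w x(3))
  qed
  then have "gain A B C D \<omega> \<le> c" for \<omega>
    by (intro onorm_bound c0)
  then have "(SUP \<omega>. gain A B C D \<omega>) \<le> c"
    by (intro cSUP_least) auto
  then show "(SUP \<omega>. gain A B C D \<omega>) < \<gamma>"
    using cg by linarith
qed

subsection \<open>Quadratic certificates for the closed loop\<close>

definition join :: "real^'a \<Rightarrow> real^'b \<Rightarrow> real^('a + 'b)" where
  "join x y = (\<chi> i. case i of Inl a \<Rightarrow> x $ a | Inr b \<Rightarrow> y $ b)"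

lemma sum_UNIV_Plus: "(\<Sum>i\<in>UNIV. f i) = (\<Sum>a\<in>UNIV. f (Inl a)) + (\<Sum>b\<in>UNIV. f (Inr b))"
  for f :: "'a::finite + 'b::finite \<Rightarrow> 'c::comm_monoid_add"
  by (subst UNIV_Plus_UNIV[symmetric], subst sum.Plus) (simp_all add: o_def)

lemma join_cases: obtains x y where "v = join x y"
proof
  show "v = join (\<chi> a. v $ Inl a) (\<chi> b. v $ Inr b)"
    by (simp add: join_def vec_eq_iff split: sum.split)
qed

lemma join_eq_iff [simp]: "join x y = join x' y' \<longleftrightarrow> x = x' \<and> y = y'"
  by (auto simp: join_def vec_eq_iff split: sum.splits)

lemma join_eq_0_iff [simp]: "join x y = 0 \<longleftrightarrow> x = 0 \<and> y = 0"
  by (auto simp: join_def vec_eq_iff split: sum.splits)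

lemma join_add: "join x y + join x' y' = join (x + x') (y + y')"
  by (auto simp: join_def vec_eq_iff split: sum.splits)

lemma inner_join: "join x y \<bullet> join x' y' = x \<bullet> x' + y \<bullet> y'"
  by (simp add: inner_vec_def sum_UNIV_Plus join_def)

definition block :: "real^'a^'c \<Rightarrow> real^'b^'c \<Rightarrow> real^'a^'d \<Rightarrow> real^'b^'d \<Rightarrow> real^('a + 'b)^('c + 'd)" where
  "block X V W Z = (\<chi> i j. case (i, j) of
     (Inl a, Inl b) \<Rightarrow> X $ a $ b | (Inl a, Inr b) \<Rightarrow> V $ a $ b
   | (Inr a, Inl b) \<Rightarrow> W $ a $ b | (Inr a, Inr b) \<Rightarrow> Z $ a $ b)"

lemma block_mult: "block X V W Z *v join x y = join (X *v x + V *v y) (W *v x + Z *v y)"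
  by (auto simp: vec_eq_iff block_def join_def matrix_vector_mult_def sum_UNIV_Plus split: sum.splits)

lemma block_cases: obtains X V W Z where "M = block X V W Z"
proof
  show "M = block (\<chi> a b. M $ Inl a $ Inl b) (\<chi> a b. M $ Inl a $ Inr b)
     (\<chi> a b. M $ Inr a $ Inl b) (\<chi> a b. M $ Inr a $ Inr b)"
    by (auto simp: vec_eq_iff block_def split: sum.splits)
qed

lemma transpose_block: "transpose (block X V W Z) = block (transpose X) (transpose W) (transpose V) (transpose Z)"
  by (auto simp: vec_eq_iff block_def transpose_def split: sum.splits)

lemma block_eq_iff: "block X V W Z = block X' V' W' Z' \<longleftrightarrow> X = X' \<and> V = V' \<and> W = W' \<and> Z = Z'"
proof
  assume "block X V W Z = block X' V' W' Z'"
  then have "\<And>x y. block X V W Z *v join x y = block X' V' W' Z' *v join x y" by simp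
  from this[of _ 0] this[of 0] show "X = X' \<and> V = V' \<and> W = W' \<and> Z = Z'"
    by (auto simp: block_mult matrix_eq)
qed simp

section \<open>Closed-loop signals as functions of plant state, controller state and
  disturbance\<close>

definition ctl_input where
  "ctl_input (P :: ('nx::finite, _, _, _, _) plant) (K :: ('nx, _, _) ctrl) x \<xi> w = (case K of (D, C, B, A) \<Rightarrow> D *v (pC2 P *v x + pD21 P *v w) + C *v \<xi>)"

definition plant_rhs where
  "plant_rhs (P :: (_, _, _, _, _) plant) K x \<xi> w = pA P *v x + pB1 P *v w + pB2 P *v ctl_input P K x \<xi> w"

definition ctl_rhs where
  "ctl_rhs (P :: ('nx::finite, _, _, _, _) plant) (K :: ('nx, _, _) ctrl) x \<xi> w = (case K of (D, C, B, A) \<Rightarrow> B *v (pC2 P *v x + pD21 P *v w) + A *v \<xi>)"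

definition perf_output where
  "perf_output (P :: (_, _, _, _, _) plant) K x \<xi> w = pC1 P *v x + pD11 P *v w + pD12 P *v ctl_input P K x \<xi> w"

lemmas closed_loop_defs = ctl_input_def plant_rhs_def ctl_rhs_def perf_output_def

lemma Acl_block: "Acl P (D, C, B, A) = block (pA P + pB2 P ** D ** pC2 P) (pB2 P ** C) (B ** pC2 P) A"
  by (simp add: Acl_def block_def)

lemmas mat_vec_distribs = matrix_vector_mult_add_rdistrib matrix_vector_mult_diff_rdistrib
  matrix_vector_right_distrib matrix_vector_mult_diff_distrib matrix_vector_mul_assoc[symmetric]

lemma closed_loop_state:
  "Acl P K *v join x \<xi> + Bcl P K *v w = join (plant_rhs P K x \<xi> w) (ctl_rhs P K x \<xi> w)"
proof -
  obtain D C B A where K: "K = (D, C, B, A)" by (cases K)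
  have "Bcl P K *v w = join ((pB1 P + pB2 P ** D ** pD21 P) *v w) ((B ** pD21 P) *v w)"
    by (auto simp: vec_eq_iff join_def matrix_vector_mult_def Bcl_def K split: sum.splits)
  then show ?thesis
    by (simp add: K Acl_block block_mult join_add closed_loop_defs mat_vec_distribs algebra_simps)
qed

lemma closed_loop_output:
  "Ccl P K *v join x \<xi> + Dcl P K *v w = perf_output P K x \<xi> w"
proof -
  obtain D C B A where K: "K = (D, C, B, A)" by (cases K)
  have "Ccl P K *v join x \<xi> = (pC1 P + pD12 P ** D ** pC2 P) *v x + (pD12 P ** C) *v \<xi>"
    by (auto simp: vec_eq_iff join_def matrix_vector_mult_def Ccl_def K sum_UNIV_Plus split: sum.splits)
  then show ?thesis
    by (simp add: K Dcl_def closed_loop_defs mat_vec_distribs algebra_simps)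
qed

text \<open>The derivative of \<open>storage\<close> along the closed loop plus |z|^2 - \<gamma>^2
  |w|^2.\<close>

definition dissipation where
  "dissipation (P :: (_, _, _, _, _) plant) \<gamma> K X V Z x \<xi> w =
     2 * ((X *v x + V *v \<xi>) \<bullet> plant_rhs P K x \<xi> w + (transpose V *v x + Z *v \<xi>) \<bullet> ctl_rhs P K x \<xi> w)
     + perf_output P K x \<xi> w \<bullet> perf_output P K x \<xi> w - \<gamma>\<^sup>2 * (w \<bullet> w)"

definition storage :: "real^'n^'n \<Rightarrow> real^'n^'n \<Rightarrow> real^'n^'n \<Rightarrow> real^'n \<Rightarrow> real^'n \<Rightarrow> real" where
  "storage X V Z x \<xi> = (X *v x + V *v \<xi>) \<bullet> x + (transpose V *v x + Z *v \<xi>) \<bullet> \<xi>"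

definition certificate where
  "certificate (P :: (_, _, _, _, _) plant) \<gamma> K X V Z \<longleftrightarrow> transpose X = X \<and> transpose Z = Z
     \<and> (\<forall>x \<xi>. x \<noteq> 0 \<or> \<xi> \<noteq> 0 \<longrightarrow> storage X V Z x \<xi> > 0)
     \<and> (\<forall>x \<xi> w. x \<noteq> 0 \<or> \<xi> \<noteq> 0 \<or> w \<noteq> 0 \<longrightarrow> dissipation P \<gamma> K X V Z x \<xi> w < 0)"

lemma all_join: "(\<forall>v. Q v) \<longleftrightarrow> (\<forall>x \<xi>. Q (join x \<xi>))"
  by (metis join_cases)

lemma brl_lmi_block_iff:
  "brl_lmi (Acl P K) (Bcl P K) (Ccl P K) (Dcl P K) \<gamma> (block X V (transpose V) Z) \<longleftrightarrow> certificate P \<gamma> K X V Z"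
  unfolding brl_lmi_def certificate_def all_join
  by (simp add: transpose_block block_eq_iff block_mult inner_join closed_loop_state closed_loop_output
      storage_def dissipation_def zero_prod_def de_Morgan_conj)

text \<open>Both directions of the bounded real lemma for the closed loop. Symmetry forces the lower
  left block of a solution to be \<open>transpose V\<close>, so three blocks describe it.\<close>

lemma Kgamma_iff_certificate:
  "K \<in> Kgamma P \<gamma> \<longleftrightarrow> \<gamma> > 0 \<and> (\<exists>X V Z. certificate P \<gamma> K X V Z)"
proof -
  let ?lmi = "brl_lmi (Acl P K) (Bcl P K) (Ccl P K) (Dcl P K) \<gamma>"
  have hinf: "hinf_norm P K = (SUP \<omega>. gain (Acl P K) (Bcl P K) (Ccl P K) (Dcl P K) \<omega>)"
    by (simp add: hinf_norm_def Tzw_def transfer_fn_def)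
  have "K \<in> Kgamma P \<gamma> \<longleftrightarrow> \<gamma> > 0 \<and> (\<exists>X. ?lmi X)"
    unfolding Kgamma_def Cstab_def mem_Collect_eq hinf
    using brl_necessity[of "Acl P K"] brl_sufficiency[of \<gamma> "Acl P K"] by blast
  also have "(\<exists>X. ?lmi X) \<longleftrightarrow> (\<exists>X V Z. certificate P \<gamma> K X V Z)"
  proof
    assume "\<exists>X. ?lmi X"
    then obtain M where M: "?lmi M" by blast
    obtain X V W Z where b: "M = block X V W Z" by (rule block_cases)
    have "transpose M = M" using M by (simp add: brl_lmi_def)
    then have "W = transpose V" by (auto simp: b transpose_block block_eq_iff)
    then show "\<exists>X V Z. certificate P \<gamma> K X V Z" using M b brl_lmi_block_iff by blast
  qed (use brl_lmi_block_iff in blast)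
  finally show ?thesis .
qed

section \<open>Changes of controller coordinates\<close>

definition similar :: "real^'nx^'nx \<Rightarrow> ('nx::finite, 'nu::finite, 'ny::finite) ctrl \<Rightarrow> ('nx, 'nu, 'ny) ctrl" where
  "similar T K = (case K of (D, C, B, A) \<Rightarrow> (D, C ** matrix_inv T, T ** B, T ** A ** matrix_inv T))"

lemma matrix_inv_vec:
  fixes T :: "real^'n^'n"
  assumes "invertible T"
  shows "matrix_inv T *v (T *v x) = x" "T *v (matrix_inv T *v x) = x"
  by (simp_all add: matrix_vector_mul_assoc matrix_inv_left[OF assms] matrix_inv_right[OF assms])

lemma matrix_inv_unique:
  fixes A B :: "real^'n^'n"
  assumes "A ** B = mat 1" shows "matrix_inv A = B"
proof -
  have "invertible A" using assms invertible_right_inverse by blast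
  then have "matrix_inv A ** (A ** B) = B"
    by (simp add: matrix_mul_assoc matrix_inv_left)
  then show ?thesis using assms by simp
qed

lemma invertible_matrix_inv:
  fixes T :: "real^'n^'n"
  assumes "invertible T" shows "invertible (matrix_inv T)" "matrix_inv (matrix_inv T) = T"
  using matrix_inv_left[OF assms] matrix_inv_unique invertible_right_inverse by blast+

lemma similar_mult:
  assumes "invertible S" "invertible T"
  shows "similar S (similar T K) = similar (S ** T) K"
proof -
  have "(S ** T) ** (matrix_inv T ** matrix_inv S) = S ** (T ** matrix_inv T) ** matrix_inv S"
    by (simp add: matrix_mul_assoc)
  then have "matrix_inv (S ** T) = matrix_inv T ** matrix_inv S"
    by (intro matrix_inv_unique) (simp add: matrix_inv_right assms)
  then show ?thesis by (simp add: similar_def matrix_mul_assoc split: prod.split)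
qed

lemma similar_one [simp]:
  fixes K :: "('nx::finite, 'nu::finite, 'ny::finite) ctrl"
  shows "similar (mat 1) K = K"
proof -
  have "matrix_inv (mat 1 :: real^'nx^'nx) = mat 1" by (rule matrix_inv_unique) simp
  then show ?thesis by (simp add: similar_def split: prod.split)
qed

text \<open>Storage and dissipation in the new coordinate \<xi> are their old values at T^{-1}
  \<xi>, and T^{-1} is injective.\<close>

lemma certificate_similar:
  assumes T: "invertible T" and c: "certificate P \<gamma> K X V Z"
  shows "certificate P \<gamma> (similar T K) X (V ** matrix_inv T) (transpose (matrix_inv T) ** Z ** matrix_inv T)"
proof -
  let ?Ti = "matrix_inv T"
  obtain D C B A where K: "K = (D, C, B, A)" by (cases K)
  have u: "ctl_input P (similar T K) x \<xi> w = ctl_input P K x (?Ti *v \<xi>) w" for x \<xi> w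
    by (simp add: K similar_def ctl_input_def matrix_vector_mul_assoc)
  then have xd: "plant_rhs P (similar T K) x \<xi> w = plant_rhs P K x (?Ti *v \<xi>) w"
    and z: "perf_output P (similar T K) x \<xi> w = perf_output P K x (?Ti *v \<xi>) w" for x \<xi> w
    by (simp_all add: plant_rhs_def perf_output_def)
  have xid: "?Ti *v ctl_rhs P (similar T K) x \<xi> w = ctl_rhs P K x (?Ti *v \<xi>) w" for x \<xi> w
    by (simp add: K similar_def ctl_rhs_def mat_vec_distribs matrix_inv_vec[OF T])
  have tr: "(transpose (V ** ?Ti) *v x + (transpose ?Ti ** Z ** ?Ti) *v \<xi>) \<bullet> y
      = (transpose V *v x + Z *v (?Ti *v \<xi>)) \<bullet> (?Ti *v y)" for x \<xi> y
    by (simp add: matrix_transpose_mul matrix_vector_mul_assoc[symmetric] inner_add_left dot_lmul_matrix)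
  have st: "storage X (V ** ?Ti) (transpose ?Ti ** Z ** ?Ti) x \<xi> = storage X V Z x (?Ti *v \<xi>)" for x \<xi>
    unfolding storage_def tr by (simp add: matrix_vector_mul_assoc)
  have di: "dissipation P \<gamma> (similar T K) X (V ** ?Ti) (transpose ?Ti ** Z ** ?Ti) x \<xi> w
      = dissipation P \<gamma> K X V Z x (?Ti *v \<xi>) w" for x \<xi> w
    unfolding dissipation_def tr xd z xid by (simp add: matrix_vector_mul_assoc)
  have nz: "?Ti *v \<xi> \<noteq> 0" if "\<xi> \<noteq> 0" for \<xi>
    using that matrix_inv_vec(2)[OF T, of \<xi>] by (metis matrix_vector_mult_0_right)
  have "transpose (transpose ?Ti ** Z ** ?Ti) = transpose ?Ti ** Z ** ?Ti"
    using c by (simp add: certificate_def matrix_transpose_mul matrix_mul_assoc)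
  then show ?thesis
    using c nz unfolding certificate_def st di by blast
qed

lemma Kgamma_similar:
  assumes "invertible T" "K \<in> Kgamma P \<gamma>" shows "similar T K \<in> Kgamma P \<gamma>"
  using assms certificate_similar unfolding Kgamma_iff_certificate by blast

section \<open>Perturbation and normalization of certificates\<close>

lemma bilinear_neg_perturb:
  fixes q r :: "'a::euclidean_space \<Rightarrow> 'a \<Rightarrow> real"
  assumes q: "bilinear q" and r: "bilinear r" and neg: "\<And>l. l \<noteq> 0 \<Longrightarrow> q l l < 0"
  obtains \<delta> where "\<delta> > 0" "\<And>t l. \<bar>t\<bar> < \<delta> \<Longrightarrow> l \<noteq> 0 \<Longrightarrow> q l l + t * r l l < 0"
proof -
  obtain \<epsilon> where e: "\<epsilon> > 0" "\<And>l. q l l \<le> - \<epsilon> * (l \<bullet> l)"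
    using bilinear_neg_uniform[OF q neg] by metis
  obtain c where c: "c > 0" "\<And>l l'. norm (r l l') \<le> c * norm l * norm l'"
    using bilinear_bounded_pos[OF r] by blast
  show ?thesis
  proof
    show "\<epsilon> / c > 0" using e c by simp
    fix t and l :: 'a assume t: "\<bar>t\<bar> < \<epsilon> / c" and l: "l \<noteq> 0"
    have ll: "l \<bullet> l > 0" using l by simp
    have "\<bar>t * r l l\<bar> \<le> \<bar>t\<bar> * (c * (l \<bullet> l))"
      unfolding abs_mult using c(2)[of l l]
      by (intro mult_left_mono) (simp_all add: dot_square_norm power2_eq_square mult_ac)
    also have "\<dots> < (\<epsilon> / c) * (c * (l \<bullet> l))"
      using t ll c by (intro mult_strict_right_mono) auto
    also have "\<dots> = \<epsilon> * (l \<bullet> l)" using c by simp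
    finally show "q l l + t * r l l < 0" using e(2)[of l] by linarith
  qed
qed

lemma linear_matrix_comp: "linear g \<Longrightarrow> linear (\<lambda>l. M *v g l)" for M :: "real^'n^'m"
  using linear_compose[of g "(*v) M"] by (simp add: o_def)

lemma linear_closed_loop:
  fixes P :: "('nx::finite, 'nw::finite, 'nu::finite, 'ny::finite, 'nz::finite) plant"
  shows "linear (\<lambda>(x, \<xi>, w). plant_rhs P K x \<xi> w)" "linear (\<lambda>(x, \<xi>, w). ctl_rhs P K x \<xi> w)"
    "linear (\<lambda>(x, \<xi>, w). perf_output P K x \<xi> w)"
proof -
  obtain D C B A where K: "K = (D, C, B, A)" by (cases K)
  have f: "linear (\<lambda>l::(real^'nx) \<times> (real^'nx) \<times> (real^'nw). fst (snd l))"
    "linear (\<lambda>l::(real^'nx) \<times> (real^'nx) \<times> (real^'nw). snd (snd l))"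
    by (auto intro!: linearI)
  show "linear (\<lambda>(x, \<xi>, w). plant_rhs P K x \<xi> w)" "linear (\<lambda>(x, \<xi>, w). ctl_rhs P K x \<xi> w)"
    "linear (\<lambda>(x, \<xi>, w). perf_output P K x \<xi> w)"
    unfolding closed_loop_defs K case_prod_unfold fst_conv snd_conv
    by (intro linear_compose_add linear_matrix_comp linear_fst f)+
qed


lemma bilinear_dissipation:
  fixes \<alpha> \<beta> f g :: "(real^'n) \<times> (real^'n) \<times> (real^'m) \<Rightarrow> real^'n"
    and h :: "(real^'n) \<times> (real^'n) \<times> (real^'m) \<Rightarrow> real^'p"
  assumes "linear \<alpha>" "linear \<beta>" "linear f" "linear g" "linear h"
  shows "bilinear (\<lambda>l l'. 2 * (\<alpha> l \<bullet> f l' + \<beta> l \<bullet> g l') + h l \<bullet> h l' - c * (snd (snd l) \<bullet> snd (snd l')))"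
  using assms by (intro bilinear_diff_fun bilinear_add_fun bilinear_scale_fun bilinear_inner_comp
    linear_compose[OF linear_snd linear_snd, unfolded o_def])

lemma certificateD:
  assumes "certificate P \<gamma> K X V Z"
  shows "transpose X = X" "transpose Z = Z" "x \<noteq> 0 \<or> \<xi> \<noteq> 0 \<Longrightarrow> storage X V Z x \<xi> > 0"
    "x \<noteq> 0 \<or> \<xi> \<noteq> 0 \<or> w \<noteq> 0 \<Longrightarrow> dissipation P \<gamma> K X V Z x \<xi> w < 0"
  using assms unfolding certificate_def by blast+

text \<open>det(V + t I) is a polynomial in t. It is not zero, since a shift exceeding the bound
  \<open>c\<close> of the form of \<open>V\<close> gives an invertible matrix; so its finitely many
  roots cannot fill an interval.\<close>

lemma invertible_add_scaled_one:
  fixes V :: "real^'n^'n"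
  assumes "\<delta> > 0"
  obtains t where "\<bar>t\<bar> < \<delta>" "invertible (V + t *\<^sub>R mat 1)"
proof -
  define M where "M = (\<chi> i j. [:V $ i $ j, if i = j then 1 else 0:] :: real poly^'n^'n)"
  have ev: "poly (det M) t = det (V + t *\<^sub>R mat 1)" for t
  proof -
    have "poly (M $ i $ j) t = (V + t *\<^sub>R mat 1) $ i $ j" for i j
      by (simp add: M_def mat_def)
    moreover have "poly (of_int k) t = of_int k" for k
      by (simp add: of_int_poly)
    ultimately show ?thesis
      by (simp add: det_def poly_sum poly_prod)
  qed
  obtain c where c: "c > 0" "\<And>x. \<bar>(V *v x) \<bullet> x\<bar> \<le> c * (x \<bullet> x)" by (rule matrix_form_bound) blast
  have "invertible (V + (c + 1) *\<^sub>R mat 1)"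
  proof (rule invertible_kerI)
    fix x assume "(V + (c + 1) *\<^sub>R mat 1) *v x = 0"
    then have "(V *v x + (c + 1) *\<^sub>R x) \<bullet> x = 0"
      by (simp add: mat_add_scale_vec)
    then have "(V *v x) \<bullet> x + c * (x \<bullet> x) + x \<bullet> x = 0"
      by (simp add: inner_add_left algebra_simps)
    then have "x \<bullet> x \<le> 0" using c(2)[of x] by linarith
    then show "x = 0" using inner_gt_zero_iff[of x] by linarith
  qed
  then have "det M \<noteq> 0"
    using ev[of "c + 1"] by (metis invertible_det_nz poly_0)
  then have fin: "finite {t. poly (det M) t = 0}" by (rule poly_roots_finite)
  have "infinite {0<..<\<delta>}" using assms by simp
  then obtain t where "t \<in> {0<..<\<delta>}" "poly (det M) t \<noteq> 0"
    by (metis (mono_tags, lifting) fin finite_subset mem_Collect_eq subsetI)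
  then show ?thesis by (intro that[of t]) (auto simp: ev invertible_det_nz)
qed

text \<open>Replacing \<open>V\<close> by V + t I changes storage and dissipation by t times fixed
  bilinear forms, and strict inequalities survive small t.\<close>

lemma certificate_perturb:
  fixes P :: "('nx::finite, 'nw::finite, 'nu::finite, 'ny::finite, 'nz::finite) plant"
  assumes c: "certificate P \<gamma> K X V Z"
  obtains W where "invertible W" "certificate P \<gamma> K X W Z"
proof -
  define f where "f = (\<lambda>(x, \<xi>, w). plant_rhs P K x \<xi> w)"
  define g where "g = (\<lambda>(x, \<xi>, w). ctl_rhs P K x \<xi> w)"
  define h where "h = (\<lambda>(x, \<xi>, w). perf_output P K x \<xi> w)"
  have lin: "linear f" "linear g" "linear h"
    unfolding f_def g_def h_def by (rule linear_closed_loop)+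
  note pr = linear_compose[OF linear_snd linear_fst, unfolded o_def]
  define q where "q l l' = 2 * ((X *v fst l + V *v fst (snd l)) \<bullet> f l' + (transpose V *v fst l + Z *v fst (snd l)) \<bullet> g l')
     + h l \<bullet> h l' - \<gamma>\<^sup>2 * (snd (snd l) \<bullet> snd (snd l'))" for l l'
  define r where "r l l' = 2 * (fst (snd l) \<bullet> f l' + fst l \<bullet> g l')"
    for l l' :: "(real^'nx) \<times> (real^'nx) \<times> (real^'nw)"
  have bq: "bilinear q" and br: "bilinear r"
    unfolding q_def r_def
    by (intro bilinear_dissipation bilinear_add_fun bilinear_scale_fun bilinear_inner_comp lin pr
      linear_compose_add linear_matrix_comp linear_fst)+
  have "q l l < 0" if "l \<noteq> 0" for l
  proof -
    obtain x \<xi> w where l: "l = (x, \<xi>, w)" by (cases l)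
    with that have "x \<noteq> 0 \<or> \<xi> \<noteq> 0 \<or> w \<noteq> 0" by (auto simp: zero_prod_def)
    then have "dissipation P \<gamma> K X V Z x \<xi> w < 0" using c unfolding certificate_def by blast
    then show ?thesis by (simp add: l q_def dissipation_def f_def g_def h_def)
  qed
  then obtain \<delta>1 where d1: "\<delta>1 > 0" "\<And>t l. \<bar>t\<bar> < \<delta>1 \<Longrightarrow> l \<noteq> 0 \<Longrightarrow> q l l + t * r l l < 0"
    by (rule bilinear_neg_perturb[OF bq br]) auto
  \<comment> \<open>The sign is reversed so that positivity of the storage fits the perturbation
    lemma for negative forms.\<close>
  define q' where "q' l l' = (- 1) * ((X *v fst l + V *v snd l) \<bullet> fst l' + (transpose V *v fst l + Z *v snd l) \<bullet> snd l')" for l l'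
  define r' where "r' l l' = (- 1) * (snd l \<bullet> fst l' + fst l \<bullet> snd l')" for l l' :: "(real^'nx) \<times> (real^'nx)"
  have bq': "bilinear q'" and br': "bilinear r'"
    unfolding q'_def r'_def
    by (intro bilinear_diff_fun bilinear_add_fun bilinear_scale_fun bilinear_inner_comp
      linear_compose_add linear_matrix_comp linear_fst linear_snd)+
  have "q' l l < 0" if "l \<noteq> 0" for l
  proof -
    have "fst l \<noteq> 0 \<or> snd l \<noteq> 0" using that by (auto simp: prod_eq_iff)
    then have "storage X V Z (fst l) (snd l) > 0" using c unfolding certificate_def by blast
    then show ?thesis by (simp add: q'_def storage_def)
  qed
  then obtain \<delta>2 where d2: "\<delta>2 > 0" "\<And>t l. \<bar>t\<bar> < \<delta>2 \<Longrightarrow> l \<noteq> 0 \<Longrightarrow> q' l l + t * r' l l < 0"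
    by (rule bilinear_neg_perturb[OF bq' br']) auto
  obtain t where t: "\<bar>t\<bar> < min \<delta>1 \<delta>2" "invertible (V + t *\<^sub>R mat 1)"
    by (rule invertible_add_scaled_one[of "min \<delta>1 \<delta>2"]) (use d1 d2 in auto)
  have tr: "transpose (V + t *\<^sub>R mat 1) = transpose V + t *\<^sub>R mat 1"
    by (simp add: transpose_def vec_eq_iff mat_def eq_commute)
  have "certificate P \<gamma> K X (V + t *\<^sub>R mat 1) Z"
    unfolding certificate_def
  proof (intro conjI allI impI)
    show "transpose X = X" "transpose Z = Z" using c by (auto simp: certificate_def)
    fix x \<xi> :: "real^'nx" assume "x \<noteq> 0 \<or> \<xi> \<noteq> 0"
    then have "q' (x, \<xi>) (x, \<xi>) + t * r' (x, \<xi>) (x, \<xi>) < 0"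
      using t by (intro d2) (auto simp: zero_prod_def)
    then show "storage X (V + t *\<^sub>R mat 1) Z x \<xi> > 0"
      unfolding storage_def q'_def r'_def tr
      by (simp add: mat_add_scale_vec algebra_simps
        inner_add_left)
  next
    fix x \<xi> :: "real^'nx" and w :: "real^'nw" assume "x \<noteq> 0 \<or> \<xi> \<noteq> 0 \<or> w \<noteq> 0"
    then have "q (x, \<xi>, w) (x, \<xi>, w) + t * r (x, \<xi>, w) (x, \<xi>, w) < 0"
      using t by (intro d1) (auto simp: zero_prod_def)
    then show "dissipation P \<gamma> K X (V + t *\<^sub>R mat 1) Z x \<xi> w < 0"
      unfolding dissipation_def q_def r_def tr f_def g_def h_def
      by (simp add: mat_add_scale_vec algebra_simps
        inner_add_left)
  qed
  then show ?thesis using that t(2) by blast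
qed

text \<open>With V = - Z the storage is x^T (X - Z) x + (x - \<xi>)^T Z (x - \<xi>): the controller
  state is compared with the plant state in the same coordinates.\<close>

definition slice where
  "slice (P :: (_, _, _, _, _) plant) \<gamma> = {K. \<exists>X Z. certificate P \<gamma> K X (- Z) Z}"

lemma pd_invertible:
  fixes Z :: "real^'n^'n"
  assumes "\<And>x. x \<noteq> 0 \<Longrightarrow> (Z *v x) \<bullet> x > 0" shows "invertible Z"
  by (rule invertible_kerI) (metis assms inner_zero_left less_irrefl)

lemma invertible_transpose_field:
  fixes A :: "'a::field^'n^'n"
  assumes "invertible A" shows "invertible (transpose A)" "matrix_inv (transpose A) = transpose (matrix_inv A)"
proof -
  have l: "transpose A ** transpose (matrix_inv A) = mat 1"
    using matrix_inv_left[OF assms] by (metis matrix_transpose_mul transpose_mat)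
  then show inv: "invertible (transpose A)" using invertible_right_inverse by blast
  have "matrix_inv (transpose A) ** (transpose A ** transpose (matrix_inv A)) = transpose (matrix_inv A)"
    by (simp add: matrix_mul_assoc matrix_inv_left[OF inv])
  then show "matrix_inv (transpose A) = transpose (matrix_inv A)" by (simp add: l)
qed

lemma uminus_matrix_mult: "(- A) ** B = - (A ** B)" "A ** (- B) = - (A ** B)" for A :: "real^'n^'m" and B :: "real^'k^'n"
  by (simp_all add: matrix_matrix_mult_def vec_eq_iff sum_negf)

lemma uminus_matrix_vec: "(- A) *v x = - (A *v x)" for A :: "real^'n^'m"
  by (simp add: matrix_vector_mult_def vec_eq_iff sum_negf)

lemma transpose_uminus: "transpose (- A) = - transpose A" for A :: "real^'n^'m"
  by (simp add: transpose_def vec_eq_iff)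

text \<open>The substitution of S \<xi> for \<xi> turns \<open>V\<close>, \<open>Z\<close> into V S
  and S^T Z S. The requirement V S = - S^T Z S has the invertible solution S = - Z^{-1} V^T; this is
  why \<open>V\<close> must first be made invertible.\<close>

lemma Kgamma_similar_slice:
  fixes K :: "('nx::finite, 'nu::finite, 'ny::finite) ctrl"
  assumes "K \<in> Kgamma P \<gamma>"
  obtains T K' where "invertible T" "K' \<in> slice P \<gamma>" "K = similar T K'"
proof -
  obtain X V0 Z where "certificate P \<gamma> K X V0 Z"
    using assms Kgamma_iff_certificate by blast
  then obtain V where V: "invertible V" and c: "certificate P \<gamma> K X V Z"
    by (rule certificate_perturb)
  have symZ: "transpose Z = Z" using c by (simp add: certificate_def)
  have "(Z *v \<xi>) \<bullet> \<xi> > 0" if "\<xi> \<noteq> 0" for \<xi>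
    using certificateD(3)[OF c, of 0 \<xi>] that by (simp add: storage_def)
  then have Z: "invertible Z" by (rule pd_invertible)
  define S where "S = - (matrix_inv Z ** transpose V)"
  have S: "invertible S"
  proof (rule invertible_kerI)
    fix x assume "S *v x = 0"
    then have "matrix_inv Z *v (transpose V *v x) = 0"
      by (simp add: S_def uminus_matrix_vec matrix_vector_mul_assoc[symmetric])
    then show "x = 0"
      by (metis V Z invertible_kerD invertible_matrix_inv(1) transpose_invertible)
  qed
  let ?R = "matrix_inv S"
  have Ri: "matrix_inv ?R = S" using invertible_matrix_inv(2)[OF S] .
  have "certificate P \<gamma> (similar ?R K) X (V ** S) (transpose S ** Z ** S)"
    using certificate_similar[OF invertible_matrix_inv(1)[OF S] c] unfolding Ri .
  moreover have "transpose S ** Z ** S = - (V ** S)"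
  proof -
    have "transpose S = - (V ** matrix_inv Z)"
      using invertible_transpose_field(2)[symmetric, OF Z] symZ by (simp add: S_def matrix_transpose_mul transpose_uminus)
    then have "transpose S ** Z = - V"
      by (simp add: uminus_matrix_mult matrix_mul_assoc[symmetric] matrix_inv_left[OF Z])
    then show ?thesis by (simp add: uminus_matrix_mult)
  qed
  ultimately have "certificate P \<gamma> (similar ?R K) X (- (transpose S ** Z ** S)) (transpose S ** Z ** S)"
    by simp
  then have "similar ?R K \<in> slice P \<gamma>" by (auto simp: slice_def)
  moreover have "K = similar S (similar ?R K)"
    by (simp add: similar_mult[OF S invertible_matrix_inv(1)[OF S]] matrix_inv_right[OF S])
  ultimately show ?thesis using that S by blast
qed

lemma slice_subset: "\<gamma> > 0 \<Longrightarrow> slice P \<gamma> \<subseteq> Kgamma P \<gamma>"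
  using Kgamma_iff_certificate unfolding slice_def by blast

subsection \<open>Convex parametrization of the controllers in the slice\<close>

lemma continuous_on_matrix_mult [continuous_intros]:
  fixes f :: "'t::topological_space \<Rightarrow> real^'n^'m" and g :: "'t \<Rightarrow> real^'k^'n"
  assumes "continuous_on S f" "continuous_on S g"
  shows "continuous_on S (\<lambda>x. f x ** g x)"
  unfolding matrix_matrix_mult_def
  by (intro continuous_on_vec_lambda continuous_on_sum continuous_on_mult continuous_on_component assms)

lemma continuous_on_det:
  fixes f :: "'t::topological_space \<Rightarrow> real^'n^'n"
  assumes "continuous_on S f"
  shows "continuous_on S (\<lambda>x. det (f x))"
  unfolding det_def
  by (intro continuous_on_sum continuous_on_mult continuous_on_prod continuous_on_const continuous_on_component assms)

text \<open>Cramer's rule displays the entries of the inverse as quotients of determinants, from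
  which continuity of inversion can be read off.\<close>

lemma matrix_inv_cramer:
  fixes A :: "real^'n^'n"
  assumes "invertible A"
  shows "matrix_inv A = (\<chi> k l. det (\<chi> i j. if j = k then axis l 1 $ i else A $ i $ j) / det A)"
proof -
  have "matrix_inv A $ k $ l = det (\<chi> i j. if j = k then axis l 1 $ i else A $ i $ j) / det A" for k l
  proof -
    have d: "det A \<noteq> 0" using assms invertible_det_nz by blast
    have "A *v (matrix_inv A *v axis l 1) = axis l 1" by (rule matrix_inv_vec(2)[OF assms])
    then have "matrix_inv A *v axis l 1 = (\<chi> k. det (\<chi> i j. if j = k then axis l 1 $ i else A $ i $ j) / det A)"
      using cramer[OF d] by blast
    moreover have "(matrix_inv A *v axis l 1) $ k = matrix_inv A $ k $ l"
      by (simp add: matrix_vector_mul_component inner_axis)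
    ultimately show ?thesis by simp
  qed
  then show ?thesis by (simp add: vec_eq_iff)
qed

lemma continuous_on_matrix_inv:
  fixes f :: "'t::topological_space \<Rightarrow> real^'n^'n"
  assumes f: "continuous_on S f" and inv: "\<And>x. x \<in> S \<Longrightarrow> invertible (f x)"
  shows "continuous_on S (\<lambda>x. matrix_inv (f x))"
proof -
  have "continuous_on S (\<lambda>x. \<chi> k l. det (\<chi> i j. if j = k then axis l 1 $ i else f x $ i $ j) / det (f x))"
  proof (intro continuous_on_vec_lambda continuous_on_divide continuous_on_det f)
    show "continuous_on S (\<lambda>x. if j = k then axis l 1 $ i else f x $ i $ j)" for i j k l :: 'n
      by (cases "j = k") (auto intro!: continuous_on_component f)
  qed (use inv invertible_det_nz in blast)
  then show ?thesis
    by (rule continuous_on_eq) (rule matrix_inv_cramer[OF inv, symmetric])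
qed

text \<open>Tuples (X, Y, M, H, F, G). \<open>X\<close> and \<open>Y\<close> carry the certificate,
  with \<open>Y\<close> the inverse of X - Z; \<open>G\<close> is the feedthrough of the controller,
  and \<open>F\<close>, \<open>H\<close>, \<open>M\<close> stand in for its output, input and state
  matrices.\<close>

type_synonym ('nx, 'nu, 'ny) lmi_data =
  "(real^'nx^'nx) \<times> (real^'nx^'nx) \<times> (real^'nx^'nx) \<times> (real^'ny^'nx) \<times> (real^'nx^'nu) \<times> (real^'ny^'nu)"

definition lmi_input where
  "lmi_input (P :: ('nx::finite, _, _, _, _) plant) (s :: ('nx, _, _) lmi_data) a b w = (case s of (X, Y, M, H, F, G) \<Rightarrow> F *v a + G *v (pC2 P *v b + pD21 P *v w))"

definition lmi_output where
  "lmi_output (P :: (_, _, _, _, _) plant) (s :: (_, _, _) lmi_data) a b w = (case s of (X, Y, M, H, F, G) \<Rightarrow>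
     pC1 P *v (Y *v a + b) + pD11 P *v w + pD12 P *v lmi_input P s a b w)"

text \<open>Half the derivative of the storage in the variables \<open>a\<close>, \<open>b\<close>,
  written so that every term is affine in the data: the products of unknowns have been absorbed into
  \<open>M\<close> and \<open>H\<close>.\<close>

definition lmi_rate where
  "lmi_rate (P :: (_, _, _, _, _) plant) (s :: (_, _, _) lmi_data) a b w = (case s of (X, Y, M, H, F, G) \<Rightarrow>
     a \<bullet> (pA P *v (Y *v a + b) + pB1 P *v w + pB2 P *v lmi_input P s a b w)
     + b \<bullet> (X *v (pA P *v b) + X *v (pB1 P *v w) + H *v (pC2 P *v b + pD21 P *v w) + M *v a))"

definition lmi_form where
  "lmi_form (P :: (_, _, _, _, _) plant) \<gamma> s a b w = 2 * lmi_rate P s a b w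
     + lmi_output P s a b w \<bullet> lmi_output P s a b w - \<gamma>\<^sup>2 * (w \<bullet> w)"

text \<open>The quadratic form of the block matrix with diagonal blocks \<open>Y\<close>,
  \<open>X\<close> and identities off the diagonal.\<close>

definition coupling :: "real^'n^'n \<Rightarrow> real^'n^'n \<Rightarrow> real^'n \<Rightarrow> real^'n \<Rightarrow> real" where
  "coupling X Y a b = a \<bullet> (Y *v a) + 2 * (a \<bullet> b) + b \<bullet> (X *v b)"

definition lmi_set where
  "lmi_set (P :: (_, _, _, _, _) plant) \<gamma> = {s :: (_, _, _) lmi_data. transpose (fst s) = fst s \<and> transpose (fst (snd s)) = fst (snd s)
     \<and> (\<forall>a b. a \<noteq> 0 \<or> b \<noteq> 0 \<longrightarrow> coupling (fst s) (fst (snd s)) a b > 0)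
     \<and> (\<forall>a b w. a \<noteq> 0 \<or> b \<noteq> 0 \<or> w \<noteq> 0 \<longrightarrow> lmi_form P \<gamma> s a b w < 0)}"

lemma scaled_sum_inner_le:
  fixes x y :: "'a::real_inner"
  assumes "u \<ge> 0" "v \<ge> 0" "u + v = 1"
  shows "(u *\<^sub>R x + v *\<^sub>R y) \<bullet> (u *\<^sub>R x + v *\<^sub>R y) \<le> u * (x \<bullet> x) + v * (y \<bullet> y)"
proof -
  have v: "v = 1 - u" using assms by simp
  have "u * (x \<bullet> x) + v * (y \<bullet> y) - (u *\<^sub>R x + v *\<^sub>R y) \<bullet> (u *\<^sub>R x + v *\<^sub>R y) = u * v * ((x - y) \<bullet> (x - y))"
    by (simp add: v inner_add_left inner_add_right inner_diff_left inner_diff_right inner_commute[of y x] algebra_simps)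
  moreover have "\<dots> \<ge> 0" using assms by simp
  ultimately show ?thesis by linarith
qed

lemma convex_comb_neg:
  fixes u v x y :: real
  assumes "u \<ge> 0" "v \<ge> 0" "u + v = 1" "x < 0" "y < 0"
  shows "u * x + v * y < 0"
  using assms by (metis add.commute add_0 add_less_cancel_left convex_bound_lt mult_zero_right)

text \<open>Input, output and rate are affine in the data. Only the output enters squared, and
  convexity of the squared norm gives the inequality in the direction that is wanted.\<close>

lemma convex_lmi_set:
  fixes P :: "('nx::finite, 'nw::finite, 'nu::finite, 'ny::finite, 'nz::finite) plant"
  shows "convex (lmi_set P \<gamma>)"
  unfolding convex_def
proof (intro ballI allI impI)
  fix s t :: "('nx, 'nu, 'ny) lmi_data" and u v :: real
  assume s: "s \<in> lmi_set P \<gamma>" and t: "t \<in> lmi_set P \<gamma>" and uv: "0 \<le> u" "0 \<le> v" "u + v = 1"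
  obtain X Y M H F G where st: "s = (X, Y, M, H, F, G)" by (cases s)
  obtain X' Y' M' H' F' G' where tt: "t = (X', Y', M', H', F', G')" by (cases t)
  let ?r = "u *\<^sub>R s + v *\<^sub>R t"
  note ms = mat_add_scale_vec mat_vec_linear
  \<comment> \<open>Terms free of the data are split with the weights \<open>u\<close> and
    \<open>v\<close>, so that affine expressions combine like linear ones.\<close>
  have aff: "b = u *\<^sub>R b + v *\<^sub>R b" for b :: "real^'k"
    using uv(3) by (metis scaleR_add_left scaleR_one)
  have inp: "lmi_input P ?r a b w = u *\<^sub>R lmi_input P s a b w + v *\<^sub>R lmi_input P t a b w" for a b w
    by (simp add: st tt lmi_input_def ms scaleR_add_right)
  have out: "lmi_output P ?r a b w = u *\<^sub>R lmi_output P s a b w + v *\<^sub>R lmi_output P t a b w" for a b w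
  proof -
    have "lmi_output P ?r a b w = pC1 P *v ((u *\<^sub>R Y + v *\<^sub>R Y') *v a + (u *\<^sub>R b + v *\<^sub>R b))
       + (u *\<^sub>R (pD11 P *v w) + v *\<^sub>R (pD11 P *v w)) + pD12 P *v lmi_input P ?r a b w"
      by (simp add: lmi_output_def st tt flip: aff)
    also have "\<dots> = u *\<^sub>R lmi_output P s a b w + v *\<^sub>R lmi_output P t a b w"
      unfolding inp by (simp add: st tt lmi_output_def ms scaleR_add_right)
    finally show ?thesis .
  qed
  have rate: "lmi_rate P ?r a b w = u * lmi_rate P s a b w + v * lmi_rate P t a b w" for a b w
  proof -
    have "lmi_rate P ?r a b w = a \<bullet> (pA P *v ((u *\<^sub>R Y + v *\<^sub>R Y') *v a + (u *\<^sub>R b + v *\<^sub>R b))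
       + (u *\<^sub>R (pB1 P *v w) + v *\<^sub>R (pB1 P *v w)) + pB2 P *v lmi_input P ?r a b w)
     + b \<bullet> ((u *\<^sub>R X + v *\<^sub>R X') *v (pA P *v b) + (u *\<^sub>R X + v *\<^sub>R X') *v (pB1 P *v w)
      + (u *\<^sub>R H + v *\<^sub>R H') *v (pC2 P *v b + pD21 P *v w) + (u *\<^sub>R M + v *\<^sub>R M') *v a)"
      by (simp add: lmi_rate_def st tt flip: aff)
    also have "\<dots> = u * lmi_rate P s a b w + v * lmi_rate P t a b w"
      unfolding inp by (simp add: st tt lmi_rate_def ms inner_add_right distrib_left)
    finally show ?thesis .
  qed
  show "?r \<in> lmi_set P \<gamma>"
    unfolding lmi_set_def mem_Collect_eq
  proof (intro conjI allI impI)
    show "transpose (fst ?r) = fst ?r" "transpose (fst (snd ?r)) = fst (snd ?r)"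
      using s t by (simp_all add: lmi_set_def transpose_def vec_eq_iff)
    fix a b :: "real^'nx" assume ab: "a \<noteq> 0 \<or> b \<noteq> 0"
    have "coupling (fst ?r) (fst (snd ?r)) a b = u * coupling X Y a b + v * coupling X' Y' a b"
    proof -
      have "2 * (a \<bullet> b) = u * (2 * (a \<bullet> b)) + v * (2 * (a \<bullet> b))"
        using uv(3) by (metis distrib_right mult_1)
      then show ?thesis
        by (simp add: st tt coupling_def ms inner_add_right distrib_left)
    qed
    moreover have "coupling X Y a b > 0" "coupling X' Y' a b > 0"
      using s t ab by (auto simp: lmi_set_def st tt)
    ultimately show "coupling (fst ?r) (fst (snd ?r)) a b > 0"
      using convex_comb_neg[OF uv, of "- coupling X Y a b" "- coupling X' Y' a b"] by simp
  next
    fix a b :: "real^'nx" and w :: "real^'nw" assume abw: "a \<noteq> 0 \<or> b \<noteq> 0 \<or> w \<noteq> 0"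
    have "u * lmi_form P \<gamma> s a b w + v * lmi_form P \<gamma> t a b w < 0"
      using s t abw by (intro convex_comb_neg uv) (auto simp: lmi_set_def)
    moreover have "lmi_form P \<gamma> ?r a b w \<le> u * lmi_form P \<gamma> s a b w + v * lmi_form P \<gamma> t a b w"
    proof -
      have "\<gamma>\<^sup>2 * (w \<bullet> w) = u * (\<gamma>\<^sup>2 * (w \<bullet> w)) + v * (\<gamma>\<^sup>2 * (w \<bullet> w))"
        using uv(3) by (metis distrib_right mult_1)
      then show ?thesis
        using scaled_sum_inner_le[OF uv, of "lmi_output P s a b w" "lmi_output P t a b w"]
        unfolding lmi_form_def rate out by (simp add: algebra_simps)
    qed
    ultimately show "lmi_form P \<gamma> ?r a b w < 0" by linarith
  qed
qed

text \<open>Solves the substitutions F = (D C2 + C) Y, H = X B2 D - Z B and the corresponding one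
  for \<open>M\<close> for the controller matrices, with Z = X - Y^{-1} and D = G.\<close>

definition lmi_ctrl where
  "lmi_ctrl (P :: (_, _, _, _, _) plant) (s :: (_, _, _) lmi_data) = (case s of (X, Y, M, H, F, G) \<Rightarrow>
     let Yi = matrix_inv Y; Zi = matrix_inv (X - Yi); B = Zi ** (X ** pB2 P ** G - H)
     in (G, F ** Yi - G ** pC2 P, B,
         Zi ** (X ** pA P ** Y + X ** pB2 P ** F - M) ** Yi - B ** pC2 P))"

text \<open>The congruence \<open>\<xi> = Y a\<close>, \<open>x = Y a + b\<close> turns the dissipation inequality of the recovered
  controller into the affine-quadratic form \<open>lmi_form\<close>.\<close>

lemma lmi_ctrl_dissipation:
  fixes X Y :: "real^'nx::finite^'nx"
  assumes symX: "transpose X = X" and symY: "transpose Y = Y" and Y: "invertible Y" and Z: "invertible (X - matrix_inv Y)"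
    and s: "s = (X, Y, M, H, F, G)" and xi: "\<xi> = Y *v a" and x: "x = Y *v a + b"
  shows "dissipation P \<gamma> (lmi_ctrl P s) X (- (X - matrix_inv Y)) (X - matrix_inv Y) x \<xi> w = lmi_form P \<gamma> s a b w"
    and "storage X (- (X - matrix_inv Y)) (X - matrix_inv Y) x \<xi> = coupling X Y a b"
proof -
  let ?Yi = "matrix_inv Y" and ?Z = "X - matrix_inv Y"
  let ?Zi = "matrix_inv ?Z"
  have Yia: "?Yi *v (Y *v v) = v" for v by (rule matrix_inv_vec(1)[OF Y])
  have symZ: "transpose ?Z = ?Z"
    using invertible_transpose_field(2)[symmetric, OF Y] symX symY by (simp add: transpose_def vec_eq_iff)
  have u: "ctl_input P (lmi_ctrl P s) x \<xi> w = lmi_input P s a b w"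
    by (simp add: ctl_input_def lmi_ctrl_def Let_def s lmi_input_def xi x mat_vec_distribs Yia)
  have z: "perf_output P (lmi_ctrl P s) x \<xi> w = lmi_output P s a b w"
    unfolding perf_output_def u by (simp add: lmi_output_def s x)
  have xd: "plant_rhs P (lmi_ctrl P s) x \<xi> w = pA P *v (Y *v a + b) + pB1 P *v w + pB2 P *v lmi_input P s a b w"
    unfolding plant_rhs_def u by (simp add: x)
  define B where "B = ?Zi ** (X ** pB2 P ** G - H)"
  have ZB: "?Z *v (B *v v) = X *v (pB2 P *v (G *v v)) - H *v v" for v
    unfolding B_def matrix_vector_mul_assoc matrix_mul_assoc matrix_inv_right[OF Z]
    by (simp add: mat_vec_distribs)
  have ctl: "ctl_rhs P (lmi_ctrl P s) x \<xi> w = B *v (pC2 P *v b + pD21 P *v w)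
      + ?Zi *v (X *v (pA P *v (Y *v a)) + X *v (pB2 P *v (F *v a)) - M *v a)"
    by (simp add: ctl_rhs_def lmi_ctrl_def Let_def s xi x Yia mat_vec_distribs flip: B_def)
  have Zctl: "?Z *v ctl_rhs P (lmi_ctrl P s) x \<xi> w = X *v (pB2 P *v (lmi_input P s a b w)) + X *v (pA P *v (Y *v a))
      - H *v (pC2 P *v b + pD21 P *v w) - M *v a"
    unfolding ctl matrix_vector_right_distrib[of ?Z] ZB matrix_inv_vec(2)[OF Z]
    by (simp add: lmi_input_def s matrix_vector_right_distrib)
  \<comment> \<open>The half gradient of the storage is a + X b in the plant state and - Z b in the
    controller state. So \<open>Z\<close> meets the factor Z^{-1} of the controller, and what is
    left is affine in the data.\<close>
  have p1: "X *v x + (- ?Z) *v \<xi> = a + X *v b"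
    by (simp add: x xi uminus_matrix_vec mat_vec_distribs Yia)
  have p2: "transpose (- ?Z) *v x + ?Z *v \<xi> = - (?Z *v b)"
    unfolding transpose_uminus symZ uminus_matrix_vec by (simp add: x xi matrix_vector_right_distrib)
  have p3: "(?Z *v b) \<bullet> v = b \<bullet> (?Z *v v)" for v by (rule symmetric_inner[OF symZ])
  have p4: "(X *v b) \<bullet> v = b \<bullet> (X *v v)" for v by (rule symmetric_inner[OF symX])
  show "dissipation P \<gamma> (lmi_ctrl P s) X (- ?Z) ?Z x \<xi> w = lmi_form P \<gamma> s a b w"
    unfolding dissipation_def p1 p2 z xd inner_minus_left p3 Zctl
    unfolding lmi_form_def lmi_rate_def s prod.case
    by (simp add: inner_add_left p4 inner_add_right inner_diff_right matrix_vector_right_distrib)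
  have "?Z *v \<xi> = X *v (Y *v a) - a" by (simp add: xi mat_vec_distribs Yia)
  then show "storage X (- ?Z) ?Z x \<xi> = coupling X Y a b"
    unfolding storage_def p1 p2 inner_minus_left p3 coupling_def
    by (simp add: x inner_add_left inner_add_right inner_diff_right p4 inner_commute[of b a])
qed

lemma matrix_vector_mult_minus_right: "A *v (- x) = - (A *v x)" for A :: "real^'n^'m"
  by (simp add: matrix_vector_mult_def vec_eq_iff sum_negf)

text \<open>Setting b = 0 in \<open>coupling\<close> shows Y > 0; setting a = - Y^{-1} b gives the
  Schur complement X - Y^{-1} > 0.\<close>

lemma lmi_set_invertible:
  assumes "(X, Y, M, H, F, G) \<in> lmi_set P \<gamma>"
  shows "transpose X = X" "transpose Y = Y" "invertible Y" "invertible (X - matrix_inv Y)"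
proof -
  have c: "coupling X Y a b > 0" if "a \<noteq> 0 \<or> b \<noteq> 0" for a b
    using assms that by (auto simp: lmi_set_def)
  show sym: "transpose X = X" "transpose Y = Y" using assms by (auto simp: lmi_set_def)
  show Y: "invertible Y"
    by (rule pd_invertible) (use c[of _ 0] in \<open>auto simp: coupling_def inner_commute\<close>)
  show "invertible (X - matrix_inv Y)"
  proof (rule pd_invertible)
    fix b :: "real^'a" assume "b \<noteq> 0"
    then have "coupling X Y (- (matrix_inv Y *v b)) b > 0" by (intro c) simp
    then show "((X - matrix_inv Y) *v b) \<bullet> b > 0"
      by (simp add: coupling_def matrix_inv_vec[OF Y] matrix_vector_mult_diff_rdistrib inner_diff_left
          inner_diff_right matrix_vector_mult_minus_right inner_commute)
  qed
qed

text \<open>The variables (a, b) and (x, \<xi>) determine each other because \<open>Y\<close> is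
  invertible, so positivity and dissipation carry over both ways. For a slice controller, Y = (X -
  Z)^{-1} and the remaining data are chosen so that \<open>lmi_ctrl\<close> recovers it.\<close>

lemma slice_eq_image:
  fixes P :: "('nx::finite, 'nw::finite, 'nu::finite, 'ny::finite, 'nz::finite) plant"
  shows "slice P \<gamma> = lmi_ctrl P ` lmi_set P \<gamma>"
proof (intro equalityI subsetI)
  fix K assume "K \<in> lmi_ctrl P ` lmi_set P \<gamma>"
  then obtain s where s: "s \<in> lmi_set P \<gamma>" "K = lmi_ctrl P s" by blast
  obtain X Y M H F G where st: "s = (X, Y, M, H, F, G)" by (cases s)
  note inv = lmi_set_invertible[OF s(1)[unfolded st]]
  let ?Z = "X - matrix_inv Y"
  have symZ: "transpose ?Z = ?Z"
    using invertible_transpose_field(2)[symmetric, OF inv(3)] inv(1,2) by (simp add: transpose_def vec_eq_iff)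
  have ab: "\<xi> = Y *v (matrix_inv Y *v \<xi>)" "x = Y *v (matrix_inv Y *v \<xi>) + (x - \<xi>)"
    for x \<xi> :: "real^'nx"
    by (simp_all add: matrix_inv_vec[OF inv(3)])
  have nz: "matrix_inv Y *v \<xi> \<noteq> 0 \<or> x - \<xi> \<noteq> 0" if "x \<noteq> 0 \<or> \<xi> \<noteq> 0" for x \<xi> :: "real^'nx"
    using that ab(1)[of \<xi>] by force
  have "certificate P \<gamma> K X (- ?Z) ?Z"
    unfolding certificate_def s(2)
  proof (intro conjI allI impI inv(1) symZ)
    fix x \<xi> :: "real^'nx" assume "x \<noteq> 0 \<or> \<xi> \<noteq> 0"
    then show "storage X (- ?Z) ?Z x \<xi> > 0"
      unfolding lmi_ctrl_dissipation(2)[OF inv st ab] using s(1) nz by (auto simp: lmi_set_def st)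
  next
    fix x \<xi> :: "real^'nx" and w :: "real^'nw" assume "x \<noteq> 0 \<or> \<xi> \<noteq> 0 \<or> w \<noteq> 0"
    then have "matrix_inv Y *v \<xi> \<noteq> 0 \<or> x - \<xi> \<noteq> 0 \<or> w \<noteq> 0" using nz by blast
    then show "dissipation P \<gamma> (lmi_ctrl P s) X (- ?Z) ?Z x \<xi> w < 0"
      unfolding lmi_ctrl_dissipation(1)[OF inv st ab] using s(1) unfolding lmi_set_def by blast
  qed
  then show "K \<in> slice P \<gamma>" unfolding slice_def by blast
next
  fix K assume "K \<in> slice P \<gamma>"
  then obtain X Z where c: "certificate P \<gamma> K X (- Z) Z" by (auto simp: slice_def)
  obtain D C B A where K: "K = (D, C, B, A)" by (cases K)
  define Yi where "Yi = X - Z"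
  define Y where "Y = matrix_inv Yi"
  have symX: "transpose X = X" and symZ: "transpose Z = Z" using certificateD[OF c] by auto
  have symYi: "transpose Yi = Yi" using symX symZ by (simp add: Yi_def transpose_def vec_eq_iff)
  \<comment> \<open>On the diagonal \<xi> = x the storage reduces to x^T (X - Z) x.\<close>
  have Yi: "invertible Yi"
  proof (rule pd_invertible)
    fix x :: "real^'nx" assume "x \<noteq> 0"
    then have "storage X (- Z) Z x x > 0" by (intro certificateD(3)[OF c]) simp
    then show "(Yi *v x) \<bullet> x > 0"
      by (simp add: storage_def Yi_def transpose_uminus symZ uminus_matrix_vec matrix_vector_mult_diff_rdistrib
         del: transpose_matrix_vector)
  qed
  have invY: "invertible Y" and YY: "matrix_inv Y = Yi"
    using invertible_matrix_inv[OF Yi] by (auto simp: Y_def)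
  have Zeq: "X - matrix_inv Y = Z" by (simp add: YY Yi_def)
  have symY: "transpose Y = Y" using invertible_transpose_field(2)[symmetric, OF Yi] symYi by (simp add: Y_def)
  have invZ: "invertible Z"
  proof (rule pd_invertible)
    fix x :: "real^'nx" assume "x \<noteq> 0"
    then have "storage X (- Z) Z 0 x > 0" by (intro certificateD(3)[OF c]) simp
    then show "(Z *v x) \<bullet> x > 0"
      by (simp add: storage_def)
  qed
  have YYi: "Y ** Yi = mat 1" using matrix_inv_left[OF Yi] by (simp add: Y_def)
  define M where "M = X ** pA P ** Y + X ** pB2 P ** ((D ** pC2 P + C) ** Y) - Z ** (A + B ** pC2 P) ** Y"
  define H where "H = X ** pB2 P ** D - Z ** B"
  define s where "s = (X, Y, M, H, (D ** pC2 P + C) ** Y, D)"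
  have ZiZ: "matrix_inv Z ** (Z ** W) = W" for W :: "real^'k^'nx"
    by (simp add: matrix_mul_assoc matrix_inv_left[OF invZ])
  have Ks: "lmi_ctrl P s = K"
  proof -
    have 1: "X ** pB2 P ** D - H = Z ** B" by (simp add: H_def)
    have 2: "X ** pA P ** Y + X ** pB2 P ** ((D ** pC2 P + C) ** Y) - M = Z ** ((A + B ** pC2 P) ** Y)"
      by (simp add: M_def matrix_mul_assoc)
    have 3: "W ** Y ** Yi = W" for W :: "real^'nx^'k"
      by (simp add: matrix_mul_assoc[symmetric] YYi)
    show ?thesis
      unfolding lmi_ctrl_def s_def prod.case Let_def Zeq 1 2 ZiZ K unfolding YY 3 by simp
  qed
  have invZ': "invertible (X - matrix_inv Y)" using invZ Zeq by simp
  have "s \<in> lmi_set P \<gamma>"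
    unfolding lmi_set_def mem_Collect_eq
  proof (intro conjI allI impI)
    show "transpose (fst s) = fst s" "transpose (fst (snd s)) = fst (snd s)"
      by (simp_all add: s_def symX symY)
    have nz: "Y *v a + b \<noteq> 0 \<or> Y *v a \<noteq> 0" if "a \<noteq> 0 \<or> b \<noteq> 0" for a b
      using that invertible_kerD[OF invY] by force
    note eq = lmi_ctrl_dissipation[OF symX symY invY invZ' s_def refl refl, unfolded Zeq, symmetric]
    show "coupling (fst s) (fst (snd s)) a b > 0" if "a \<noteq> 0 \<or> b \<noteq> 0" for a b
    proof -
      have "coupling (fst s) (fst (snd s)) a b = storage X (- Z) Z (Y *v a + b) (Y *v a)"
        unfolding s_def fst_conv snd_conv by (rule eq(2))
      then show ?thesis using certificateD(3)[OF c nz[OF that]] by simp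
    qed
    show "lmi_form P \<gamma> s a b w < 0" if "a \<noteq> 0 \<or> b \<noteq> 0 \<or> w \<noteq> 0" for a b w
      unfolding eq(1) Ks using that nz by (intro certificateD(4)[OF c]) blast
  qed
  then show "K \<in> lmi_ctrl P ` lmi_set P \<gamma>" using Ks by blast
qed

lemma path_connected_slice:
  fixes P :: "('nx::finite, 'nw::finite, 'nu::finite, 'ny::finite, 'nz::finite) plant"
  shows "path_connected (slice P \<gamma>)"
proof -
  have cont: "continuous_on (lmi_set P \<gamma>) (lmi_ctrl P)"
  proof -
    let ?S = "lmi_set P \<gamma>"
    let ?Yi = "\<lambda>s::('nx, 'nu, 'ny) lmi_data. matrix_inv (fst (snd s))"
    have inv: "invertible (fst (snd s))" "invertible (fst s - ?Yi s)" if "s \<in> ?S" for s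
      using lmi_set_invertible[of "fst s" "fst (snd s)" "fst (snd (snd s))" "fst (snd (snd (snd s)))"
          "fst (snd (snd (snd (snd s))))" "snd (snd (snd (snd (snd s))))"] that by auto
    have cY: "continuous_on ?S ?Yi"
      by (intro continuous_on_matrix_inv continuous_intros inv)
    have cZ: "continuous_on ?S (\<lambda>s. matrix_inv (fst s - ?Yi s))"
      by (intro continuous_on_matrix_inv continuous_intros inv cY)
    show ?thesis
      unfolding lmi_ctrl_def Let_def case_prod_unfold
      by (intro continuous_intros cY cZ)
  qed
  show ?thesis
    unfolding slice_eq_image
    by (intro path_connected_continuous_image cont convex_imp_path_connected convex_lmi_set)
qed

subsection \<open>Path components of the general linear group\<close>

lemma path_component_image:
  assumes "path_component S x y" "continuous_on S f" "f ` S \<subseteq> T"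
  shows "path_component T (f x) (f y)"
proof -
  obtain g where g: "path g" "path_image g \<subseteq> S" "pathstart g = x" "pathfinish g = y"
    using assms(1) unfolding path_component_def by blast
  then show ?thesis
    unfolding path_component_def
    by (intro exI[of _ "f \<circ> g"])
      (use assms in \<open>auto intro!: path_continuous_image continuous_on_subset[OF assms(2)] simp: path_image_compose pathstart_compose pathfinish_compose\<close>)
qed

lemma path_componentI_interval:
  assumes "continuous_on {0..1} g" "\<And>t. 0 \<le> t \<Longrightarrow> t \<le> 1 \<Longrightarrow> g t \<in> S"
  shows "path_component S (g 0) (g (1::real))"
  unfolding path_component_def
  by (intro exI[of _ g]) (use assms in \<open>auto simp: path_def path_image_def pathstart_def pathfinish_def\<close>)

abbreviation gl_path :: "real^'n^'n \<Rightarrow> real^'n^'n \<Rightarrow> bool" where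
  "gl_path \<equiv> path_component {T. invertible T}"

lemma continuous_on_outer [continuous_intros]:
  assumes "continuous_on S f" "continuous_on S g"
  shows "continuous_on S (\<lambda>t. outer (f t) (g t))"
  unfolding outer_def
  by (intro continuous_on_vec_lambda continuous_on_mult continuous_on_component assms)

definition householder :: "real^'n \<Rightarrow> real^'n^'n" where
  "householder v = mat 1 - (2 / (v \<bullet> v)) *\<^sub>R outer v v"

lemma householder_vec: "householder v *v x = x - (2 * (v \<bullet> x) / (v \<bullet> v)) *\<^sub>R v"
  by (simp add: householder_def matrix_vector_mult_diff_rdistrib scaleR_matrix_vector_assoc[symmetric] outer_mult_vec)

lemma householder_involutive: "v \<noteq> 0 \<Longrightarrow> householder v ** householder v = mat 1"
  by (simp add: matrix_eq matrix_vector_mul_assoc[symmetric] householder_vec inner_diff_right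
      algebra_simps flip: scaleR_add_left)

lemma invertible_householder: "v \<noteq> 0 \<Longrightarrow> invertible (householder v)"
  using householder_involutive invertible_right_inverse by blast

lemma matrix_inv_householder: "v \<noteq> 0 \<Longrightarrow> matrix_inv (householder v) = householder v"
  by (simp add: householder_involutive matrix_inv_unique)

lemma householder_minus: "householder (- v) = householder v"
  by (simp add: matrix_eq householder_vec)

text \<open>The segment from \<open>u\<close> to \<open>v\<close> avoids 0 when their inner product
  is nonnegative; otherwise \<open>v\<close> is replaced by - v, which defines the same
  reflection.\<close>

lemma gl_path_householder:
  assumes "u \<noteq> 0" "v \<noteq> 0"
  shows "gl_path (householder u) (householder v)"
proof -
  have *: "gl_path (householder u) (householder v)" if v: "v \<noteq> 0" and uv: "u \<bullet> v \<ge> 0" for v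
  proof -
    define g where "g t = (1 - t) *\<^sub>R u + t *\<^sub>R v" for t :: real
    have g0: "g t \<noteq> 0" if "0 \<le> t" "t \<le> 1" for t
    proof
      assume "g t = 0"
      then have "0 = g t \<bullet> g t" by simp
      also have "\<dots> = (1 - t)\<^sup>2 * (u \<bullet> u) + 2 * t * (1 - t) * (u \<bullet> v) + t\<^sup>2 * (v \<bullet> v)"
        by (simp add: g_def inner_add_left inner_add_right inner_commute[of v u] power2_eq_square algebra_simps)
      finally have s: "(1 - t)\<^sup>2 * (u \<bullet> u) + 2 * t * (1 - t) * (u \<bullet> v) + t\<^sup>2 * (v \<bullet> v) = 0" by simp
      have "2 * t * (1 - t) * (u \<bullet> v) \<ge> 0" using that uv by simp
      moreover have "(1 - t)\<^sup>2 * (u \<bullet> u) \<ge> 0" "t\<^sup>2 * (v \<bullet> v) \<ge> 0" by simp_all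
      ultimately have "(1 - t)\<^sup>2 * (u \<bullet> u) = 0" "t\<^sup>2 * (v \<bullet> v) = 0" using s by linarith+
      then show False using assms(1) v by auto
    qed
    have "path_component {T. invertible T} (householder (g 0)) (householder (g 1))"
      by (rule path_componentI_interval[of "\<lambda>t. householder (g t)"])
        (use g0 in \<open>auto simp: householder_def g_def invertible_householder[unfolded householder_def]
          intro!: continuous_intros\<close>)
    then show ?thesis by (simp add: g_def)
  qed
  show ?thesis
  proof (cases "u \<bullet> v \<ge> 0")
    case False
    then show ?thesis using *[of "- v"] assms by (simp add: householder_minus)
  qed (use * assms in blast)
qed

lemma gl_path_mult:
  fixes A B :: "real^'n^'n"
  assumes "gl_path A A'" "gl_path B B'"
  shows "gl_path (A ** B) (A' ** B')"
proof -
  have inv: "invertible A'" "invertible B"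
    using assms path_component_mem by blast+
  have "gl_path (A ** B) (A' ** B)"
    by (rule path_component_image[OF assms(1), of "\<lambda>X. X ** B"])
      (auto intro!: continuous_intros invertible_mult inv)
  moreover have "gl_path (A' ** B) (A' ** B')"
    by (rule path_component_image[OF assms(2), of "\<lambda>X. A' ** X"])
      (auto intro!: continuous_intros invertible_mult inv)
  ultimately show ?thesis by (rule path_component_trans)
qed

lemma gl_path_refl: "invertible T \<Longrightarrow> gl_path T T"
  by (simp add: path_component_refl)

lemma outer_matrix_mult: "outer a b ** outer c d = (b \<bullet> c) *\<^sub>R outer a d"
  by (simp add: matrix_eq matrix_vector_mul_assoc[symmetric] outer_mult_vec scaleR_matrix_vector_assoc[symmetric]
    matrix_vector_mult_scaleR mult.commute)

lemma invertible_one_plus_nilpotent: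
  fixes E :: "real^'n^'n"
  assumes "E ** E = 0" shows "invertible (mat 1 + E)"
proof -
  have "(mat 1 + E) ** (mat 1 - E) = mat 1"
  proof -
    have "E *v (E *v x) = 0" for x by (simp add: matrix_vector_mul_assoc assms)
    then show ?thesis
      by (simp add: matrix_eq matrix_vector_mul_assoc[symmetric] mat_vec_distribs del: matrix_vector_mul_assoc)
  qed
  then show ?thesis using invertible_right_inverse by blast
qed

lemma householder_axis: "householder (axis k 1) = (\<chi> i j. if i = j then if i = k then - 1 else 1 else 0)"
proof -
  have "axis k 1 \<bullet> axis k (1::real) = 1" by (simp add: inner_axis_axis)
  then show ?thesis
    unfolding householder_def by (simp add: vec_eq_iff mat_def outer_def) (simp add: axis_def)
qed

text \<open>Induction over products of elementary matrices. \<open>Q\<close> is closed under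
  products since a reflection squares to the identity, and all reflections are joined to
  \<open>householder e\<close>. Guarding \<open>Q\<close> by invertibility lets the induction run
  over all matrices.\<close>

lemma gl_path_one_or_householder:
  fixes T :: "real^'n^'n"
  assumes T: "invertible T" and e: "e \<noteq> 0"
  shows "gl_path T (mat 1) \<or> gl_path T (householder e)"
proof -
  let ?R = "householder e"
  define Q where "Q T \<longleftrightarrow> gl_path T (mat 1) \<or> gl_path T ?R" for T :: "real^'n^'n"
  have one: "Q (mat 1)"
    unfolding Q_def by (intro disjI1 gl_path_refl) (metis invertible_def matrix_mul_lid)
  have hh: "Q (householder v)" if "v \<noteq> 0" for v
    unfolding Q_def using gl_path_householder that e by blast
  have Qmult: "Q (A ** B)" if "Q A" "Q B" for A B
  proof -
    from that obtain A' B' where "gl_path A A'" "gl_path B B'" "A' = mat 1 \<or> A' = ?R" "B' = mat 1 \<or> B' = ?R"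
      unfolding Q_def by metis
    then have "gl_path (A ** B) (A' ** B')" "A' ** B' = mat 1 \<or> A' ** B' = ?R"
      using gl_path_mult householder_involutive[OF e] by auto
    then show ?thesis unfolding Q_def by metis
  qed
  have Qpath: "Q A" if "gl_path A B" "Q B" for A B
    using that path_component_trans unfolding Q_def by blast
  have "invertible T \<longrightarrow> Q T"
  proof (rule induct_matrix_elementary_alt[where P = "\<lambda>T. invertible T \<longrightarrow> Q T"])
    fix A B :: "real^'n^'n" assume "invertible A \<longrightarrow> Q A" "invertible B \<longrightarrow> Q B"
    then show "invertible (A ** B) \<longrightarrow> Q (A ** B)"
      using Qmult by (auto simp: invertible_det_nz det_mul)
  next
    fix A :: "real^'n^'n" and i assume "row i A = 0"
    then have "det A = 0" by (rule det_zero_row)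
    then show "invertible A \<longrightarrow> Q A" by (simp add: invertible_det_nz)
  next
    fix A :: "real^'n^'n" assume A: "\<And>i j. i \<noteq> j \<Longrightarrow> A $ i $ j = 0"
    show "invertible A \<longrightarrow> Q A"
    proof
      assume inv: "invertible A"
      define dg where "dg a = (\<chi> i j. if i = j then a i else 0 :: real^'n^'n)" for a
      have dg_inv: "invertible (dg a) \<longleftrightarrow> (\<forall>i. a i \<noteq> 0)" for a
        by (simp add: invertible_det_nz dg_def det_diagonal)
      have Adg: "A = dg (\<lambda>i. A $ i $ i)" using A by (auto simp: dg_def vec_eq_iff)
      have nz: "A $ i $ i \<noteq> 0" for i using inv Adg dg_inv by metis
      \<comment> \<open>Each diagonal entry moves to its sign without crossing zero; what remains is
        a product of axis reflections.\<close>
      define g where "g t = dg (\<lambda>i. (1 - t) * A $ i $ i + t * sgn (A $ i $ i))" for t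
      have "gl_path (g 0) (g 1)"
      proof (rule path_componentI_interval)
        show "continuous_on {0..1} g"
          unfolding g_def dg_def
        proof (intro continuous_on_vec_lambda)
          fix i j :: 'n
          show "continuous_on {0..1} (\<lambda>t. if i = j then (1 - t) * A $ i $ i + t * sgn (A $ i $ i) else 0)"
            by (cases "i = j") (auto intro!: continuous_intros)
        qed
        fix t :: real assume t: "0 \<le> t" "t \<le> 1"
        have "(1 - t) * A $ i $ i + t * sgn (A $ i $ i) \<noteq> 0" for i
        proof -
          have "(1 - t) * A $ i $ i + t * sgn (A $ i $ i) = sgn (A $ i $ i) * ((1 - t) * \<bar>A $ i $ i\<bar> + t)"
            using nz[of i] by (simp add: algebra_simps sgn_real_def)
          moreover have "(1 - t) * \<bar>A $ i $ i\<bar> + t > 0"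
            using t nz[of i] by (cases "t = 0") (auto intro: add_nonneg_pos)
          ultimately show ?thesis using nz[of i] by (simp add: sgn_zero_iff)
        qed
        then show "g t \<in> {T. invertible T}" by (simp add: g_def dg_inv)
      qed
      moreover have "g 0 = A" using Adg by (simp add: g_def)
      moreover have "Q (g 1)"
      proof -
        have flip: "Q (dg (\<lambda>i. if i \<in> S then - 1 else 1))" if "finite S" for S
          using that
        proof (induction S)
          case empty
          have "dg (\<lambda>i. 1) = mat 1" by (simp add: dg_def mat_def vec_eq_iff)
          then show ?case using one by simp
        next
          case (insert k S)
          have h: "householder (axis k 1) = dg (\<lambda>i. if i = k then - 1 else 1)"
            by (simp add: householder_axis dg_def)
          have "dg a ** dg b = dg (\<lambda>i. a i * b i)" for a b
            by (simp add: dg_def matrix_matrix_mult_def vec_eq_iff if_distrib[of "\<lambda>c. c * _"] if_distrib[of "\<lambda>c. _ * c"] cong: if_cong)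
          then have "dg (\<lambda>i. if i \<in> insert k S then - 1 else 1) = householder (axis k 1) ** dg (\<lambda>i. if i \<in> S then - 1 else 1)"
            using insert(2) unfolding h by (auto intro!: arg_cong[where f = dg])
          then show ?case using Qmult[OF hh insert.IH] by (simp add: axis_eq_0_iff)
        qed
        have "g 1 = dg (\<lambda>i. if i \<in> {i. A $ i $ i < 0} then - 1 else 1)"
          unfolding g_def using nz by (intro arg_cong[where f = dg]) (force simp: sgn_real_def)
        then show ?thesis using flip[of "{i. A $ i $ i < 0}"] by simp
      qed
      ultimately show "Q A" using Qpath by metis
    qed
  next
    fix m n :: 'n assume mn: "m \<noteq> n"
    \<comment> \<open>Swapping two coordinates is the reflection along the difference of the two
      axis vectors.\<close>
    have "(\<chi> i j. mat 1 $ i $ Transposition.transpose m n j) = householder (axis m 1 - axis n (1::real))"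
    proof -
      have "(axis m 1 - axis n 1) \<bullet> (axis m 1 - axis n (1::real)) = 2"
        using mn by (simp add: inner_diff_left inner_diff_right inner_axis_axis)
      then show ?thesis
        unfolding householder_def using mn
        by (simp add: vec_eq_iff mat_def outer_def) (auto simp: axis_def Transposition.transpose_def)
    qed
    moreover have "axis m 1 - axis n (1::real) \<noteq> 0"
      using mn by (simp add: axis_eq_axis)
    ultimately show "invertible (\<chi> i j. mat 1 $ i $ Transposition.transpose m n j)
       \<longrightarrow> Q (\<chi> i j. mat 1 $ i $ Transposition.transpose m n j)"
      using hh by simp
  next
    fix m n :: 'n assume mn: "m \<noteq> n"
    let ?E = "outer (axis m 1) (axis n 1) :: real^'n^'n"
    have eq: "(\<chi> i j. of_bool (i = m \<and> j = n \<or> i = j)) = mat 1 + 1 *\<^sub>R ?E"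
      using mn by (auto simp: vec_eq_iff mat_def outer_def axis_def)
    \<comment> \<open>The off-diagonal entry is shrunk to 0; invertibility persists because that
      part squares to zero.\<close>
    have "gl_path (mat 1 + 1 *\<^sub>R ?E) (mat 1 + 0 *\<^sub>R ?E)"
    proof (rule path_component_sym, rule path_componentI_interval[of "\<lambda>t. mat 1 + t *\<^sub>R ?E"])
      show "continuous_on {0..1} (\<lambda>t. mat 1 + t *\<^sub>R ?E)" by (intro continuous_intros)
      fix t :: real
      have "(t *\<^sub>R ?E) ** (t *\<^sub>R ?E) = 0"
        using mn by (simp add: scalar_matrix_assoc[symmetric] matrix_scalar_ac outer_matrix_mult inner_axis_axis)
      then show "mat 1 + t *\<^sub>R ?E \<in> {T. invertible T}" by (simp add: invertible_one_plus_nilpotent)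
    qed
    then have "Q (mat 1 + 1 *\<^sub>R ?E)" using Qpath one by simp
    then show "invertible (\<chi> i j. of_bool (i = m \<and> j = n \<or> i = j)) \<longrightarrow> Q (\<chi> i j. of_bool (i = m \<and> j = n \<or> i = j))"
      unfolding eq by blast
  qed
  then show ?thesis using T by (simp add: Q_def)
qed

lemma continuous_on_similar:
  fixes f :: "'t::topological_space \<Rightarrow> real^'nx::finite^'nx" and g :: "'t \<Rightarrow> ('nx, 'nu::finite, 'ny::finite) ctrl"
  assumes "continuous_on S f" "continuous_on S g" "\<And>t. t \<in> S \<Longrightarrow> invertible (f t)"
  shows "continuous_on S (\<lambda>t. similar (f t) (g t))"
  unfolding similar_def case_prod_unfold
  by (intro continuous_intros continuous_on_matrix_inv assms)

lemma path_component_similar: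
  fixes K :: "('nx::finite, 'nu::finite, 'ny::finite) ctrl"
  assumes "gl_path S T" "K \<in> Kgamma P \<gamma>"
  shows "path_component (Kgamma P \<gamma>) (similar S K) (similar T K)"
  by (rule path_component_image[OF assms(1), of "\<lambda>T. similar T K"])
     (auto intro!: continuous_on_similar continuous_intros Kgamma_similar assms)

text \<open>Contracting the coordinate change to I or to the reflection joins each controller to
  some slice controller L or to the mirror image of L. Reflecting such a path from the fixed
  \<open>K\<close> gives a second path from \<open>K\<close>, so L and its mirror image are joined
  through \<open>K\<close>.\<close>

lemma Kgamma_path_connected_if_fixed:
  fixes K :: "('nx::finite, 'nu::finite, 'ny::finite) ctrl"
  assumes K: "K \<in> Kgamma P \<gamma>" and v: "v \<noteq> 0" and fixed: "similar (householder v) K = K"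
  shows "path_connected (Kgamma P \<gamma>)"
proof -
  let ?pc = "path_component (Kgamma P \<gamma>)"
  let ?R = "householder v"
  have R: "invertible ?R" by (rule invertible_householder[OF v])
  have g0: "\<gamma> > 0" using K Kgamma_iff_certificate by blast
  note sl = slice_subset[OF g0, of P]
  have red: "\<exists>L\<in>slice P \<gamma>. ?pc K' L \<or> ?pc K' (similar ?R L)" if K': "K' \<in> Kgamma P \<gamma>" for K'
  proof -
    obtain T L where TL: "invertible T" "L \<in> slice P \<gamma>" "K' = similar T L"
      using Kgamma_similar_slice[OF K'] by metis
    have L: "L \<in> Kgamma P \<gamma>" using TL sl by blast
    show ?thesis
      using gl_path_one_or_householder[OF TL(1) v] path_component_similar[OF _ L] TL
      by (metis similar_one)
  qed
  have slpc: "?pc L L'" if "L \<in> slice P \<gamma>" "L' \<in> slice P \<gamma>" for L L'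
    using path_component_of_subset[OF sl] path_connected_slice that unfolding path_connected_component by blast
  have pcR: "?pc (similar ?R L) (similar ?R L')" if "?pc L L'" for L L'
    by (rule path_component_image[OF that, of "similar ?R"])
       (auto intro!: continuous_on_similar continuous_intros Kgamma_similar R)
  have RR: "similar ?R (similar ?R L) = L" for L :: "('nx, 'nu, 'ny) ctrl"
    by (simp add: similar_mult[OF R R] householder_involutive[OF v])
  obtain L0 where L0: "L0 \<in> slice P \<gamma>" "?pc K L0 \<or> ?pc K (similar ?R L0)"
    using red[OF K] by blast
  have L0R: "?pc L0 (similar ?R L0)"
    using L0(2)
  proof
    assume h: "?pc K L0"
    from pcR[OF h] have "?pc K (similar ?R L0)" unfolding fixed .
    with path_component_sym[OF h] show ?thesis by (rule path_component_trans)
  next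
    assume h: "?pc K (similar ?R L0)"
    from pcR[OF h] have "?pc K L0" unfolding fixed RR .
    from path_component_sym[OF this] h show ?thesis by (rule path_component_trans)
  qed
  have base: "?pc K' L0" if K': "K' \<in> Kgamma P \<gamma>" for K'
  proof -
    obtain L where L: "L \<in> slice P \<gamma>" "?pc K' L \<or> ?pc K' (similar ?R L)"
      using red[OF K'] by blast
    from L(2) show ?thesis
    proof
      assume "?pc K' L"
      then show ?thesis using slpc[OF L(1) L0(1)] by (rule path_component_trans)
    next
      assume "?pc K' (similar ?R L)"
      then have "?pc K' (similar ?R L0)" using pcR[OF slpc[OF L(1) L0(1)]] by (rule path_component_trans)
      then show ?thesis using path_component_sym[OF L0R] by (rule path_component_trans)
    qed
  qed
  show ?thesis
    unfolding path_connected_component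
    using path_component_trans[OF base path_component_sym[OF base]] by blast
qed

subsection \<open>Uncontrollable controllers\<close>

lemma mpow_Suc: "mpow A (Suc k) *v x = A *v (mpow A k *v x)" for A :: "real^'n^'n"
  by (simp add: mpow_def matrix_vector_mul_assoc)

text \<open>The spaces \<open>V j\<close> grow with \<open>j\<close>. If the first n inclusions were
  all strict, the dimension count would make \<open>V n\<close> everything; so
  \<open>V j = V (Suc j)\<close> for some j < n. Since \<open>A\<close> maps \<open>V j\<close> into
  \<open>V (Suc j)\<close>, that space is invariant, and it contains the range of
  \<open>B\<close>.\<close>

lemma uncontrollable_invariant_subspace:
  fixes A :: "real^'n^'n" and B :: "real^'m^'n"
  assumes "\<not> controllable A B"
  obtains S where "subspace S" "S \<noteq> UNIV" "\<And>x. x \<in> S \<Longrightarrow> A *v x \<in> S" "\<And>u. B *v u \<in> S"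
proof -
  define V where "V j = span {mpow A k *v (B *v u) | k u. k < j}" for j
  have sub: "subspace (V j)" for j by (simp add: V_def)
  have mono: "V j \<subseteq> V (Suc j)" for j
    unfolding V_def by (intro span_mono) auto
  have mem: "mpow A k *v (B *v u) \<in> V j" if "k < j" for k u j
    unfolding V_def by (intro span_base) (use that in auto)
  have AV: "A *v x \<in> V (Suc j)" if "x \<in> V j" for x j
    using that unfolding V_def
  proof (induction rule: span_induct_alt)
    case base
    then show ?case by (simp add: span_zero)
  next
    case (step c x y)
    then obtain k u where "x = mpow A k *v (B *v u)" "k < j" by blast
    then have "A *v x \<in> V (Suc j)" using mem[of "Suc k" "Suc j"] by (simp add: mpow_Suc)
    then show ?case using step(2) unfolding V_def
      by (simp add: mat_vec_linear span_add span_scale)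
  qed
  have ne: "V (CARD('n)) \<noteq> UNIV" using assms by (simp add: V_def controllable_def)
  have "\<exists>j<CARD('n). V j = V (Suc j)"
  proof (rule ccontr)
    assume "\<not> ?thesis"
    then have strict: "V j \<noteq> V (Suc j)" if "j < CARD('n)" for j using that by blast
    have "j \<le> CARD('n) \<longrightarrow> dim (V j) \<ge> j" for j
    proof (induction j)
      case (Suc j)
      show ?case
      proof
        assume j: "Suc j \<le> CARD('n)"
        have "dim (V j) < dim (V (Suc j))"
          using strict[of j] j mono[of j] sub by (intro dim_psubset) (auto simp: span_eq_iff[THEN iffD2])
        then show "Suc j \<le> dim (V (Suc j))" using Suc j by simp
      qed
    qed simp
    then have "dim (V (CARD('n))) = DIM(real^'n)"
      using dim_subset_UNIV[of "V (CARD('n))"] by (simp add: le_antisym)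
    then have "V (CARD('n)) = UNIV"
      using dim_eq_full[of "V (CARD('n))"] sub by (metis span_eq_iff)
    then show False using ne by simp
  qed
  then obtain j where j: "j < CARD('n)" "V j = V (Suc j)" by blast
  have inv: "A *v x \<in> V j" if "x \<in> V j" for x using AV[OF that] j by simp
  have BV: "B *v u \<in> V j" for u
    using mem[of 0 "Suc j" u] j(2) by (simp add: mpow_def)
  have "V j \<subseteq> V (CARD('n))"
    unfolding V_def using j(1) by (intro span_mono) auto
  then have "V j \<noteq> UNIV" using ne by auto
  then show ?thesis using that[OF sub] inv BV by blast
qed

lemma orthogonal_projection_matrix:
  fixes S :: "(real^'n) set"
  assumes S: "subspace S"
  obtains E :: "real^'n^'n" where "transpose E = E" "\<And>x. E *v x \<in> S" "\<And>x. x \<in> S \<Longrightarrow> E *v x = x"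
proof -
  obtain B where B: "B \<subseteq> S" "pairwise orthogonal B" "\<And>x. x \<in> B \<Longrightarrow> norm x = 1" "independent B" "span B = S"
    using orthonormal_basis_subspace[OF S] by metis
  have fin: "finite B" using B(4) by (rule independent_imp_finite)
  define E where "E = (\<Sum>b\<in>B. outer b b)"
  have Ex: "E *v x = (\<Sum>b\<in>B. (b \<bullet> x) *\<^sub>R b)" for x
  proof -
    have "linear (\<lambda>M::real^'n^'n. M *v x)"
      by (auto intro!: linearI simp: matrix_vector_mult_add_rdistrib scaleR_matrix_vector_assoc)
    have "E *v x = (\<Sum>b\<in>B. outer b b *v x)"
      unfolding E_def by (rule linear_sum[OF \<open>linear (\<lambda>M. M *v x)\<close>])
    then show ?thesis by (simp add: outer_mult_vec)
  qed
  show ?thesis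
  proof
    show "transpose E = E"
      by (simp add: E_def transpose_def outer_def vec_eq_iff mult.commute)
    show "E *v x \<in> S" for x
      unfolding Ex B(5)[symmetric] by (intro span_sum span_scale span_base)
    show "E *v x = x" if "x \<in> S" for x
      using that unfolding B(5)[symmetric]
    proof (induction rule: span_induct_alt)
      case (step c b y)
      have "E *v b = (\<Sum>b'\<in>B. if b' = b then b else 0)"
        unfolding Ex using B(2,3) step(1)
        by (intro sum.cong) (auto simp: pairwise_def orthogonal_def dot_square_norm)
      then have "E *v b = b" using fin step(1) by simp
      then show ?case using step(2) by (simp add: mat_vec_linear)
    qed simp
  qed
qed

text \<open>Finsler's lemma. The unit vectors with q >= 0 form a compact set on which r <= -\<rho> <
  0 and q <= N, so k = (N + 1) / \<rho> suffices there; on the other unit vectors \<open>q\<close>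
  is negative and \<open>r\<close> nonpositive.\<close>

lemma bilinear_finsler:
  fixes q r :: "'a::euclidean_space \<Rightarrow> 'a \<Rightarrow> real"
  assumes q: "bilinear q" and r: "bilinear r" and r0: "\<And>l. r l l \<le> 0"
    and neg: "\<And>l. l \<noteq> 0 \<Longrightarrow> r l l = 0 \<Longrightarrow> q l l < 0"
  obtains k where "k > 0" "\<And>l. l \<noteq> 0 \<Longrightarrow> q l l + k * r l l < 0"
proof -
  let ?S = "sphere (0::'a) 1"
  define T where "T = ?S \<inter> {l. q l l \<ge> 0}"
  have cT: "compact T"
    unfolding T_def by (intro compact_Int_closed closed_Collect_le continuous_on_const continuous_on_bilinear_diag[OF q]) auto
  have unit: "\<exists>k>0. \<forall>l\<in>?S. q l l + k * r l l < 0"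
  proof (cases "T = {}")
    case True
    have "q l l + 1 * r l l < 0" if "l \<in> ?S" for l
    proof -
      have "q l l < 0" using True that by (auto simp: T_def)
      then show ?thesis using r0[of l] by simp
    qed
    then show ?thesis by (intro exI[of _ 1]) auto
  next
    case False
    obtain l1 where l1: "l1 \<in> T" "\<And>l. l \<in> T \<Longrightarrow> r l l \<le> r l1 l1"
      using continuous_attains_sup[OF cT False continuous_on_bilinear_diag[OF r]] by auto
    obtain l2 where l2: "l2 \<in> T" "\<And>l. l \<in> T \<Longrightarrow> q l l \<le> q l2 l2"
      using continuous_attains_sup[OF cT False continuous_on_bilinear_diag[OF q]] by auto
    define \<rho> where "\<rho> = - r l1 l1"
    have "l1 \<noteq> 0" "q l1 l1 \<ge> 0" using l1(1) by (auto simp: T_def)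
    then have "r l1 l1 \<noteq> 0" using neg[of l1] by auto
    then have \<rho>: "\<rho> > 0" using r0[of l1] by (simp add: \<rho>_def)
    define N where "N = q l2 l2"
    have N: "N \<ge> 0" using l2(1) by (simp add: T_def N_def)
    define k where "k = (N + 1) / \<rho>"
    have k: "k > 0" "k * \<rho> = N + 1" using N \<rho> by (simp_all add: k_def)
    have "q l l + k * r l l < 0" if l: "l \<in> ?S" for l
    proof (cases "l \<in> T")
      case True
      have "k * r l l \<le> k * (- \<rho>)" using l1(2)[OF True] k by (intro mult_left_mono) (auto simp: \<rho>_def)
      moreover have "q l l \<le> N" using l2(2)[OF True] by (simp add: N_def)
      ultimately show ?thesis using k(2) by simp
    next
      case False
      then have "q l l < 0" using l by (auto simp: T_def)
      moreover have "k * r l l \<le> 0" using r0[of l] k by (simp add: mult_nonneg_nonpos)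
      ultimately show ?thesis by simp
    qed
    then show ?thesis using k(1) by blast
  qed
  then obtain k where k: "k > 0" "\<And>l. norm l = 1 \<Longrightarrow> q l l + k * r l l < 0"
    by auto
  show ?thesis
  proof (rule that[OF k(1)])
    fix l :: 'a assume l: "l \<noteq> 0"
    have "q l l + k * r l l = (norm l)\<^sup>2 * (q (sgn l) (sgn l) + k * r (sgn l) (sgn l))"
      unfolding bilinear_sgn[OF q, of l] bilinear_sgn[OF r, of l] by (simp add: algebra_simps)
    also have "\<dots> < 0" using k(2)[of "sgn l"] l by (simp add: norm_sgn mult_pos_neg)
    finally show "q l l + k * r l l < 0" .
  qed
qed

section \<open>Decoupling: \<open>E\<close> projects onto an \<open>A\<close>-invariant subspace
  containing the range of \<open>B\<close>, \<open>F\<close> onto its complement\<close>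

context
  fixes P :: "('nx::finite, 'nw::finite, 'nu::finite, 'ny::finite, 'nz::finite) plant"
    and A B C D E F X V Z and \<gamma> :: real
  assumes c: "certificate P \<gamma> (D, C, B, A) X V Z"
    and symE: "transpose E = E" and EE: "\<And>x. E *v (E *v x) = E *v x"
    and AE: "\<And>x. A *v (E *v x) = E *v (A *v (E *v x))" and EB: "\<And>u. E *v (B *v u) = B *v u"
    and F_def: "F = mat 1 - E"
begin

private lemma Fv: "F *v x = x - E *v x"
  by (simp add: F_def matrix_vector_mult_diff_rdistrib)

private lemma symF: "transpose F = F"
  using symE by (simp add: F_def transpose_def vec_eq_iff mat_def)

text \<open>\<open>Z2\<close> is the inverse of the compression to the uncontrollable directions of the lower right block
  of the inverse certificate.\<close>

lemma uncontrollable_lyapunov: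
  obtains Z2 where "transpose Z2 = Z2" "\<And>x. x \<noteq> 0 \<Longrightarrow> (Z2 *v x) \<bullet> x > 0"
    "\<And>\<xi>. F *v \<xi> \<noteq> 0 \<Longrightarrow> (Z2 *v (F *v \<xi>)) \<bullet> (F *v (A *v (F *v \<xi>))) < 0"
proof -
  let ?M = "block X V (transpose V) Z"
  have symM: "transpose ?M = ?M" using certificateD[OF c] by (simp add: transpose_block)
  have "(?M *v v) \<bullet> v > 0" if "v \<noteq> 0" for v
  proof -
    obtain x \<xi> where v: "v = join x \<xi>" by (rule join_cases)
    then have "storage X V Z x \<xi> > 0" using that by (intro certificateD(3)[OF c]) auto
    then show ?thesis unfolding v block_mult inner_join storage_def .
  qed
  then have M: "invertible ?M" by (rule pd_invertible)
  obtain R11 R12 R21 R22 where R: "matrix_inv ?M = block R11 R12 R21 R22" by (rule block_cases)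
  have "transpose (matrix_inv ?M) = matrix_inv ?M"
    unfolding invertible_transpose_field(2)[symmetric, OF M] symM ..
  then have symR: "transpose R22 = R22" by (simp add: R transpose_block block_eq_iff)
  \<comment> \<open>Columns of the inverse certificate: the state (R12 \<eta>, R22 \<eta>) has half
    gradient (0, \<eta>).\<close>
  have inv: "X *v (R12 *v \<eta>) + V *v (R22 *v \<eta>) = 0" "transpose V *v (R12 *v \<eta>) + Z *v (R22 *v \<eta>) = \<eta>" for \<eta>
  proof -
    have "?M *v (matrix_inv ?M *v join 0 \<eta>) = join 0 \<eta>" by (rule matrix_inv_vec(2)[OF M])
    then show "X *v (R12 *v \<eta>) + V *v (R22 *v \<eta>) = 0" "transpose V *v (R12 *v \<eta>) + Z *v (R22 *v \<eta>) = \<eta>"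
      unfolding R block_mult by simp_all
  qed
  have nzR: "R12 *v \<eta> \<noteq> 0 \<or> R22 *v \<eta> \<noteq> 0" if "\<eta> \<noteq> 0" for \<eta>
    using inv(2)[of \<eta>] that by (metis add_0 matrix_vector_mult_0_right)
  have Rpd: "(R22 *v \<eta>) \<bullet> \<eta> > 0" if "\<eta> \<noteq> 0" for \<eta>
    using certificateD(3)[OF c nzR[OF that]] unfolding storage_def inv by (simp add: inner_commute)
  \<comment> \<open>Adding \<open>E\<close> makes the compression of \<open>R22\<close> to the range
    of \<open>F\<close> invertible on the whole space.\<close>
  define Rh where "Rh = F ** R22 ** F + E"
  have Rh: "Rh *v x = F *v (R22 *v (F *v x)) + E *v x" for x
    by (simp add: Rh_def mat_vec_distribs)
  have symRh: "transpose Rh = Rh"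
  proof -
    have "transpose (F ** R22 ** F) = F ** R22 ** F"
      by (simp add: matrix_transpose_mul symF symR matrix_mul_assoc)
    then show ?thesis using symE by (simp add: Rh_def transpose_def vec_eq_iff)
  qed
  have Rhpd: "(Rh *v x) \<bullet> x > 0" if "x \<noteq> 0" for x
  proof -
    have e: "(E *v x) \<bullet> x = (E *v x) \<bullet> (E *v x)"
      by (metis EE symmetric_inner[OF symE])
    have f: "(F *v (R22 *v (F *v x))) \<bullet> x = (R22 *v (F *v x)) \<bullet> (F *v x)"
      by (rule symmetric_inner[OF symF])
    have "F *v x \<noteq> 0 \<or> E *v x \<noteq> 0" using that by (auto simp: Fv)
    moreover have "(R22 *v (F *v x)) \<bullet> (F *v x) \<ge> 0" using Rpd[of "F *v x"] by (cases "F *v x = 0") auto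
    moreover have "(E *v x) \<bullet> (E *v x) \<ge> 0" by simp
    ultimately show ?thesis
      using Rpd[of "F *v x"] inner_gt_zero_iff[of "E *v x"] unfolding Rh inner_add_left e f by linarith
  qed
  have invRh: "invertible Rh" by (rule pd_invertible[OF Rhpd])
  define Z2 where "Z2 = matrix_inv Rh"
  have RZ: "Rh *v (Z2 *v x) = x" for x by (simp add: Z2_def matrix_inv_vec(2)[OF invRh])
  show ?thesis
  proof
    show "transpose Z2 = Z2" by (simp add: Z2_def invertible_transpose_field(2)[symmetric, OF invRh] symRh)
    show "(Z2 *v x) \<bullet> x > 0" if "x \<noteq> 0" for x
    proof -
      have "Z2 *v x \<noteq> 0" using RZ[of x] that by (metis matrix_vector_mult_0_right)
      from Rhpd[OF this] show ?thesis by (simp add: RZ inner_commute)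
    qed
    fix \<xi> assume \<xi>: "F *v \<xi> \<noteq> 0"
    define \<eta> where "\<eta> = Z2 *v (F *v \<xi>)"
    have Rh\<eta>: "F *v (R22 *v (F *v \<eta>)) + E *v \<eta> = F *v \<xi>" using RZ[of "F *v \<xi>"] by (simp add: \<eta>_def Rh)
    have EF: "E *v (F *v x) = 0" for x by (simp add: Fv matrix_vector_mult_diff_distrib EE)
    have "E *v (F *v (R22 *v (F *v \<eta>)) + E *v \<eta>) = 0" unfolding Rh\<eta> EF ..
    then have E\<eta>: "E *v \<eta> = 0" by (simp add: matrix_vector_right_distrib EF EE)
    then have F\<eta>: "F *v \<eta> = \<eta>" by (simp add: Fv)
    have FR: "F *v (R22 *v \<eta>) = F *v \<xi>" using Rh\<eta> by (simp add: F\<eta> E\<eta>)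
    have \<eta>0: "\<eta> \<noteq> 0" using Rh\<eta> \<xi> by (metis add_0 matrix_vector_mult_0_right)
    define x where "x = R12 *v \<eta>"
    define \<zeta> where "\<zeta> = R22 *v \<eta>"
    \<comment> \<open>At this state the plant component of the gradient vanishes, so dissipation
      with w = 0 speaks of the controller dynamics alone.\<close>
    have "dissipation P \<gamma> (D, C, B, A) X V Z x \<zeta> 0 < 0"
      using nzR[OF \<eta>0] by (intro certificateD(4)[OF c]) (auto simp: x_def \<zeta>_def)
    then have "2 * (\<eta> \<bullet> ctl_rhs P (D, C, B, A) x \<zeta> 0)
        + perf_output P (D, C, B, A) x \<zeta> 0 \<bullet> perf_output P (D, C, B, A) x \<zeta> 0 < 0"
      unfolding dissipation_def by (simp only: x_def \<zeta>_def inv) simp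
    then have neg: "\<eta> \<bullet> ctl_rhs P (D, C, B, A) x \<zeta> 0 < 0"
      using inner_ge_zero[of "perf_output P (D, C, B, A) x \<zeta> 0"] by linarith
    \<comment> \<open>\<eta> is orthogonal to the range of \<open>E\<close>, which contains the
      range of \<open>B\<close> and the image of itself under \<open>A\<close>; only the action of
      \<open>A\<close> on the \<open>F\<close> component contributes.\<close>
    have E\<eta>0: "\<eta> \<bullet> (E *v u) = 0" for u
      using symmetric_inner[OF symE, of \<eta> u] E\<eta> by simp
    have "\<eta> \<bullet> ctl_rhs P (D, C, B, A) x \<zeta> 0 = \<eta> \<bullet> (B *v (pC2 P *v x)) + \<eta> \<bullet> (A *v (E *v \<zeta> + F *v \<zeta>))"
      by (simp add: ctl_rhs_def inner_add_right Fv)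
    also have "\<eta> \<bullet> (B *v (pC2 P *v x)) = 0" using E\<eta>0[of "B *v (pC2 P *v x)"] by (simp add: EB)
    also have "A *v (E *v \<zeta> + F *v \<zeta>) = E *v (A *v (E *v \<zeta>)) + A *v (F *v \<xi>)"
      using FR AE by (simp add: matrix_vector_right_distrib \<zeta>_def)
    finally have "\<eta> \<bullet> ctl_rhs P (D, C, B, A) x \<zeta> 0 = \<eta> \<bullet> (A *v (F *v \<xi>))"
      by (simp add: inner_add_right E\<eta>0)
    moreover have "\<eta> \<bullet> (A *v (F *v \<xi>)) = \<eta> \<bullet> (F *v (A *v (F *v \<xi>)))"
      using symmetric_inner[OF symF, of \<eta>] F\<eta> by metis
    ultimately show "(Z2 *v (F *v \<xi>)) \<bullet> (F *v (A *v (F *v \<xi>))) < 0"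
      using neg by (simp add: \<eta>_def)
  qed
qed

text \<open>The modified controller agrees with the original on the range of \<open>E\<close>, so
  for F \<xi> = 0 the compressed dissipation is the original one and negative. The Lyapunov term of
  \<open>Z2\<close> is nonpositive and vanishes only there; \<open>bilinear_finsler\<close> supplies
  the weight \<open>k\<close> that combines the two.\<close>

lemma decoupled_certificate:
  assumes symZ2: "transpose Z2 = Z2" and Z2: "\<And>x. x \<noteq> 0 \<Longrightarrow> (Z2 *v x) \<bullet> x > 0"
    and CL: "\<And>x. CL *v (E *v x) = C *v (E *v x)" and AL: "\<And>x. AL *v (E *v x) = A *v (E *v x)"
    and lyap: "\<And>\<xi>. F *v \<xi> \<noteq> 0 \<Longrightarrow> (Z2 *v (F *v \<xi>)) \<bullet> (F *v (AL *v (F *v \<xi>))) < 0"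
  shows "\<exists>k. certificate P \<gamma> (D, CL, B, AL) X (V ** E) (E ** Z ** E + k *\<^sub>R (F ** Z2 ** F))"
proof -
  let ?L = "(D, CL, B, AL)"
  have iE: "(E *v x) \<bullet> y = x \<bullet> (E *v y)" and iF: "(F *v x) \<bullet> y = x \<bullet> (F *v y)" for x y
    by (rule symmetric_inner[OF symE] symmetric_inner[OF symF])+
  \<comment> \<open>The \<open>F\<close> component of the controller evolves autonomously, because
    the input and the \<open>E\<close> component act only within the range of
    \<open>E\<close>.\<close>
  have Fctl: "F *v ctl_rhs P ?L x \<xi> w = F *v (AL *v (F *v \<xi>))" for x \<xi> w
  proof -
    have "ctl_rhs P ?L x \<xi> w = E *v (B *v (pC2 P *v x + pD21 P *v w)) + (E *v (A *v (E *v \<xi>)) + AL *v (F *v \<xi>))"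
      using AL[of \<xi>] AE[of \<xi>] by (simp add: ctl_rhs_def EB Fv matrix_vector_mult_diff_distrib)
    moreover have "F *v (E *v y) = 0" for y by (simp add: Fv EE)
    ultimately show ?thesis by (simp add: matrix_vector_right_distrib)
  qed
  define f where "f = (\<lambda>(x, \<xi>, w). plant_rhs P ?L x \<xi> w)"
  define g where "g = (\<lambda>(x, \<xi>, w). ctl_rhs P ?L x \<xi> w)"
  define h where "h = (\<lambda>(x, \<xi>, w). perf_output P ?L x \<xi> w)"
  have lin: "linear f" "linear g" "linear h"
    unfolding f_def g_def h_def by (rule linear_closed_loop)+
  note pr = linear_compose[OF linear_snd linear_fst, unfolded o_def]
  define q where "q l l' = 2 * ((X *v fst l + V *v (E *v fst (snd l))) \<bullet> f l'
       + (transpose V *v fst l + Z *v (E *v fst (snd l))) \<bullet> (E *v g l'))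
     + h l \<bullet> h l' - \<gamma>\<^sup>2 * (snd (snd l) \<bullet> snd (snd l'))" for l l'
  define r where "r l l' = 2 * ((Z2 *v (F *v fst (snd l))) \<bullet> (F *v (AL *v (F *v fst (snd l')))))"
    for l l' :: "(real^'nx) \<times> (real^'nx) \<times> (real^'nw)"
  have bq: "bilinear q" and br: "bilinear r"
    unfolding q_def r_def
    by (intro bilinear_dissipation bilinear_add_fun bilinear_scale_fun bilinear_inner_comp lin pr
      linear_compose_add linear_matrix_comp linear_fst)+
  have r0: "r l l \<le> 0" for l
    using lyap[of "fst (snd l)"] by (cases "F *v fst (snd l) = 0") (auto simp: r_def)
  have neg: "q l l < 0" if l: "l \<noteq> 0" and rl: "r l l = 0" for l
  proof -
    obtain x \<xi> w where lt: "l = (x, \<xi>, w)" by (cases l)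
    have "F *v \<xi> = 0" using rl lyap[of \<xi>] by (auto simp: r_def lt)
    then have E\<xi>: "E *v \<xi> = \<xi>" by (simp add: Fv)
    have CL\<xi>: "CL *v \<xi> = C *v \<xi>" and AL\<xi>: "AL *v \<xi> = A *v \<xi>" and AE\<xi>: "E *v (A *v \<xi>) = A *v \<xi>"
      using CL[of \<xi>] AL[of \<xi>] AE[of \<xi>] unfolding E\<xi> by simp_all
    have u: "ctl_input P ?L x \<xi> w = ctl_input P (D, C, B, A) x \<xi> w"
      by (simp add: ctl_input_def CL\<xi>)
    have rhs: "plant_rhs P ?L x \<xi> w = plant_rhs P (D, C, B, A) x \<xi> w"
        "perf_output P ?L x \<xi> w = perf_output P (D, C, B, A) x \<xi> w"
      by (simp_all add: plant_rhs_def perf_output_def u)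
    have "E *v ctl_rhs P ?L x \<xi> w = ctl_rhs P (D, C, B, A) x \<xi> w"
      by (simp add: ctl_rhs_def matrix_vector_right_distrib[of E] EB AL\<xi> AE\<xi>)
    then have "q l l = dissipation P \<gamma> (D, C, B, A) X V Z x \<xi> w"
      by (simp add: q_def lt f_def g_def h_def dissipation_def rhs E\<xi>)
    also have "\<dots> < 0" using l by (intro certificateD(4)[OF c]) (auto simp: lt zero_prod_def)
    finally show ?thesis .
  qed
  obtain k where k: "k > 0" "\<And>l. l \<noteq> 0 \<Longrightarrow> q l l + k * r l l < 0"
    using bilinear_finsler[OF bq br r0 neg] by metis
  show ?thesis
  proof (intro exI)
    let ?Z = "E ** Z ** E + k *\<^sub>R (F ** Z2 ** F)"
    have vecs: "(V ** E) *v \<xi> = V *v (E *v \<xi>)" "transpose (V ** E) *v x = E *v (transpose V *v x)"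
      "?Z *v \<xi> = E *v (Z *v (E *v \<xi>)) + k *\<^sub>R (F *v (Z2 *v (F *v \<xi>)))" for x \<xi>
      by (simp_all only: matrix_transpose_mul symE mat_add_scale_vec
          matrix_vector_mul_assoc matrix_mul_assoc)
    have symZ: "transpose Z = Z" by (rule certificateD(2)[OF c])
    have grad: "(transpose (V ** E) *v x + ?Z *v \<xi>) \<bullet> y = (transpose V *v x + Z *v (E *v \<xi>)) \<bullet> (E *v y)
       + k * ((Z2 *v (F *v \<xi>)) \<bullet> (F *v y))" for x \<xi> y
      unfolding vecs by (simp add: inner_add_left iE iF del: transpose_matrix_vector)
    show "certificate P \<gamma> ?L X (V ** E) ?Z"
      unfolding certificate_def
    proof (intro conjI allI impI)
      show "transpose X = X" by (rule certificateD(1)[OF c])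
      have "transpose (E ** Z ** E) = E ** Z ** E" "transpose (F ** Z2 ** F) = F ** Z2 ** F"
        by (simp_all add: matrix_transpose_mul symE symF symZ symZ2 matrix_mul_assoc)
      then show "transpose ?Z = ?Z" by (simp add: transpose_def vec_eq_iff)
      fix x \<xi> :: "real^'nx" assume nz: "x \<noteq> 0 \<or> \<xi> \<noteq> 0"
      have st: "storage X (V ** E) ?Z x \<xi> = storage X V Z x (E *v \<xi>) + k * ((Z2 *v (F *v \<xi>)) \<bullet> (F *v \<xi>))"
        unfolding storage_def grad vecs(1) by simp
      have s0: "storage X V Z x (E *v \<xi>) > 0" if "x \<noteq> 0 \<or> E *v \<xi> \<noteq> 0"
        using that by (rule certificateD(3)[OF c])
      have z0: "k * ((Z2 *v (F *v \<xi>)) \<bullet> (F *v \<xi>)) > 0" if "F *v \<xi> \<noteq> 0"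
        using Z2[OF that] k(1) by simp
      show "storage X (V ** E) ?Z x \<xi> > 0"
      proof (cases "x \<noteq> 0 \<or> E *v \<xi> \<noteq> 0")
        case True
        moreover have "k * ((Z2 *v (F *v \<xi>)) \<bullet> (F *v \<xi>)) \<ge> 0"
          using z0 by (cases "F *v \<xi> = 0") auto
        ultimately show ?thesis using s0 unfolding st by linarith
      next
        case False
        then have "F *v \<xi> \<noteq> 0" using nz by (auto simp: Fv)
        then show ?thesis using z0 False unfolding st by (simp add: storage_def)
      qed
    next
      fix x \<xi> :: "real^'nx" and w :: "real^'nw" assume "x \<noteq> 0 \<or> \<xi> \<noteq> 0 \<or> w \<noteq> 0"
      then have "q (x, \<xi>, w) (x, \<xi>, w) + k * r (x, \<xi>, w) (x, \<xi>, w) < 0"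
        by (intro k(2)) (auto simp: zero_prod_def)
      moreover have "dissipation P \<gamma> ?L X (V ** E) ?Z x \<xi> w = q (x, \<xi>, w) (x, \<xi>, w) + k * r (x, \<xi>, w) (x, \<xi>, w)"
        unfolding dissipation_def grad vecs(1) Fctl
        by (simp add: q_def r_def f_def g_def h_def algebra_simps)
      ultimately show "dissipation P \<gamma> ?L X (V ** E) ?Z x \<xi> w < 0" by simp
    qed
  qed
qed

end

text \<open>Replaces \<open>C\<close> by C E and \<open>A\<close> by E A E - F. The uncontrollable
  directions then no longer reach the output, are not coupled to the rest, and decay at the same
  rate, so a reflection along one of them changes nothing.\<close>

lemma Kgamma_path_connected_uncontrollable:
  fixes P :: "('nx::finite, 'nw::finite, 'nu::finite, 'ny::finite, 'nz::finite) plant"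
  assumes K: "(D, C, B, A) \<in> Kgamma P \<gamma>" and unc: "\<not> controllable A B"
  shows "path_connected (Kgamma P \<gamma>)"
proof -
  obtain X V Z where c: "certificate P \<gamma> (D, C, B, A) X V Z"
    using K Kgamma_iff_certificate by blast
  obtain S where S: "subspace S" "S \<noteq> UNIV" "\<And>x. x \<in> S \<Longrightarrow> A *v x \<in> S" "\<And>u. B *v u \<in> S"
    using uncontrollable_invariant_subspace[OF unc] by metis
  obtain E where E: "transpose E = E" "\<And>x. E *v x \<in> S" "\<And>x. x \<in> S \<Longrightarrow> E *v x = x"
    using orthogonal_projection_matrix[OF S(1)] by metis
  have EE: "E *v (E *v x) = E *v x" for x using E by blast
  have AE: "A *v (E *v x) = E *v (A *v (E *v x))" for x using E S by metis
  have EB: "E *v (B *v u) = B *v u" for u using E S by blast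
  obtain y where "y \<notin> S" using S(2) by blast
  \<comment> \<open>The component of \<open>y\<close> orthogonal to \<open>S\<close>; reflecting
    along it leaves \<open>S\<close> pointwise fixed.\<close>
  define v where "v = y - E *v y"
  have v0: "v \<noteq> 0" using \<open>y \<notin> S\<close> E(2)[of y] by (auto simp: v_def)
  have Ev: "E *v v = 0" by (simp add: v_def matrix_vector_mult_diff_distrib EE)
  define F where "F = mat 1 - E"
  have Fv: "F *v x = x - E *v x" for x by (simp add: F_def matrix_vector_mult_diff_rdistrib)
  obtain Z2 where Z2: "transpose Z2 = Z2" "\<And>x. x \<noteq> 0 \<Longrightarrow> (Z2 *v x) \<bullet> x > 0"
    "\<And>\<xi>. F *v \<xi> \<noteq> 0 \<Longrightarrow> (Z2 *v (F *v \<xi>)) \<bullet> (F *v (A *v (F *v \<xi>))) < 0"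
    by (rule uncontrollable_lyapunov[OF c E(1) EE AE EB F_def]) blast
  define C1 where "C1 = C ** E"
  define A1 where "A1 = E ** A ** E - F"
  have C1: "C1 *v x = C *v (E *v x)" for x by (simp add: C1_def matrix_vector_mul_assoc)
  have A1: "A1 *v x = E *v (A *v (E *v x)) - F *v x" for x by (simp add: A1_def mat_vec_distribs)
  have FF: "F *v (A1 *v (F *v \<xi>)) = - (F *v \<xi>)" for \<xi>
    by (simp add: A1 Fv matrix_vector_mult_diff_distrib EE)
  have C1E: "C1 *v (E *v x) = C *v (E *v x)" for x by (simp add: C1 EE)
  have A1E: "A1 *v (E *v x) = A *v (E *v x)" for x
    using AE[of x] by (simp add: A1 EE Fv)
  have lyap1: "(Z2 *v (F *v \<xi>)) \<bullet> (F *v (A1 *v (F *v \<xi>))) < 0" if "F *v \<xi> \<noteq> 0" for \<xi>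
    using Z2(2)[OF that] by (simp add: FF)
  obtain Z1 where cK1: "certificate P \<gamma> (D, C1, B, A1) X (V ** E) Z1"
    using decoupled_certificate[OF c E(1) EE AE EB F_def Z2(1,2) C1E A1E lyap1] by blast
  have "\<gamma> > 0" using K Kgamma_iff_certificate by blast
  then have K1: "(D, C1, B, A1) \<in> Kgamma P \<gamma>" using cK1 Kgamma_iff_certificate by blast
  have vE: "v \<bullet> (E *v x) = 0" for x
    using symmetric_inner[OF E(1), of v x] Ev by simp
  let ?H = "householder v"
  have HE: "?H *v (E *v x) = E *v x" for x by (simp add: householder_vec vE)
  have EH: "E *v (?H *v x) = E *v x" for x
    by (simp add: householder_vec matrix_vector_mult_diff_distrib matrix_vector_mult_scaleR Ev)
  have HH: "?H *v (?H *v x) = x" for x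
    by (simp add: matrix_vector_mul_assoc householder_involutive[OF v0])
  have "?H ** B = B"
    by (simp add: matrix_eq matrix_vector_mul_assoc[symmetric]) (metis HE EB)
  moreover have "C1 ** ?H = C1"
    by (simp add: matrix_eq matrix_vector_mul_assoc[symmetric] C1 EH)
  moreover have "?H ** A1 ** ?H = A1"
    by (simp add: matrix_eq matrix_vector_mul_assoc[symmetric] A1 EH Fv matrix_vector_mult_diff_distrib HE HH)
  ultimately have "similar ?H (D, C1, B, A1) = (D, C1, B, A1)"
    by (simp add: similar_def matrix_inv_householder[OF v0])
  then show ?thesis by (rule Kgamma_path_connected_if_fixed[OF K1 v0])
qed

subsection \<open>Transposition\<close>

definition transpose_plant :: "('nx::finite, 'nw::finite, 'nu::finite, 'ny::finite, 'nz::finite) plant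
    \<Rightarrow> ('nx, 'nz, 'ny, 'nu, 'nw) plant" where
  "transpose_plant P = \<lparr>pA = transpose (pA P), pB1 = transpose (pC1 P), pB2 = transpose (pC2 P),
     pC1 = transpose (pB1 P), pD11 = transpose (pD11 P), pD12 = transpose (pD21 P),
     pC2 = transpose (pB2 P), pD21 = transpose (pD12 P)\<rparr>"

definition transpose_ctrl :: "('nx::finite, 'nu::finite, 'ny::finite) ctrl \<Rightarrow> ('nx, 'ny, 'nu) ctrl" where
  "transpose_ctrl K = (case K of (D, C, B, A) \<Rightarrow> (transpose D, transpose B, transpose C, transpose A))"

lemma transpose_plant_involutive: "transpose_plant (transpose_plant P) = P"
  by (simp add: transpose_plant_def)

lemma transpose_ctrl_involutive: "transpose_ctrl (transpose_ctrl K) = K"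
  by (simp add: transpose_ctrl_def split: prod.split)

lemma closed_loop_transpose:
  "Acl (transpose_plant P) (transpose_ctrl K) = transpose (Acl P K)"
  "Bcl (transpose_plant P) (transpose_ctrl K) = transpose (Ccl P K)"
  "Ccl (transpose_plant P) (transpose_ctrl K) = transpose (Bcl P K)"
  "Dcl (transpose_plant P) (transpose_ctrl K) = transpose (Dcl P K)"
proof -
  obtain D C B A where K: "K = (D, C, B, A)" by (cases K)
  note ts = transpose_add matrix_transpose_mul matrix_mul_assoc
  show "Acl (transpose_plant P) (transpose_ctrl K) = transpose (Acl P K)"
    by (simp add: K transpose_ctrl_def transpose_plant_def Acl_block transpose_block ts)
  show "Dcl (transpose_plant P) (transpose_ctrl K) = transpose (Dcl P K)"
    by (simp add: K transpose_ctrl_def transpose_plant_def Dcl_def ts)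
  have "transpose (Ccl P K) = (\<chi> i j. case i of
      Inl a \<Rightarrow> transpose (pC1 P + pD12 P ** D ** pC2 P) $ a $ j | Inr a \<Rightarrow> transpose (pD12 P ** C) $ a $ j)"
    by (auto simp: K Ccl_def transpose_def vec_eq_iff split: sum.split)
  then show "Bcl (transpose_plant P) (transpose_ctrl K) = transpose (Ccl P K)"
    by (simp add: K transpose_ctrl_def transpose_plant_def Bcl_def ts cong: sum.case_cong)
  have "transpose (Bcl P K) = (\<chi> i j. case j of
      Inl a \<Rightarrow> transpose (pB1 P + pB2 P ** D ** pD21 P) $ i $ a | Inr a \<Rightarrow> transpose (B ** pD21 P) $ i $ a)"
    by (auto simp: K Bcl_def transpose_def vec_eq_iff split: sum.split)
  then show "Ccl (transpose_plant P) (transpose_ctrl K) = transpose (Bcl P K)"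
    by (simp add: K transpose_ctrl_def transpose_plant_def Ccl_def ts cong: sum.case_cong)
qed

lemma cmat_transpose: "cmat (transpose M) = transpose (cmat M)"
  by (simp add: cmat_def transpose_def vec_eq_iff)

lemma transpose_mat_diff: "transpose (mat s - M) = mat s - transpose M" for M :: "'a::ab_group_add^'n^'n"
  by (auto simp: transpose_def vec_eq_iff mat_def)

text \<open>Invertibility passes to the transpose, so an eigenvalue of the transposed matrix is also
  one of \<open>M\<close>, with a possibly different eigenvector.\<close>

lemma hurwitz_transpose:
  assumes "hurwitz M" shows "hurwitz (transpose M)"
  unfolding hurwitz_def
proof (intro allI impI, elim conjE)
  fix lam :: complex and v :: "complex^'a" assume v: "v \<noteq> 0" "cmat (transpose M) *v v = lam *s v"
  have ms: "mat lam *v x = lam *s x" for x :: "complex^'a"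
    by (simp add: vec_eq_iff matrix_vector_mult_def mat_def if_distrib[of "\<lambda>c. c * _"] cong: if_cong)
  have "transpose (mat lam - cmat M) *v v = 0"
  proof -
    have "transpose (mat lam - cmat M) = mat lam - cmat (transpose M)"
      by (simp add: cmat_transpose transpose_mat_diff)
    then show ?thesis using v(2) by (simp only: matrix_vector_mult_diff_rdistrib ms) simp
  qed
  then have "\<not> invertible (mat lam - cmat M)"
    using invertible_transpose_field(1) invertible_kerD v(1) by blast
  then obtain x where x: "(mat lam - cmat M) *v x = 0" "x \<noteq> 0"
    using invertible_kerI by blast
  then have "cmat M *v x = lam *s x" by (simp add: matrix_vector_mult_diff_rdistrib ms)
  then show "Re lam < 0" using assms x(2) unfolding hurwitz_def by blast
qed

lemma transfer_fn_transpose: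
  assumes "hurwitz A"
  shows "transfer_fn (transpose A) (transpose C) (transpose B) (transpose D) \<omega>
    = transpose (transfer_fn A B C D \<omega>)"
proof -
  let ?s = "\<i> * complex_of_real \<omega>"
  have "mat ?s - cmat (transpose A) = transpose (mat ?s - cmat A)"
    by (simp add: cmat_transpose transpose_mat_diff)
  then show ?thesis
    by (simp add: transfer_fn_def invertible_transpose_field(2)[OF hurwitz_resolvent_invertible[OF assms]]
       transpose_add matrix_transpose_mul cmat_transpose matrix_mul_assoc)
qed

text \<open>The transpose is not the adjoint. With w = M^T v and y the conjugate of w, |w|^2 is the
  bilinear pairing of v with M y; conjugation preserves norms, so Cauchy-Schwarz applies as for
  adjoints.\<close>

lemma onorm_transpose_le:
  fixes M :: "complex^'n^'m"
  shows "onorm (\<lambda>v. transpose M *v v) \<le> onorm (\<lambda>v. M *v v)"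
proof (rule onorm_bound)
  show "onorm (\<lambda>v. M *v v) \<ge> 0" by (intro onorm_pos_le matrix_vector_mul_bounded_linear)
  fix v :: "complex^'m"
  define w where "w = transpose M *v v"
  define y where "y = (\<chi> j. cnj (w $ j))"
  have ic: "a \<bullet> b = Re (a * cnj b)" for a b :: complex by (simp add: inner_complex_def)
  have ncn: "norm (\<chi> i. cnj (y $ i)) = norm y" for y :: "complex^'k"
    by (simp add: norm_vec_def)
  have wj: "w $ j * c = (\<Sum>i\<in>UNIV. v $ i * (M $ i $ j * c))" for j c
    by (simp add: w_def matrix_vector_mult_def transpose_def sum_distrib_left mult_ac)
  have "(norm w)\<^sup>2 = w \<bullet> w" by (simp add: dot_square_norm)
  also have "\<dots> = Re (\<Sum>j\<in>UNIV. w $ j * y $ j)"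
    by (simp add: inner_vec_def ic y_def del: complex_mult_cnj)
  also have "(\<Sum>j\<in>UNIV. w $ j * y $ j) = (\<Sum>i\<in>UNIV. v $ i * (M *v y) $ i)"
    unfolding wj by (subst sum.swap) (simp add: matrix_vector_mult_def sum_distrib_left)
  also have "Re \<dots> = v \<bullet> (\<chi> i. cnj ((M *v y) $ i))"
    by (simp add: inner_vec_def ic)
  also have "\<dots> \<le> norm v * norm (\<chi> i. cnj ((M *v y) $ i))"
    by (rule norm_cauchy_schwarz)
  also have "\<dots> \<le> norm v * (onorm (\<lambda>v. M *v v) * norm w)"
    using onorm[OF matrix_vector_mul_bounded_linear[of M], of y]
    by (intro mult_left_mono) (simp_all add: ncn y_def)
  finally have "norm w * norm w \<le> (onorm (\<lambda>v. M *v v) * norm v) * norm w"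
    by (simp add: power2_eq_square mult_ac)
  moreover have "onorm (\<lambda>v. M *v v) \<ge> 0" by (intro onorm_pos_le matrix_vector_mul_bounded_linear)
  ultimately show "norm (transpose M *v v) \<le> onorm (\<lambda>v. M *v v) * norm v"
    unfolding w_def[symmetric] by (cases "w = 0") simp_all
qed

lemma onorm_transpose: "onorm (\<lambda>v. transpose M *v v) = onorm (\<lambda>v. M *v v)" for M :: "complex^'n^'m"
  using onorm_transpose_le[of M] onorm_transpose_le[of "transpose M"] by (simp only: transpose_transpose)

text \<open>The closed loop, and with it the transfer function at each frequency, is transposed;
  eigenvalues and operator norms do not change.\<close>

lemma Kgamma_transpose:
  assumes "K \<in> Kgamma P \<gamma>" shows "transpose_ctrl K \<in> Kgamma (transpose_plant P) \<gamma>"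
proof -
  have h: "hurwitz (Acl P K)" using assms by (simp add: Kgamma_def Cstab_def)
  have "hinf_norm (transpose_plant P) (transpose_ctrl K) = hinf_norm P K"
    unfolding hinf_norm_def Tzw_def transfer_fn_def[symmetric] closed_loop_transpose transfer_fn_transpose[OF h]
      onorm_transpose ..
  then show ?thesis
    using assms hurwitz_transpose[OF h] by (simp add: Kgamma_def Cstab_def closed_loop_transpose)
qed

lemma Kgamma_transpose_eq: "transpose_ctrl ` Kgamma P \<gamma> = Kgamma (transpose_plant P) \<gamma>"
proof (intro equalityI subsetI)
  fix L assume L: "L \<in> Kgamma (transpose_plant P) \<gamma>"
  have "transpose_ctrl L \<in> Kgamma P \<gamma>"
    using Kgamma_transpose[OF L] by (simp add: transpose_plant_involutive)
  then show "L \<in> transpose_ctrl ` Kgamma P \<gamma>"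
    by (metis image_eqI transpose_ctrl_involutive)
qed (use Kgamma_transpose in blast)

lemma continuous_on_transpose:
  fixes f :: "'t::topological_space \<Rightarrow> real^'n^'m"
  assumes "continuous_on S f" shows "continuous_on S (\<lambda>x. transpose (f x))"
  unfolding transpose_def by (intro continuous_on_vec_lambda continuous_on_component assms)

lemma path_connected_Kgamma_transpose:
  assumes "path_connected (Kgamma P \<gamma>)" shows "path_connected (Kgamma (transpose_plant P) \<gamma>)"
  unfolding Kgamma_transpose_eq[symmetric]
proof (rule path_connected_continuous_image[OF _ assms])
  show "continuous_on (Kgamma P \<gamma>) transpose_ctrl"
    unfolding transpose_ctrl_def case_prod_unfold
    by (intro continuous_intros continuous_on_transpose)
qed

section \<open>Duality of controllability and observability\<close>

lemma mpow_commute_vec: "mpow A k *v (A *v x) = A *v (mpow A k *v x)" for A :: "real^'n^'n"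
  by (induction k) (simp_all add: mpow_Suc, simp add: mpow_def)

lemma transpose_mpow: "transpose (mpow A k) = mpow (transpose A) k" for A :: "real^'n^'n"
proof (induction k)
  case (Suc k)
  have "transpose (mpow A (Suc k)) *v x = mpow (transpose A) (Suc k) *v x" for x
  proof -
    have "mpow A (Suc k) = A ** mpow A k" by (simp add: mpow_def)
    then have "transpose (mpow A (Suc k)) *v x = mpow (transpose A) k *v (transpose A *v x)"
      by (simp only: matrix_transpose_mul Suc matrix_vector_mul_assoc)
    then show ?thesis by (simp only: mpow_commute_vec mpow_Suc)
  qed
  then show ?case unfolding matrix_eq by blast
qed (simp add: mpow_def transpose_mat)

text \<open>By \<open>ip\<close>, the vectors annihilated by all C A^k with k < n form the
  orthogonal complement of the controllable span of the transposed pair.\<close>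

lemma controllable_transpose_iff:
  fixes A :: "real^'n^'n" and C :: "real^'n^'p"
  shows "controllable (transpose A) (transpose C) \<longleftrightarrow> observable C A"
proof -
  let ?G = "{mpow (transpose A) k *v (transpose C *v u) | k u. k < CARD('n)}"
  have ip: "(mpow (transpose A) k *v (transpose C *v u)) \<bullet> x = u \<bullet> (C *v (mpow A k *v x))" for k u x
  proof -
    have "(mpow (transpose A) k *v (transpose C *v u)) \<bullet> x = (transpose C *v u) \<bullet> (mpow A k *v x)"
      using inner_transpose[of "mpow (transpose A) k" "transpose C *v u" x] by (simp only: transpose_mpow transpose_transpose)
    also have "\<dots> = u \<bullet> (C *v (mpow A k *v x))"
      using inner_transpose[of "transpose C" u "mpow A k *v x"] by (simp only: transpose_transpose)
    finally show ?thesis .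
  qed
  show ?thesis
  proof
    assume c: "controllable (transpose A) (transpose C)"
    show "observable C A" unfolding observable_def
    proof (intro allI impI)
      fix x assume x: "\<forall>k<CARD('n). C *v (mpow A k *v x) = 0"
      have "x \<in> span ?G" using c by (simp add: controllable_def)
      then have "orthogonal x x"
        by (rule orthogonal_to_span) (use x ip in \<open>auto simp: orthogonal_def inner_commute\<close>)
      then show "x = 0" by (simp add: orthogonal_def)
    qed
  next
    assume o: "observable C A"
    show "controllable (transpose A) (transpose C)"
    proof (rule ccontr)
      assume "\<not> ?thesis"
      then have "span ?G \<noteq> UNIV" unfolding controllable_def .
      then have "span ?G \<subset> span UNIV" unfolding span_UNIV by (rule psubsetI[OF subset_UNIV])
      then have "\<exists>x. x \<noteq> 0 \<and> (\<forall>y. y \<in> span ?G \<longrightarrow> orthogonal x y)"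
      proof (rule orthogonal_to_subspace_exists_gen)
        fix x assume "x \<noteq> 0" "\<And>y. y \<in> span ?G \<Longrightarrow> orthogonal x y"
        then show ?thesis by (intro exI[of _ x]) simp
      qed
      then obtain x where x: "x \<noteq> 0" "\<And>y. y \<in> span ?G \<Longrightarrow> orthogonal x y" by (elim exE conjE) simp
      have "C *v (mpow A k *v x) = 0" if "k < CARD('n)" for k
      proof -
        let ?u = "C *v (mpow A k *v x)"
        have "mpow (transpose A) k *v (transpose C *v ?u) \<in> span ?G"
          by (intro span_base) (use that in blast)
        from x(2)[OF this] have "?u \<bullet> ?u = 0"
          using ip[of k ?u x] by (simp add: orthogonal_def inner_commute)
        then show ?thesis by simp
      qed
      then show False using o x(1) unfolding observable_def by blast
    qed
  qed
qed

lemma path_connected_if_nonminimal: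
  assumes "K \<in> Kgamma P \<gamma>" "nonminimal K"
  shows "path_connected (Kgamma P \<gamma>)"
proof -
  obtain D C B A where K: "K = (D, C, B, A)" by (cases K)
  show ?thesis
  proof (cases "controllable A B")
    case False
    then show ?thesis using Kgamma_path_connected_uncontrollable assms(1) K by blast
  next
    case True
    then have "\<not> controllable (transpose A) (transpose C)"
      using assms(2) by (simp add: K nonminimal_def controllable_transpose_iff)
    moreover have "(transpose D, transpose B, transpose C, transpose A) \<in> Kgamma (transpose_plant P) \<gamma>"
      using Kgamma_transpose[OF assms(1)] by (simp add: K transpose_ctrl_def)
    ultimately have "path_connected (Kgamma (transpose_plant P) \<gamma>)"
      using Kgamma_path_connected_uncontrollable by blast
    from path_connected_Kgamma_transpose[OF this] show ?thesis
      by (simp add: transpose_plant_involutive)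
  qed
qed

subsection \<open>Controllers of single-output plants\<close>

text \<open>The controllability matrix for input \<open>j\<close>, made square: the index type
  carries no order, so \<open>h\<close> assigns to each column the power of \<open>A\<close> it
  contains.\<close>

definition ctrb_matrix :: "('n \<Rightarrow> nat) \<Rightarrow> 'm \<Rightarrow> real^'n^'n \<Rightarrow> real^'m^'n \<Rightarrow> real^'n^'n" where
  "ctrb_matrix h j A B = (\<chi> i k. (mpow A (h k) ** B) $ i $ j)"

lemma column_ctrb_matrix: "column k (ctrb_matrix h j A B) = mpow A (h k) *v (B *v axis j 1)"
  by (simp add: column_def ctrb_matrix_def vec_eq_iff matrix_vector_mul_assoc matrix_vector_mul_component inner_axis)

text \<open>With one input every vector \<open>u\<close> is a multiple of the axis vector of
  \<open>j\<close>, so the columns already span the controllable space.\<close>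

lemma det_ctrb_matrix_nonzero:
  fixes A :: "real^'n^'n" and B :: "real^'m^'n"
  assumes h: "bij_betw h UNIV {..<CARD('n)}" and m: "CARD('m) = 1" and c: "controllable A B"
  shows "det (ctrb_matrix h j A B) \<noteq> 0"
proof -
  let ?W = "ctrb_matrix h j A B"
  have Uj: "UNIV = {j}" using m by (metis UNIV_I card_1_singletonE singletonD)
  have "mpow A k *v (B *v u) \<in> span (columns ?W)" if "k < CARD('n)" for k u
  proof -
    have "k \<in> h ` UNIV" using h that by (simp add: bij_betw_def)
    then obtain l where l: "h l = k" by blast
    have all: "i = j" for i using Uj by (metis UNIV_I singletonD)
    have "u = (u $ j) *\<^sub>R axis j 1"
    proof (unfold vec_eq_iff, rule allI)
      fix i show "u $ i = ((u $ j) *\<^sub>R axis j 1) $ i" by (subst (1 2) all[of i]) simp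
    qed
    then have "mpow A k *v (B *v u) = mpow A k *v (B *v ((u $ j) *\<^sub>R axis j 1))" by simp
    also have "\<dots> = (u $ j) *\<^sub>R column l ?W"
      unfolding column_ctrb_matrix l by (simp only: matrix_vector_mult_scaleR)
    finally show ?thesis
      by (simp only:) (intro span_scale span_base, auto simp: columns_def)
  qed
  then have "{mpow A k *v (B *v u) | k u. k < CARD('n)} \<subseteq> span (columns ?W)" by blast
  then have "span {mpow A k *v (B *v u) | k u. k < CARD('n)} \<subseteq> span (columns ?W)"
    by (rule span_minimal) (rule subspace_span)
  then have "UNIV \<subseteq> span (columns ?W)"
    unfolding c[unfolded controllable_def] .
  then have "span (columns ?W) = UNIV" by (rule equalityI[OF subset_UNIV])
  then have "\<exists>R. ?W ** R = mat 1"
    unfolding matrix_right_invertible_span_columns span_vec_eq .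
  then show ?thesis using invertible_right_inverse invertible_det_nz by blast
qed

lemma mpow_similar:
  fixes A R :: "real^'n^'n"
  assumes R: "invertible R"
  shows "mpow (R ** A ** matrix_inv R) k *v (R *v x) = R *v (mpow A k *v x)"
proof (induction k)
  case (Suc k)
  show ?case unfolding mpow_Suc Suc
    by (simp add: matrix_vector_mul_assoc[symmetric] matrix_inv_vec[OF R])
qed (simp add: mpow_def)

lemma ctrb_matrix_similar:
  fixes A R :: "real^'n^'n"
  assumes R: "invertible R"
  shows "ctrb_matrix h j (R ** A ** matrix_inv R) (R ** B) = R ** ctrb_matrix h j A B"
proof -
  have "column k (ctrb_matrix h j (R ** A ** matrix_inv R) (R ** B)) = column k (R ** ctrb_matrix h j A B)" for k
  proof -
    have "column k (R ** M) = R *v column k M" for M :: "real^'n^'n"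
      by (simp add: column_def matrix_matrix_mult_def matrix_vector_mult_def vec_eq_iff)
    then show ?thesis
      by (simp add: column_ctrb_matrix mpow_similar[OF R] matrix_vector_mul_assoc[symmetric])
  qed
  then show ?thesis by (simp add: column_def vec_eq_iff)
qed

lemma continuous_on_mpow:
  fixes f :: "'t::topological_space \<Rightarrow> real^'n^'n"
  assumes "continuous_on S f" shows "continuous_on S (\<lambda>x. mpow (f x) k)"
proof (induction k)
  case (Suc k)
  have "mpow M (Suc k) = M ** mpow M k" for M :: "real^'n^'n" by (simp add: mpow_def)
  then show ?case using Suc assms by (simp add: continuous_on_matrix_mult)
qed (simp add: mpow_def)

lemma det_householder_axis: "det (householder (axis k 1)) = - 1"
proof -
  have "det (householder (axis k 1)) = (\<Prod>i\<in>UNIV. if i = k then - 1 else 1)"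
    unfolding householder_axis by (simp add: det_diagonal)
  then show ?thesis by simp
qed

text \<open>A coordinate change multiplies the controllability matrix from the left, so an axis
  reflection reverses the sign of its determinant \<phi>. The connected image of \<phi> contains a
  value and its negative, hence 0.\<close>

lemma exists_uncontrollable:
  fixes P :: "('nx::finite, 'nw::finite, 'nu::finite, 'ny::finite, 'nz::finite) plant"
  assumes y: "CARD('ny) = 1" and pc: "path_connected (Kgamma P \<gamma>)" and ne: "Kgamma P \<gamma> \<noteq> {}"
  shows "\<exists>D C B A. (D, C, B, A) \<in> Kgamma P \<gamma> \<and> \<not> controllable A B"
proof (rule ccontr)
  assume "\<not> ?thesis"
  then have all: "controllable A B" if "(D, C, B, A) \<in> Kgamma P \<gamma>" for D C B A using that by blast
  obtain h :: "'nx \<Rightarrow> nat" where h: "bij_betw h UNIV {..<CARD('nx)}"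
    using ex_bij_betw_finite_nat[of "UNIV :: 'nx set"] by (auto simp: atLeast0LessThan)
  \<comment> \<open>Index types are inhabited and the goal mentions neither variable, so arbitrary
    indices may be fixed.\<close>
  fix j :: 'ny and k :: 'nx
  define \<phi> where "\<phi> K = (case K of (D, C, B, A) \<Rightarrow> det (ctrb_matrix h j A B))" for K :: "('nx, 'nu, 'ny) ctrl"
  have nz: "\<phi> K \<noteq> 0" if "K \<in> Kgamma P \<gamma>" for K
  proof -
    obtain D C B A where K: "K = (D, C, B, A)" by (cases K)
    show ?thesis using det_ctrb_matrix_nonzero[OF h y all] that by (simp add: K \<phi>_def)
  qed
  have "continuous_on (Kgamma P \<gamma>) \<phi>"
    unfolding \<phi>_def case_prod_unfold ctrb_matrix_def
    by (intro continuous_on_det continuous_on_vec_lambda continuous_on_component continuous_on_matrix_mult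
      continuous_on_mpow continuous_intros)
  then have conn: "connected (\<phi> ` Kgamma P \<gamma>)"
    by (intro connected_continuous_image path_connected_imp_connected pc)
  obtain K where K: "K \<in> Kgamma P \<gamma>" using ne by blast
  let ?R = "householder (axis k 1) :: real^'nx^'nx"
  have R: "invertible ?R" by (rule invertible_householder) (simp add: axis_eq_0_iff)
  have sK: "similar ?R K \<in> Kgamma P \<gamma>" by (rule Kgamma_similar[OF R K])
  have "\<phi> (similar ?R K) = - \<phi> K"
    by (simp add: \<phi>_def similar_def ctrb_matrix_similar[OF R] det_mul det_householder_axis split: prod.split)
  then have "\<phi> K \<in> \<phi> ` Kgamma P \<gamma>" "- \<phi> K \<in> \<phi> ` Kgamma P \<gamma>"
    using K sK by (auto intro: rev_image_eqI)
  then have "0 \<in> \<phi> ` Kgamma P \<gamma>"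
    using connectedD_interval[OF conn, of "\<phi> K" "- \<phi> K" 0] connectedD_interval[OF conn, of "- \<phi> K" "\<phi> K" 0]
    by (cases "\<phi> K \<ge> 0") auto
  then show False using nz by force
qed

section \<open>Existence of a stabilizing controller\<close>

lemma Cstab_nonempty:
  fixes P :: "('nx::finite, 'nw::finite, 'nu::finite, 'ny::finite, 'nz::finite) plant"
  assumes "stabilizable (pA P) (pB2 P)" "detectable (pC2 P) (pA P)"
  shows "Cstab P \<noteq> {}"
proof -
  let ?A = "pA P" and ?B = "pB2 P" and ?C = "pC2 P"
  obtain F where F: "hurwitz (?A + ?B ** F)" using assms(1) by (auto simp: stabilizable_def)
  obtain L where L: "hurwitz (?A + L ** ?C)" using assms(2) by (auto simp: detectable_def)
  \<comment> \<open>The observer-based controller. The error x - \<xi> evolves under A + L C2; on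
    modes without error, \<xi> = x and the state evolves under A + B2 F.\<close>
  let ?K = "(0, F, - L, ?A + ?B ** F + L ** ?C)"
  have cl: "Acl P ?K *v join x \<xi> = join (?A *v x + ?B *v (F *v \<xi>))
      (- (L *v (?C *v x)) + (?A *v \<xi> + ?B *v (F *v \<xi>) + L *v (?C *v \<xi>)))" for x \<xi>
    by (simp add: Acl_block block_mult mat_vec_distribs uminus_matrix_mult uminus_matrix_vec)
  have "hurwitz (Acl P ?K)"
    unfolding hurwitz_iff
  proof (intro allI impI, elim conjE)
    fix \<sigma> \<omega> :: real and a b
    assume nz: "a \<noteq> 0 \<or> b \<noteq> 0" and a: "Acl P ?K *v a = \<sigma> *\<^sub>R a - \<omega> *\<^sub>R b"
      and b: "Acl P ?K *v b = \<omega> *\<^sub>R a + \<sigma> *\<^sub>R b"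
    obtain x1 \<xi>1 where a1: "a = join x1 \<xi>1" by (rule join_cases)
    obtain x2 \<xi>2 where b1: "b = join x2 \<xi>2" by (rule join_cases)
    have sc: "c *\<^sub>R join x y = join (c *\<^sub>R x) (c *\<^sub>R y)" for c and x y :: "real^'nx"
      by (auto simp: join_def vec_eq_iff split: sum.split)
    have df: "join x y - join x' y' = join (x - x') (y - y')" for x y x' y' :: "real^'nx"
      by (auto simp: join_def vec_eq_iff split: sum.split)
    have e: "?A *v x1 + ?B *v (F *v \<xi>1) = \<sigma> *\<^sub>R x1 - \<omega> *\<^sub>R x2"
      "- (L *v (?C *v x1)) + (?A *v \<xi>1 + ?B *v (F *v \<xi>1) + L *v (?C *v \<xi>1)) = \<sigma> *\<^sub>R \<xi>1 - \<omega> *\<^sub>R \<xi>2"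
      "?A *v x2 + ?B *v (F *v \<xi>2) = \<omega> *\<^sub>R x1 + \<sigma> *\<^sub>R x2"
      "- (L *v (?C *v x2)) + (?A *v \<xi>2 + ?B *v (F *v \<xi>2) + L *v (?C *v \<xi>2)) = \<omega> *\<^sub>R \<xi>1 + \<sigma> *\<^sub>R \<xi>2"
      using a b unfolding a1 b1 cl sc df join_add by simp_all
    have err: "(?A + L ** ?C) *v (x1 - \<xi>1) = \<sigma> *\<^sub>R (x1 - \<xi>1) - \<omega> *\<^sub>R (x2 - \<xi>2)"
      "(?A + L ** ?C) *v (x2 - \<xi>2) = \<omega> *\<^sub>R (x1 - \<xi>1) + \<sigma> *\<^sub>R (x2 - \<xi>2)"
    proof -
      have "(?A + L ** ?C) *v (x - \<xi>) = (?A *v x + ?B *v (F *v \<xi>))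
        - (- (L *v (?C *v x)) + (?A *v \<xi> + ?B *v (F *v \<xi>) + L *v (?C *v \<xi>)))" for x \<xi>
        by (simp add: mat_vec_distribs)
      then show "(?A + L ** ?C) *v (x1 - \<xi>1) = \<sigma> *\<^sub>R (x1 - \<xi>1) - \<omega> *\<^sub>R (x2 - \<xi>2)"
        "(?A + L ** ?C) *v (x2 - \<xi>2) = \<omega> *\<^sub>R (x1 - \<xi>1) + \<sigma> *\<^sub>R (x2 - \<xi>2)"
        by (simp_all only: e) (simp_all add: algebra_simps)
    qed
    show "\<sigma> < 0"
    proof (cases "x1 - \<xi>1 \<noteq> 0 \<or> x2 - \<xi>2 \<noteq> 0")
      case True
      then show ?thesis using L err unfolding hurwitz_iff by blast
    next
      case False
      then have "\<xi>1 = x1" "\<xi>2 = x2" by simp_all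
      then have "(?A + ?B ** F) *v x1 = \<sigma> *\<^sub>R x1 - \<omega> *\<^sub>R x2" "(?A + ?B ** F) *v x2 = \<omega> *\<^sub>R x1 + \<sigma> *\<^sub>R x2"
        "x1 \<noteq> 0 \<or> x2 \<noteq> 0"
        using e(1,3) nz by (auto simp: mat_vec_distribs a1 b1)
      then show ?thesis using F unfolding hurwitz_iff by blast
    qed
  qed
  then show ?thesis by (auto simp: Cstab_def)
qed

theorem theorem3:
  fixes P :: "('nx::finite, 'nw::finite, 'nu::finite, 'ny::finite, 'nz::finite) plant"
    and \<gamma> :: real
  assumes "stabilizable (pA P) (pB2 P)"
    and "detectable (pC2 P) (pA P)"
    and "\<gamma> > gamma_opt P"
  shows "((\<exists>K \<in> Kgamma P \<gamma>. nonminimal K) \<longrightarrow> path_connected (Kgamma P \<gamma>))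
    \<and> ((CARD('nu) = 1 \<or> CARD('ny) = 1) \<longrightarrow>
         (path_connected (Kgamma P \<gamma>) \<longleftrightarrow> (\<exists>K \<in> Kgamma P \<gamma>. nonminimal K)))"
proof -
  \<comment> \<open>A real infimum below \<gamma> yields an element below \<gamma> only if the set
    is nonempty, which stabilizability and detectability ensure.\<close>
  have "\<exists>x\<in>hinf_norm P ` Cstab P. x < \<gamma>"
    using cInf_lessD[of "hinf_norm P ` Cstab P" \<gamma>] assms(3) Cstab_nonempty[OF assms(1,2)]
    unfolding gamma_opt_def by blast
  then have ne: "Kgamma P \<gamma> \<noteq> {}" by (auto simp: Kgamma_def)
  have part1: "path_connected (Kgamma P \<gamma>)" if "\<exists>K \<in> Kgamma P \<gamma>. nonminimal K"
    using that path_connected_if_nonminimal by blast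
  have "\<exists>K \<in> Kgamma P \<gamma>. nonminimal K" if card: "CARD('nu) = 1 \<or> CARD('ny) = 1" and pc: "path_connected (Kgamma P \<gamma>)"
  proof (cases "CARD('ny) = 1")
    case True
    obtain D C B A where "(D, C, B, A) \<in> Kgamma P \<gamma>" "\<not> controllable A B"
      using exists_uncontrollable[OF True pc ne] by blast
    then show ?thesis by (intro bexI[of _ "(D, C, B, A)"]) (simp_all add: nonminimal_def)
  next
    case False
    then have u: "CARD('nu) = 1" using card by blast
    \<comment> \<open>A single-input plant becomes single-output by transposition, and an
      uncontrollable controller found there is transposed back to an unobservable one.\<close>
    have "Kgamma (transpose_plant P) \<gamma> \<noteq> {}"
      using ne by (simp flip: Kgamma_transpose_eq)
    then obtain D C B A where K: "(D, C, B, A) \<in> Kgamma (transpose_plant P) \<gamma>" "\<not> controllable A B"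
      using exists_uncontrollable[OF u path_connected_Kgamma_transpose[OF pc]] by blast
    have "transpose_ctrl (D, C, B, A) \<in> Kgamma P \<gamma>"
      using Kgamma_transpose[OF K(1)] by (simp add: transpose_plant_involutive)
    moreover have "nonminimal (transpose_ctrl (D, C, B, A))"
      using K(2) controllable_transpose_iff[of "transpose A" "transpose B"]
      by (simp add: nonminimal_def transpose_ctrl_def)
    ultimately show ?thesis by blast
  qed
  then show ?thesis using part1 by blast
qed

end
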